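(* Let $\nu_1,\nu_2>0$ and $T>0$. Any Leray–Hopf weak solution $(u,B)$ on $\mathbb{T}^3\times(0,T)$ (in the sense given in the context) of the viscous and resistive MHD equations $$\partial_tu-\nu_1\Delta u+u\cdot\nabla u-B\cdot\nabla B+\nabla p=0,\quad\partial_tB-\nu_2\Delta B+u\cdot\nabla B-B\cdot\nabla u=0,\quad\nabla\cdot u=0,$$ with the property that $\mathrm{div}\,B_0=0$, satisfies $\mathrm{div}\,B\equiv0$.
   Context: $\mathbb{T}^3$ is the three-dimensional torus, $\mathcal{D}$ denotes $C_c^\infty$. $(a\otimes b)_{ij}=a_ib_j$, $(\nabla\psi)_{ij}=\partial_i\psi_j$, $M:N=\sum_{i,j}M_{ij}N_{ij}$, $\mathrm{div}\,B=\nabla\cdot B$ (not assumed to vanish in the definition below). $\nu_1$ is the viscosity, $\nu_2$ the resistivity, $u$ the velocity field, $B$ the magnetic field and $p$ the pressure. A pair $(u,B)$ is called a Leray–Hopf weak solution of the viscous and resistive MHD equations if $u,\,B,\,\mathrm{div}\,B\in L^\infty((0,T);L^2(\mathbb{T}^3))\cap L^2((0,T);H^1(\mathbb{T}^3))$ and $$\int_0^T\!\!\int_{\mathbb{T}^3}\big[u\cdot\partial_t\psi_1-\nu_1\nabla u:\nabla\psi_1+u\otimes u:\nabla\psi_1-B\otimes B:\nabla\psi_1-(\mathrm{div}\,B)\,B\cdot\psi_1\big]dx\,dt=0,$$ $$\int_0^T\!\!\int_{\mathbb{T}^3}\big[B\cdot\partial_t\psi_2-\nu_2\nabla B:\nabla\psi_2+u\otimes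 B:\nabla\psi_2-B\otimes u:\nabla\psi_2-(\mathrm{div}\,B)\,u\cdot\psi_2\big]dx\,dt=0,$$ $$\int_0^T\!\!\int_{\mathbb{T}^3}u\cdot\nabla\varphi\,dx\,dt=0,$$ for all divergence-free $\psi_1,\psi_2\in\mathcal{D}(\mathbb{T}^3\times(0,T);\mathbb{R}^3)$ and all $\varphi\in\mathcal{D}(\mathbb{T}^3\times(0,T);\mathbb{R})$. Moreover, the solution is assumed to attain the initial data $u_0,B_0\in L^2(\mathbb{T}^3)$ strongly in $L^2(\mathbb{T}^3)$, where $u_0$ is also assumed to be weakly divergence-free.
   Formalization: The induction equation is tested with all smooth fields ψ₂, not only divergence-free ones; with divergence-free ψ₂ the claim fails, e.g. u=0, B=t∇h(x), u₀=B₀=0, h smooth and nonconstant, where div B=tΔh≠0. *)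

theory Defs
  imports "HOL-Analysis.Analysis"
begin

text \<open>
  The torus is \<open>\<real>\<^sup>3/\<int>\<^sup>3\<close>: functions on it are functions on \<^typ>\<open>real^3\<close> with period 1 in each
  coordinate, and integrals over it are integrals over the unit cell.
\<close>

definition periodic :: "(real^3 \<Rightarrow> 'b) \<Rightarrow> bool" where
  "periodic f \<longleftrightarrow> (\<forall>x i. f (x + axis i 1) = f x)"

abbreviation torus_cell :: "(real^3) set" where
  "torus_cell \<equiv> cbox 0 1"

abbreviation torus :: "(real^3) measure" where
  "torus \<equiv> lebesgue_on torus_cell"


section \<open>Smooth functions and classical differential operators\<close>

fun C_k :: "nat \<Rightarrow> ('a::euclidean_space \<Rightarrow> 'b::real_normed_vector) \<Rightarrow> bool" where
  "C_k 0 f \<longleftrightarrow> continuous_on UNIV f"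
| "C_k (Suc k) f \<longleftrightarrow> f differentiable_on UNIV \<and>
     (\<forall>b\<in>Basis. C_k k (\<lambda>x. frechet_derivative f (at x) b))"

definition smooth :: "('a::euclidean_space \<Rightarrow> 'b::real_normed_vector) \<Rightarrow> bool" where
  "smooth f \<longleftrightarrow> (\<forall>k. C_k k f)"

text \<open>
  \<open>grad f x $ i\<close> is the \<open>i\<close>-th partial derivative. For a vector field the derivative index comes
  first, i.e. \<open>grad \<psi> x $ i $ j\<close> is the \<open>i\<close>-th partial derivative of \<open>\<psi>\<^sub>j\<close>. The contraction
  \<open>M : N\<close> of two matrices is the inner product \<open>M \<bullet> N\<close> of the type \<^typ>\<open>real^3^3\<close>.
\<close>

definition grad :: "(real^3 \<Rightarrow> 'b::real_normed_vector) \<Rightarrow> real^3 \<Rightarrow> 'b^3" where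
  "grad f x = (\<chi> i. frechet_derivative f (at x) (axis i 1))"

definition dive :: "(real^3 \<Rightarrow> real^3) \<Rightarrow> real^3 \<Rightarrow> real" where
  "dive f x = trace (grad f x)"

definition dt :: "(real \<Rightarrow> real^3 \<Rightarrow> 'b::real_normed_vector) \<Rightarrow> real \<Rightarrow> real^3 \<Rightarrow> 'b" where
  "dt f t x = vector_derivative (\<lambda>s. f s x) (at t)"

definition outer :: "real^3 \<Rightarrow> real^3 \<Rightarrow> real^3^3" where
  "outer a b = (\<chi> i j. a $ i * b $ j)"

text \<open>Since the torus is compact, compact support only restricts the time variable.\<close>

definition test_fun :: "real \<Rightarrow> (real \<Rightarrow> real^3 \<Rightarrow> 'b::real_normed_vector) \<Rightarrow> bool" where
  "test_fun T \<phi> \<longleftrightarrow> smooth (\<lambda>(t, x). \<phi> t x) \<and> (\<forall>t. periodic (\<phi> t)) \<and>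
     (\<exists>a b. 0 < a \<and> b < T \<and> (\<forall>t x. t \<notin> {a..b} \<longrightarrow> \<phi> t x = 0))"


section \<open>Function spaces on the torus\<close>

definition L2_torus :: "(real^3 \<Rightarrow> 'b::euclidean_space) \<Rightarrow> bool" where
  "L2_torus f \<longleftrightarrow> periodic f \<and> f \<in> borel_measurable torus \<and>
     integrable torus (\<lambda>x. (norm (f x))\<^sup>2)"

text \<open>\<open>f \<in> H\<^sup>1\<close> with weak gradient \<open>G\<close>.\<close>

definition has_weak_grad ::
    "(real^3 \<Rightarrow> 'b::euclidean_space) \<Rightarrow> (real^3 \<Rightarrow> 'b^3) \<Rightarrow> bool" where
  "has_weak_grad f G \<longleftrightarrow> L2_torus f \<and> L2_torus G \<and>
     (\<forall>\<phi>::real^3 \<Rightarrow> real. smooth \<phi> \<and> periodic \<phi> \<longrightarrow>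
       (\<forall>i. (LINT x|torus. (grad \<phi> x $ i) *\<^sub>R f x) = - (LINT x|torus. \<phi> x *\<^sub>R (G x $ i))))"

definition has_weak_div :: "(real^3 \<Rightarrow> real^3) \<Rightarrow> (real^3 \<Rightarrow> real) \<Rightarrow> bool" where
  "has_weak_div f d \<longleftrightarrow> L2_torus f \<and> L2_torus d \<and>
     (\<forall>\<phi>::real^3 \<Rightarrow> real. smooth \<phi> \<and> periodic \<phi> \<longrightarrow>
       (LINT x|torus. f x \<bullet> grad \<phi> x) = - (LINT x|torus. d x * \<phi> x))"


section \<open>Time-dependent functions\<close>

definition st_measurable :: "real \<Rightarrow> (real \<Rightarrow> real^3 \<Rightarrow> 'b::euclidean_space) \<Rightarrow> bool" where
  "st_measurable T f \<longleftrightarrow>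
     (\<lambda>(t, x). f t x) \<in> borel_measurable (lebesgue_on ({0<..<T} \<times> torus_cell))"

definition Linf_L2 :: "real \<Rightarrow> (real \<Rightarrow> real^3 \<Rightarrow> 'b::euclidean_space) \<Rightarrow> bool" where
  "Linf_L2 T f \<longleftrightarrow> st_measurable T f \<and>
     (AE t in lebesgue_on {0<..<T}. L2_torus (f t)) \<and>
     (\<exists>C. AE t in lebesgue_on {0<..<T}. (LINT x|torus. (norm (f t x))\<^sup>2) \<le> C)"

definition spatial_grad ::
    "real \<Rightarrow> (real \<Rightarrow> real^3 \<Rightarrow> 'b::euclidean_space) \<Rightarrow> (real \<Rightarrow> real^3 \<Rightarrow> 'b^3) \<Rightarrow> bool" where
  "spatial_grad T f G \<longleftrightarrow> st_measurable T G \<and>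
     (AE t in lebesgue_on {0<..<T}. has_weak_grad (f t) (G t))"

definition spatial_div ::
    "real \<Rightarrow> (real \<Rightarrow> real^3 \<Rightarrow> real^3) \<Rightarrow> (real \<Rightarrow> real^3 \<Rightarrow> real) \<Rightarrow> bool" where
  "spatial_div T f d \<longleftrightarrow> st_measurable T d \<and>
     (AE t in lebesgue_on {0<..<T}. has_weak_div (f t) (d t))"

definition L2_H1 :: "real \<Rightarrow> (real \<Rightarrow> real^3 \<Rightarrow> 'b::euclidean_space) \<Rightarrow> bool" where
  "L2_H1 T f \<longleftrightarrow> st_measurable T f \<and>
     (\<exists>G. spatial_grad T f G \<and>
       integrable (lebesgue_on {0<..<T})
         (\<lambda>t. (LINT x|torus. (norm (f t x))\<^sup>2) + (LINT x|torus. (norm (G t x))\<^sup>2)))"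

text \<open>
  Elements of \<open>L\<^sup>\<infinity>(0,T;L\<^sup>2)\<close> are defined for almost every time only, so the limit
  \<open>t \<rightarrow> 0\<close> ignores null sets of times.
\<close>

definition attains_initial ::
    "real \<Rightarrow> (real \<Rightarrow> real^3 \<Rightarrow> real^3) \<Rightarrow> (real^3 \<Rightarrow> real^3) \<Rightarrow> bool" where
  "attains_initial T f f0 \<longleftrightarrow>
     (\<forall>\<epsilon>>0. \<exists>\<delta>>0. AE t in lebesgue_on {0<..<T}.
        t < \<delta> \<longrightarrow> sqrt (LINT x|torus. (norm (f t x - f0 x))\<^sup>2) < \<epsilon>)"


section \<open>Leray--Hopf weak solutions of the viscous and resistive MHD equations\<close>

text \<open>In the following, \<open>Du\<close>, \<open>DB\<close> and \<open>d\<close> stand for the weak \<open>\<nabla>u\<close>, \<open>\<nabla>B\<close> and \<open>div B\<close>.\<close>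

definition momentum_eq where
  "momentum_eq \<nu>\<^sub>1 T u Du B d \<longleftrightarrow>
     (\<forall>\<psi>::real \<Rightarrow> real^3 \<Rightarrow> real^3. test_fun T \<psi> \<and> (\<forall>t x. dive (\<psi> t) x = 0) \<longrightarrow>
       (LINT t|lebesgue_on {0<..<T}. LINT x|torus.
          u t x \<bullet> dt \<psi> t x - \<nu>\<^sub>1 * (Du t x \<bullet> grad (\<psi> t) x)
          + outer (u t x) (u t x) \<bullet> grad (\<psi> t) x
          - outer (B t x) (B t x) \<bullet> grad (\<psi> t) x
          - d t x * (B t x \<bullet> \<psi> t x)) = 0)"

text \<open>
  The induction equation contains no pressure, so it is tested with all vector fields \<open>\<psi>\<close>, not only
  with divergence-free ones. Divergence-free \<open>\<psi>\<close> would determine it only up to a gradient: for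
  smooth \<open>g\<close>, \<open>h\<close> with \<open>g(0) = 0\<close>, the pair \<open>u = 0\<close>, \<open>B = g(t) \<nabla>h(x)\<close> with initial data \<open>0\<close> would
  satisfy everything below (as \<open>B \<cdot> \<nabla>B = \<nabla>(|B|\<^sup>2/2)\<close>), although \<open>div B = g \<Delta>h\<close> need not vanish.
\<close>

definition induction_eq where
  "induction_eq \<nu>\<^sub>2 T u B DB d \<longleftrightarrow>
     (\<forall>\<psi>::real \<Rightarrow> real^3 \<Rightarrow> real^3. test_fun T \<psi> \<longrightarrow>
       (LINT t|lebesgue_on {0<..<T}. LINT x|torus.
          B t x \<bullet> dt \<psi> t x - \<nu>\<^sub>2 * (DB t x \<bullet> grad (\<psi> t) x)
          + outer (u t x) (B t x) \<bullet> grad (\<psi> t) x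
          - outer (B t x) (u t x) \<bullet> grad (\<psi> t) x
          - d t x * (u t x \<bullet> \<psi> t x)) = 0)"

definition incompressibility where
  "incompressibility T u \<longleftrightarrow>
     (\<forall>\<phi>::real \<Rightarrow> real^3 \<Rightarrow> real. test_fun T \<phi> \<longrightarrow>
       (LINT t|lebesgue_on {0<..<T}. LINT x|torus. u t x \<bullet> grad (\<phi> t) x) = 0)"

definition leray_hopf_mhd ::
    "real \<Rightarrow> real \<Rightarrow> real \<Rightarrow> (real^3 \<Rightarrow> real^3) \<Rightarrow> (real^3 \<Rightarrow> real^3) \<Rightarrow>
     (real \<Rightarrow> real^3 \<Rightarrow> real^3) \<Rightarrow> (real \<Rightarrow> real^3 \<Rightarrow> real^3) \<Rightarrow> bool" where
  "leray_hopf_mhd \<nu>\<^sub>1 \<nu>\<^sub>2 T u0 B0 u B \<longleftrightarrow>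
     Linf_L2 T u \<and> L2_H1 T u \<and> Linf_L2 T B \<and> L2_H1 T B \<and>
     (\<exists>Du DB d. spatial_grad T u Du \<and> spatial_grad T B DB \<and> spatial_div T B d \<and>
        Linf_L2 T d \<and> L2_H1 T d \<and>
        momentum_eq \<nu>\<^sub>1 T u Du B d \<and> induction_eq \<nu>\<^sub>2 T u B DB d) \<and>
     incompressibility T u \<and>
     L2_torus u0 \<and> L2_torus B0 \<and> has_weak_div u0 (\<lambda>x. 0) \<and>
     attains_initial T u u0 \<and> attains_initial T B B0"

end

theory Submission
  imports Defs
begin

text \<open>
  Testing the induction equation with gradients \<open>\<nabla>\<phi>\<close> removes its two transport terms up to the source
  \<open>(div B) u\<close>, because \<open>u \<otimes> B - B \<otimes> u\<close> is antisymmetric and the Hessian of \<open>\<phi>\<close> is symmetric. What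
  remains says that \<open>d = div B\<close> is a weak solution of the scalar equation
  \<open>\<partial>\<^sub>t d + div (d u) = \<nu>\<^sub>2 \<Delta>d\<close> with \<open>d(0) = 0\<close> (\<open>induction_tested\<close>), and the task is to prove uniqueness
  for it.

  The product \<open>d u\<close> is too rough to test this equation with \<open>d\<close> itself, so the argument is a
  renormalization. Let \<open>d\<^sub>n\<close> be the mollification of \<open>d\<close> in space and \<open>b\<close> a smooth convex function with
  bounded derivative, \<open>b(0) = 0\<close> and \<open>b > 0\<close> elsewhere. The integral of \<open>b(d\<^sub>n)\<close> grows at most at
  the rate of the integral of \<open>b'(d\<^sub>n) (u \<cdot> \<nabla>d\<^sub>n - (u \<cdot> \<nabla>d)\<^sub>n)\<close>: the diffusion has a sign by convexity,
  and the integral of \<open>b'(d\<^sub>n) u \<cdot> \<nabla>d\<^sub>n = u \<cdot> \<nabla>(b(d\<^sub>n))\<close> vanishes because \<open>u\<close> is incompressible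
  (\<open>energy_inequality\<close>). Since \<open>\<nabla>d\<close> is a function, the commutator is the average
  of \<open>(u(x) - u(y)) \<cdot> \<nabla>d(y)\<close> against the kernel, so its \<open>L\<^sup>1\<close> norm is controlled by \<open>\<nabla>d\<close> in
  \<open>L\<^sup>2\<close> and by the averaged modulus of continuity of \<open>u\<close> in \<open>L\<^sup>2\<close>, which tends to \<open>0\<close>
  (\<open>omega_tendsto\<close>). In the limit the integral of \<open>b(d)\<close> is \<open>0\<close>, hence \<open>d = 0\<close> (\<open>solution_zero\<close>).

  Only translates of the kernels, multiplied by functions of time, are ever used as test functions.
  With \<open>x\<close> fixed, the equation becomes a weak ordinary differential equation for \<open>t \<mapsto> d\<^sub>n(t, x)\<close>, to
  which du Bois-Reymond's lemma and one half of the chain rule for \<open>b\<close> apply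
  (\<open>renormalized_estimate\<close>). All other test functions, such as \<open>b(d\<^sub>n)\<close> in the incompressibility
  condition, are treated as \<open>C\<^sup>1\<close> functions of space and are reached from the kernels by mollifying
  the other factor (\<open>incompressible\<close>). The kernels are normalized powers of products of \<open>(1 + cos (2\<pi>z\<^sub>i)) / 2\<close>, which
  are periodic, smooth and concentrate at the lattice points.
\<close>

section \<open>Smooth functions of one real variable\<close>

definition smooth1 :: "(real \<Rightarrow> real) \<Rightarrow> bool" where
  "smooth1 f \<longleftrightarrow> (\<forall>j x. ((deriv ^^ j) f has_real_derivative (deriv ^^ Suc j) f x) (at x))"

lemma smooth1_deriv: "smooth1 f \<Longrightarrow> ((deriv ^^ j) f has_real_derivative (deriv ^^ Suc j) f x) (at x)"
  by (auto simp: smooth1_def)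

lemma smooth1_continuous: "smooth1 f \<Longrightarrow> continuous_on A ((deriv ^^ j) f)"
  by (meson DERIV_isCont continuous_at_imp_continuous_on smooth1_deriv)

lemma smooth1_antiderivative:
  assumes "smooth1 g" and F: "\<And>x. (f has_real_derivative g x) (at x)"
  shows "smooth1 f" and "deriv f = g"
proof -
  show d: "deriv f = g"
    using F by (auto intro: DERIV_imp_deriv)
  show "smooth1 f"
    unfolding smooth1_def
  proof (intro allI)
    fix j x
    show "((deriv ^^ j) f has_real_derivative (deriv ^^ Suc j) f x) (at x)"
    proof (cases j)
      case 0
      then show ?thesis using F d by simp
    next
      case (Suc k)
      have "(deriv ^^ Suc k) f = (deriv ^^ k) g" for k
        by (simp only: funpow_Suc_right o_apply d)
      then show ?thesis
        using smooth1_deriv[OF assms(1), of k x] Suc by metis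
    qed
  qed
qed

text \<open>
  The functions \<open>exp (-1/x) / x\<^sup>j\<close>, cut off to the left of the origin, are closed under
  differentiation up to linear combination; this is why \<open>exp (-1/x)\<close> glues smoothly to \<open>0\<close>.
\<close>

definition flat :: "nat \<Rightarrow> real \<Rightarrow> real" where
  "flat j x = (if x \<le> 0 then 0 else exp (- (1 / x)) / x ^ j)"

lemma flat_tendsto_0: "(flat j \<longlongrightarrow> 0) (at 0)"
proof -
  have "((\<lambda>y::real. y ^ j / exp y) \<longlongrightarrow> 0) at_top"
    by (rule tendsto_power_div_exp_0)
  then have "((\<lambda>x::real. inverse x ^ j / exp (inverse x)) \<longlongrightarrow> 0) (at_right 0)"
    by (rule filterlim_compose[OF _ filterlim_inverse_at_top_right])
  moreover have "\<forall>\<^sub>F x in at_right 0. inverse x ^ j / exp (inverse x) = flat j x"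
    by (rule eventually_at_right_less[THEN eventually_mono])
       (auto simp: flat_def exp_minus field_simps)
  ultimately have R: "(flat j \<longlongrightarrow> 0) (at_right 0)"
    by (rule Lim_transform_eventually)
  have "\<forall>\<^sub>F x in at_left 0. flat j x = 0"
    by (auto simp: flat_def eventually_at_left_field intro!: exI[of _ "-1"])
  then have "(flat j \<longlongrightarrow> 0) (at_left 0)"
    by (rule tendsto_eventually)
  with R show ?thesis
    by (simp add: filterlim_at_split)
qed

lemma flat_has_derivative:
  "(flat j has_real_derivative flat (j + 2) x - real j * flat (j + 1) x) (at x)"
proof -
  consider "x < 0" | "x = 0" | "x > 0" by linarith
  then show ?thesis
  proof cases
    case 1
    have "((\<lambda>x. 0) has_real_derivative 0) (at x)" by simp
    then have "(flat j has_real_derivative 0) (at x)"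
      by (rule has_field_derivative_transform_within_open[where S="{..<0}"])
         (use 1 in \<open>auto simp: flat_def\<close>)
    with 1 show ?thesis by (simp add: flat_def)
  next
    case 2
    have "((\<lambda>h. flat j h / h) \<longlongrightarrow> 0) (at 0)"
      by (rule Lim_transform_eventually[OF flat_tendsto_0[of "Suc j"]])
         (auto simp: flat_def eventually_at_filter)
    then have "(flat j has_real_derivative 0) (at 0)"
      by (simp add: DERIV_def flat_def)
    with 2 show ?thesis by (simp add: flat_def)
  next
    case 3
    have inv: "((\<lambda>x. inverse x) has_real_derivative - (inverse x ^ 2)) (at x)"
      using DERIV_inverse[of x UNIV] 3 by (simp add: numeral_2_eq_2)
    have e: "((\<lambda>x. exp (- inverse x)) has_real_derivative exp (- inverse x) * inverse x ^ 2) (at x)"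
      using DERIV_chain2[OF DERIV_exp DERIV_minus[OF inv]] by simp
    have p: "((\<lambda>x. inverse x ^ j) has_real_derivative - real j * inverse x ^ (j + 1)) (at x)"
      using DERIV_power[OF inv, of j] by (cases j) (simp_all add: power2_eq_square algebra_simps)
    have "((\<lambda>x. exp (- inverse x) * inverse x ^ j) has_real_derivative
        exp (- inverse x) * inverse x ^ (j + 2) - real j * (exp (- inverse x) * inverse x ^ (j + 1))) (at x)"
      by (rule DERIV_cong[OF DERIV_mult[OF e p]]) (simp add: power2_eq_square algebra_simps)
    also have "exp (- inverse x) * inverse x ^ (j + 2) - real j * (exp (- inverse x) * inverse x ^ (j + 1))
        = flat (j + 2) x - real j * flat (j + 1) x"
      using 3 by (simp add: flat_def divide_inverse power_inverse del: power_Suc)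
    finally have "((\<lambda>x. exp (- (1 / x)) / x ^ j) has_real_derivative
        flat (j + 2) x - real j * flat (j + 1) x) (at x)"
      by (simp add: divide_inverse power_inverse)
    then show ?thesis
      by (rule has_field_derivative_transform_within_open[where S="{0<..}"])
         (use 3 in \<open>auto simp: flat_def\<close>)
  qed
qed

text \<open>
  A class of functions that is closed under differentiation, hence consists of smooth functions. It
  contains the periodic bumps used to mollify in space and the bumps used to test in time.
\<close>

inductive elementary :: "(real \<Rightarrow> real) \<Rightarrow> bool" where
  const: "elementary (\<lambda>x. c)"
| cos: "elementary (\<lambda>x. cos (a * x + b))"
| flat: "elementary (\<lambda>x. flat j (a * x + b))"
| add: "elementary f \<Longrightarrow> elementary g \<Longrightarrow> elementary (\<lambda>x. f x + g x)"
| mult: "elementary f \<Longrightarrow> elementary g \<Longrightarrow> elementary (\<lambda>x. f x * g x)"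

lemma elementary_cmult: "elementary f \<Longrightarrow> elementary (\<lambda>x. c * f x)"
  by (rule elementary.mult[OF elementary.const])

lemma elementary_diff: "elementary f \<Longrightarrow> elementary g \<Longrightarrow> elementary (\<lambda>x. f x - g x)"
  using elementary.add[of f "\<lambda>x. (-1) * g x"] elementary_cmult[of g "-1"] by simp

lemma elementary_power: "elementary f \<Longrightarrow> elementary (\<lambda>x. f x ^ n)"
  using elementary.const[of 1] by (induction n) (simp_all add: elementary.mult)

lemma elementary_has_derivative:
  assumes "elementary f"
  shows "\<exists>g. elementary g \<and> (\<forall>x. (f has_real_derivative g x) (at x))"
  using assms
proof induction
  case (const c)
  show ?case by (intro exI[of _ "\<lambda>x. 0"]) (auto intro: elementary.const)
next
  case (cos a b)
  have "((\<lambda>x. cos (a * x + b)) has_real_derivative a * cos (a * x + (b + pi / 2))) (at x)" for x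
    by (rule derivative_eq_intros refl)+ (simp add: cos_add add.assoc[symmetric])
  then show ?case
    by (intro exI conjI allI) (rule elementary_cmult[OF elementary.cos])
next
  case (flat j a b)
  let ?g = "\<lambda>x. a * (flat (j + 2) (a * x + b) - real j * flat (j + 1) (a * x + b))"
  have "((\<lambda>x. flat j (a * x + b)) has_real_derivative ?g x) (at x)" for x
  proof -
    have "((\<lambda>x. a * x + b) has_real_derivative a) (at x)"
      by (rule derivative_eq_intros refl | simp)+
    from DERIV_chain2[OF flat_has_derivative this] show ?thesis
      by (simp add: mult.commute)
  qed
  then show ?case
    by (intro exI conjI allI)
       (rule elementary_cmult[OF elementary_diff[OF elementary.flat elementary_cmult[OF elementary.flat]]])
next
  case (add f g)
  then obtain f' g' where *: "elementary f'" "elementary g'"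
    and D: "\<And>x. (f has_real_derivative f' x) (at x)" "\<And>x. (g has_real_derivative g' x) (at x)"
    by blast
  from DERIV_add[OF D] show ?case
    by (intro exI conjI allI) (rule elementary.add[OF *])
next
  case (mult f g)
  then obtain f' g' where *: "elementary f'" "elementary g'"
    and D: "\<And>x. (f has_real_derivative f' x) (at x)" "\<And>x. (g has_real_derivative g' x) (at x)"
    by blast
  have "((\<lambda>x. f x * g x) has_real_derivative f' x * g x + f x * g' x) (at x)" for x
    using DERIV_mult[OF D, of x] by (simp add: algebra_simps)
  then show ?case
    by (intro exI conjI allI)
       (rule elementary.add[OF elementary.mult[OF *(1) mult.hyps(2)] elementary.mult[OF mult.hyps(1) *(2)]])
qed

lemma elementary_smooth1:
  assumes "elementary f"
  shows "smooth1 f"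
proof -
  have "elementary ((deriv ^^ j) f)" for j
  proof (induction j)
    case (Suc j)
    then obtain g where "elementary g" "\<And>x. ((deriv ^^ j) f has_real_derivative g x) (at x)"
      using elementary_has_derivative by blast
    then have "deriv ((deriv ^^ j) f) = g" by (auto intro: DERIV_imp_deriv)
    with \<open>elementary g\<close> show ?case by simp
  qed (use assms in auto)
  have "((deriv ^^ j) f has_real_derivative deriv ((deriv ^^ j) f) x) (at x)" for j x
  proof -
    obtain g where "((deriv ^^ j) f has_real_derivative g x) (at x)"
      using elementary_has_derivative[OF \<open>elementary ((deriv ^^ j) f)\<close>] by blast
    with DERIV_imp_deriv[OF this] show ?thesis by simp
  qed
  then show ?thesis by (simp add: smooth1_def)
qed

section \<open>The mollifying kernels\<close>

text \<open>
  The kernels have the form of a product of functions of the single coordinates, so that a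
  multi-index of orders of differentiation acts factor by factor: \<open>Ker n m\<close> is the derivative of order
  \<open>m\<close> of \<open>Ker n O3\<close>, and \<open>inc i m\<close> adds one derivative in direction \<open>i\<close>. The symmetry of the second
  derivatives then holds by construction.
\<close>

definition cosbump :: "nat \<Rightarrow> real \<Rightarrow> real" where
  "cosbump n s = ((1 + cos (2 * pi * s)) / 2) ^ n"

definition cell_mass :: "nat \<Rightarrow> real" where
  "cell_mass n = (LINT z|torus. (\<Prod>j\<in>UNIV. cosbump n (z $ j)))"

definition Ker :: "nat \<Rightarrow> (3 \<Rightarrow> nat) \<Rightarrow> real^3 \<Rightarrow> real" where
  "Ker n m z = (\<Prod>j\<in>UNIV. (deriv ^^ m j) (cosbump n) (z $ j)) / cell_mass n"

abbreviation inc :: "3 \<Rightarrow> (3 \<Rightarrow> nat) \<Rightarrow> 3 \<Rightarrow> nat" where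
  "inc i m \<equiv> m(i := Suc (m i))"

abbreviation O3 :: "3 \<Rightarrow> nat" where
  "O3 \<equiv> \<lambda>_. 0"

lemma smooth1_cosbump: "smooth1 (cosbump n)"
proof -
  have "elementary (\<lambda>s. (1/2 + 1/2 * cos (2 * pi * s + 0)) ^ n)"
    by (rule elementary_power, rule elementary.add[OF elementary.const
      elementary.mult[OF elementary.const elementary.cos]])
  moreover have "(\<lambda>s. (1/2 + 1/2 * cos (2 * pi * s + 0)) ^ n) = cosbump n"
    by (auto simp: cosbump_def fun_eq_iff add_divide_distrib)
  ultimately show ?thesis
    using elementary_smooth1 by metis
qed

lemma cosbump_deriv_periodic: "(deriv ^^ j) (cosbump n) (s + 1) = (deriv ^^ j) (cosbump n) s"
proof (induction j arbitrary: s)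
  case 0
  have "cos (2 * pi * s + 2 * pi) = cos (2 * pi * s)" by simp
  then show ?case by (simp add: cosbump_def distrib_left)
next
  case (Suc j)
  have "((\<lambda>s. (deriv ^^ j) (cosbump n) (s + 1)) has_real_derivative
      (deriv ^^ Suc j) (cosbump n) (s + 1)) (at s)"
    using DERIV_shift smooth1_deriv[OF smooth1_cosbump] by blast
  then have "((deriv ^^ j) (cosbump n) has_real_derivative
      (deriv ^^ Suc j) (cosbump n) (s + 1)) (at s)"
    by (simp only: Suc)
  then show ?case
    using DERIV_unique smooth1_deriv[OF smooth1_cosbump] by blast
qed

lemma cosbump_deriv_bounded: "\<exists>C. \<forall>s. \<bar>(deriv ^^ j) (cosbump n) s\<bar> \<le> C"
proof -
  let ?f = "(deriv ^^ j) (cosbump n)"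
  have "compact (?f ` {0..1})"
    by (intro compact_continuous_image smooth1_continuous smooth1_cosbump) auto
  then obtain C where C: "\<And>s. s \<in> {0..1} \<Longrightarrow> \<bar>?f s\<bar> \<le> C"
    by (metis bounded_iff compact_imp_bounded image_eqI real_norm_def)
  have up: "?f (s + real k) = ?f s" for s k
  proof (induction k)
    case (Suc k)
    then show ?case
      using cosbump_deriv_periodic[of j n "s + real k"] by (simp add: add_ac)
  qed simp
  have "?f s = ?f (frac s)" for s
  proof (cases "0 \<le> \<lfloor>s\<rfloor>")
    case True
    then show ?thesis
      using up[of "frac s" "nat \<lfloor>s\<rfloor>"] by (simp add: frac_def)
  next
    case False
    then show ?thesis
      using up[of s "nat (- \<lfloor>s\<rfloor>)"] by (simp add: frac_def)
  qed
  moreover have "frac s \<in> {0..1}" for s :: real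
    by (simp add: frac_lt_1 less_imp_le)
  ultimately show ?thesis
    by (metis C)
qed

lemma Ker_has_derivative:
  "(Ker n m has_derivative (\<lambda>h. \<Sum>i\<in>UNIV. h $ i * Ker n (inc i m) z)) (at z)"
proof -
  let ?f = "\<lambda>j. (deriv ^^ j) (cosbump n)"
  have 1: "((\<lambda>z. ?f (m i) (z $ i)) has_derivative (\<lambda>h. h $ i * ?f (Suc (m i)) (z $ i))) (at z)" for i
  proof -
    have "((\<lambda>z::real^3. z $ i) has_derivative (\<lambda>h. h $ i)) (at z)"
      by (rule bounded_linear_imp_has_derivative) (rule bounded_linear_vec_nth)
    from has_derivative_compose[OF this
        smooth1_deriv[OF smooth1_cosbump, unfolded has_field_derivative_def]]
    show ?thesis by (simp add: mult.commute)
  qed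
  have "((\<lambda>z. \<Prod>i\<in>UNIV. ?f (m i) (z $ i)) has_derivative
      (\<lambda>h. \<Sum>i\<in>UNIV. h $ i * ?f (Suc (m i)) (z $ i) * (\<Prod>j\<in>UNIV - {i}. ?f (m j) (z $ j)))) (at z)"
    by (rule has_derivative_prod) (rule 1)
  moreover have "?f (Suc (m i)) (z $ i) * (\<Prod>j\<in>UNIV - {i}. ?f (m j) (z $ j)) =
      (\<Prod>j\<in>UNIV. ?f (inc i m j) (z $ j))" for i
  proof -
    have "(\<Prod>j\<in>UNIV. ?f (inc i m j) (z $ j)) =
        ?f (inc i m i) (z $ i) * (\<Prod>j\<in>UNIV - {i}. ?f (inc i m j) (z $ j))"
      by (rule prod.remove) auto
    also have "(\<Prod>j\<in>UNIV - {i}. ?f (inc i m j) (z $ j)) = (\<Prod>j\<in>UNIV - {i}. ?f (m j) (z $ j))"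
      by (rule prod.cong) auto
    finally show ?thesis by simp
  qed
  ultimately have "((\<lambda>z. \<Prod>i\<in>UNIV. ?f (m i) (z $ i)) has_derivative
      (\<lambda>h. \<Sum>i\<in>UNIV. h $ i * (\<Prod>j\<in>UNIV. ?f (inc i m j) (z $ j)))) (at z)"
    by (simp add: mult.assoc)
  from has_derivative_mult_right[OF this, of "1 / cell_mass n"] show ?thesis
    by (simp add: Ker_def[abs_def] sum_divide_distrib)
qed

lemma Ker_continuous [continuous_intros]:
  fixes g :: "'a::topological_space \<Rightarrow> real^3"
  assumes "continuous_on A g" shows "continuous_on A (\<lambda>x. Ker n m (g x))"
proof -
  have "continuous_on UNIV (Ker n m)"
    by (meson Ker_has_derivative continuous_at_imp_continuous_on has_derivative_continuous)
  from continuous_on_compose2[OF this assms] show ?thesis by auto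
qed

lemma Ker_measurable [measurable]: "Ker n m \<in> borel_measurable borel"
  by (intro borel_measurable_continuous_onI continuous_intros)

lemma Ker_periodic: "Ker n m (z + axis i 1) = Ker n m z"
proof -
  have "(deriv ^^ m j) (cosbump n) ((z + axis i 1) $ j) = (deriv ^^ m j) (cosbump n) (z $ j)" for j
    by (simp add: axis_def cosbump_deriv_periodic)
  then show ?thesis by (simp add: Ker_def)
qed

lemma Ker_even: "Ker n O3 (- z) = Ker n O3 z"
  by (simp add: Ker_def cosbump_def)

lemma Ker_bounded: "\<exists>C. \<forall>z. \<bar>Ker n m z\<bar> \<le> C"
proof -
  have "\<forall>j. \<exists>C. \<forall>s. \<bar>(deriv ^^ j) (cosbump n) s\<bar> \<le> C"
    using cosbump_deriv_bounded by blast
  then obtain C where C: "\<And>j s. \<bar>(deriv ^^ j) (cosbump n) s\<bar> \<le> C j"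
    by metis
  have "\<bar>Ker n m z\<bar> \<le> (\<Prod>j\<in>UNIV. C (m j)) / \<bar>cell_mass n\<bar>" for z
    unfolding Ker_def abs_divide abs_prod
    by (intro divide_right_mono prod_mono) (auto simp: C)
  then show ?thesis by blast
qed

section \<open>Smooth test functions built from the kernels\<close>

text \<open>
  Smoothness by coinduction: a family of functions that contains the partial derivatives of all its
  members, with \<open>\<sigma> b i\<close> as the index of the derivative of \<open>F i\<close> in direction \<open>b\<close>.
\<close>

lemma smooth_family:
  fixes F :: "'i \<Rightarrow> 'a::euclidean_space \<Rightarrow> 'b::real_normed_vector"
  assumes "\<And>i x. \<exists>D. (F i has_derivative D) (at x) \<and> (\<forall>b\<in>Basis. D b = F (\<sigma> b i) x)"
  shows "smooth (F i)"
proof -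
  have "C_k k (F i)" for k i
  proof (induction k arbitrary: i)
    case 0
    have "continuous (at x) (F i)" for x
      using assms[of i x] has_derivative_continuous by blast
    then show ?case by (simp add: continuous_at_imp_continuous_on)
  next
    case (Suc k)
    have "F i differentiable at x" for x
      using assms[of i x] by (auto simp: differentiable_def)
    moreover have "frechet_derivative (F i) (at x) b = F (\<sigma> b i) x" if "b \<in> Basis" for x b
      using assms[of i x] that by (metis frechet_derivative_at)
    ultimately show ?case
      using Suc by (simp add: differentiable_on_def)
  qed
  then show ?thesis by (simp add: smooth_def)
qed

text \<open>
  Sums of derivatives of a translated kernel with constant coefficients in an arbitrary space. They
  include both the kernels (one summand) and their gradients (three summands along the axes), and for
  fixed \<open>\<mu>\<close>, \<open>v\<close>, \<open>x\<close> they form a family as in \<open>smooth_family\<close>, indexed by \<open>m\<close>.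
\<close>

definition kersum :: "nat \<Rightarrow> ('k::finite \<Rightarrow> 3 \<Rightarrow> nat) \<Rightarrow> ('k \<Rightarrow> 'b::real_normed_vector) \<Rightarrow> real^3 \<Rightarrow> (3 \<Rightarrow> nat)
    \<Rightarrow> real^3 \<Rightarrow> 'b" where
  "kersum n \<mu> v x m y = (\<Sum>k\<in>UNIV. Ker n (\<lambda>j. m j + \<mu> k j) (y - x) *\<^sub>R v k)"

lemma kersum_has_derivative:
  "(kersum n \<mu> v x m has_derivative (\<lambda>h. \<Sum>i\<in>UNIV. h $ i *\<^sub>R kersum n \<mu> v x (inc i m) y)) (at y)"
proof -
  have inc: "inc i (\<lambda>j. m j + \<mu> k j) = (\<lambda>j. inc i m j + \<mu> k j)" for i k
    by (auto simp: fun_eq_iff)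
  have "((\<lambda>y. y - x) has_derivative (\<lambda>h. h)) (at y)"
    by (auto intro!: derivative_eq_intros)
  from has_derivative_compose[OF this Ker_has_derivative, of n]
  have "((\<lambda>y. Ker n (\<lambda>j. m j + \<mu> k j) (y - x)) has_derivative
      (\<lambda>h. \<Sum>i\<in>UNIV. h $ i * Ker n (\<lambda>j. inc i m j + \<mu> k j) (y - x))) (at y)" for k
    unfolding inc[symmetric] .
  then have "(kersum n \<mu> v x m has_derivative
      (\<lambda>h. \<Sum>k\<in>UNIV. (\<Sum>i\<in>UNIV. h $ i * Ker n (\<lambda>j. inc i m j + \<mu> k j) (y - x)) *\<^sub>R v k)) (at y)"
    unfolding kersum_def[abs_def]
    by (intro has_derivative_sum has_derivative_scaleR_left)
  moreover have "(\<Sum>k\<in>UNIV. (\<Sum>i\<in>UNIV. h $ i * Ker n (\<lambda>j. inc i m j + \<mu> k j) (y - x)) *\<^sub>R v k) =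
      (\<Sum>i\<in>UNIV. h $ i *\<^sub>R kersum n \<mu> v x (inc i m) y)" for h :: "real^3"
    unfolding kersum_def scaleR_sum_left scaleR_sum_right
    by (subst sum.swap) simp
  ultimately show ?thesis by simp
qed

lemma sum_axis_scaleR: "(\<Sum>i\<in>UNIV. (axis k 1 :: real^'n) $ i *\<^sub>R f i) = (f k :: 'b::real_vector)"
proof -
  have "(\<Sum>i\<in>UNIV. (axis k 1 :: real^'n) $ i *\<^sub>R f i) = (\<Sum>i\<in>UNIV. if i = k then f k else 0)"
    by (rule sum.cong) (auto simp: axis_def)
  then show ?thesis by simp
qed

lemma grad_kersum: "grad (kersum n \<mu> v x m) y = (\<chi> i. kersum n \<mu> v x (inc i m) y)"
  unfolding grad_def frechet_derivative_at[OF kersum_has_derivative, symmetric] sum_axis_scaleR ..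

lemma smooth_kersum: "smooth (kersum n \<mu> v x m)"
proof (rule smooth_family[where F="kersum n \<mu> v x" and \<sigma>="\<lambda>b. inc (SOME k. b = axis k 1)"])
  fix m y
  have "(\<Sum>i\<in>UNIV. b $ i *\<^sub>R kersum n \<mu> v x (inc i m) y) = kersum n \<mu> v x (inc (SOME k. b = axis k 1) m) y"
    if b: "b \<in> Basis" for b
  proof -
    obtain k where "b = axis k 1" using b by (auto simp: Basis_vec_def)
    then have "b = axis (SOME k. b = axis k 1) 1" by (rule someI)
    from sum_axis_scaleR[of "SOME k. b = axis k 1" "\<lambda>i. kersum n \<mu> v x (inc i m) y", folded this]
    show ?thesis .
  qed
  then show "\<exists>D. (kersum n \<mu> v x m has_derivative D) (at y) \<and>
      (\<forall>b\<in>Basis. D b = kersum n \<mu> v x (inc (SOME k. b = axis k 1) m) y)"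
    using kersum_has_derivative by blast
qed

lemma periodic_kersum: "periodic (kersum n \<mu> v x m)"
proof -
  have "y + axis i 1 - x = (y - x) + axis i 1" for y i by simp
  then show ?thesis unfolding periodic_def kersum_def by (simp only: Ker_periodic) simp
qed

lemma test_fun_kersum:
  assumes "smooth1 \<eta>" and supp: "0 < a" "b < T" "\<And>t. t \<notin> {a..b} \<Longrightarrow> \<eta> t = 0"
  shows "test_fun T (\<lambda>t y. \<eta> t *\<^sub>R kersum n \<mu> v x m y)"
proof -
  \<comment> \<open>A derivative in time raises \<open>j\<close>, a derivative in space raises \<open>m\<close>.\<close>
  define F where "F = (\<lambda>(j, m) (t, y). (deriv ^^ j) \<eta> t *\<^sub>R kersum n \<mu> v x m y)"
  define \<sigma> where "\<sigma> = (\<lambda>(b0::real, b1) (j, m).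
    if b1 = (0::real^3) then (Suc j, m) else (j, inc (SOME k. b1 = axis k 1) m))"
  have "smooth (F (0, m))"
  proof (rule smooth_family[where F=F and \<sigma>=\<sigma>])
    fix i :: "nat \<times> (3 \<Rightarrow> nat)" and z :: "real \<times> (real^3)"
    obtain j m where i: "i = (j, m)" by (cases i)
    obtain t y where z: "z = (t, y)" by (cases z)
    let ?D = "\<lambda>h. (deriv ^^ j) \<eta> t *\<^sub>R (\<Sum>i\<in>UNIV. snd h $ i *\<^sub>R kersum n \<mu> v x (inc i m) y)
        + (fst h * (deriv ^^ Suc j) \<eta> t) *\<^sub>R kersum n \<mu> v x m y"
    have 1: "((\<lambda>z. (deriv ^^ j) \<eta> (fst z)) has_derivative (\<lambda>h. fst h * (deriv ^^ Suc j) \<eta> t)) (at z)"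
      using has_derivative_compose[where f=fst and x=z and s=UNIV,
        OF has_derivative_fst[OF has_derivative_ident]
          smooth1_deriv[OF assms(1), unfolded has_field_derivative_def]]
      by (simp add: z mult.commute)
    have 2: "((\<lambda>z. kersum n \<mu> v x m (snd z)) has_derivative
        (\<lambda>h. \<Sum>i\<in>UNIV. snd h $ i *\<^sub>R kersum n \<mu> v x (inc i m) y)) (at z)"
      using has_derivative_compose[where f=snd and x=z and s=UNIV,
        OF has_derivative_snd[OF has_derivative_ident] kersum_has_derivative] by (simp add: z)
    have "((\<lambda>z. (deriv ^^ j) \<eta> (fst z) *\<^sub>R kersum n \<mu> v x m (snd z)) has_derivative ?D) (at z)"
      using has_derivative_scaleR[OF 1 2] by (simp add: z)
    then have "(F i has_derivative ?D) (at z)"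
      by (simp add: F_def i case_prod_unfold)
    moreover have "?D b = F (\<sigma> b i) z" if b: "b \<in> Basis" for b
    proof -
      from b consider "b = (1, 0)" | k where "b = (0, axis k 1)"
        by (auto simp: Basis_prod_def Basis_vec_def)
      then show ?thesis
      proof cases
        case 1
        then show ?thesis by (simp add: F_def i z \<sigma>_def)
      next
        case 2
        have "axis k (1::real) = axis (SOME l. axis k (1::real) = axis l 1) 1"
          by (rule someI) (rule refl)
        then have "k = (SOME l. axis k (1::real) = axis l 1)"
          by (simp add: axis_eq_axis)
        with 2 show ?thesis
          by (simp add: F_def i z \<sigma>_def sum_axis_scaleR axis_eq_0_iff)
      qed
    qed
    ultimately show "\<exists>D. (F i has_derivative D) (at z) \<and> (\<forall>b\<in>Basis. D b = F (\<sigma> b i) z)"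
      by blast
  qed
  then have "smooth (\<lambda>(t, y). \<eta> t *\<^sub>R kersum n \<mu> v x m y)"
    by (simp add: F_def)
  moreover have "periodic (\<lambda>y. \<eta> t *\<^sub>R kersum n \<mu> v x m y)" for t
    using periodic_kersum[of n \<mu> v x m] by (simp add: periodic_def)
  ultimately show ?thesis
    using supp unfolding test_fun_def by (intro conjI exI[of _ a] exI[of _ b]) auto
qed

section \<open>Integration over the cell of periodic functions\<close>

interpretation torus: finite_measure torus
  by (intro finite_measure_lebesgue_on lmeasurable_cbox)

lemma measure_torus: "measure torus (space torus) = 1"
proof -
  have "torus_cell \<noteq> {}" by (simp add: interval_ne_empty_cart)
  then show ?thesis by (simp add: measure_restrict_space content_cbox_cart)
qed

lemma integral_torus_const [simp]: "(LINT x|torus. c) = (c::real)"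
  by (simp add: measure_torus[simplified])

lemma borel_measurable_torus: "f \<in> borel_measurable borel \<Longrightarrow> f \<in> borel_measurable torus"
  by (intro measurable_restrict_space1 measurable_completion) simp

lemma measurable_ident_torus [measurable]: "(\<lambda>x. x) \<in> torus \<rightarrow>\<^sub>M borel"
  by (rule borel_measurable_torus) simp

lemma continuous_integrable_torus:
  fixes f :: "real^3 \<Rightarrow> real"
  shows "continuous_on UNIV f \<Longrightarrow> integrable torus f"
  by (rule continuous_imp_integrable) (auto intro: continuous_on_subset)

lemma lint_torus_eq_integral:
  fixes f :: "real^3 \<Rightarrow> real"
  shows "continuous_on UNIV f \<Longrightarrow> (LINT x|torus. f x) = integral torus_cell f"
  by (rule lebesgue_integral_eq_integral[OF continuous_integrable_torus]) auto

text \<open>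
  The part of the shifted cell that sticks out of the cell on one side is moved back by one period and
  fills the gap on the other side.
\<close>

lemma integral_cell_shift_axis:
  fixes f :: "real^3 \<Rightarrow> real"
  assumes f: "continuous_on UNIV f" "periodic f" and s: "0 \<le> s" "s \<le> 1"
  shows "integral torus_cell (\<lambda>x. f (x + s *\<^sub>R axis i 1)) = integral torus_cell f"
proof -
  let ?e = "axis i 1 :: real^3" and ?b = "(\<chi> j. if j = i then s else 1) :: real^3"
  have int: "f integrable_on cbox a b" for a b
    using f(1) by (intro integrable_continuous) (auto intro: continuous_on_subset)
  have e: "?e \<in> Basis" by (simp add: axis_in_Basis_iff)
  let ?B = "cbox (s *\<^sub>R ?e) (1 + s *\<^sub>R ?e)"
  have shift: "integral torus_cell (\<lambda>x. f (x + s *\<^sub>R ?e)) = integral ?B f"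
    using integral_shift_cbox[of "s *\<^sub>R ?e" "s *\<^sub>R ?e" "1 + s *\<^sub>R ?e" f] by simp
  have low: "?B \<inter> {x. x \<bullet> ?e \<le> 1} = torus_cell \<inter> {x. x \<bullet> ?e \<ge> s}"
  proof -
    have "x \<in> ?B \<and> x $ i \<le> 1 \<longleftrightarrow> x \<in> torus_cell \<and> s \<le> x $ i" for x
    proof -
      have "((if j = i then s else 0) \<le> x $ j \<and> x $ j \<le> 1 + (if j = i then s else 0)) \<and> x $ i \<le> 1 \<longleftrightarrow>
          (0 \<le> x $ j \<and> x $ j \<le> 1) \<and> (j = i \<longrightarrow> s \<le> x $ i) \<and> x $ i \<le> 1" for j
        using s by (cases "j = i") auto
      then have "(\<forall>j. (if j = i then s else 0) \<le> x $ j \<and> x $ j \<le> 1 + (if j = i then s else 0)) \<and> x $ i \<le> 1 \<longleftrightarrow>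
          (\<forall>j. 0 \<le> x $ j \<and> x $ j \<le> 1) \<and> s \<le> x $ i"
        by metis
      moreover have "(s *\<^sub>R ?e) $ j = (if j = i then s else 0)" for j
        by (simp add: axis_def)
      ultimately show ?thesis
        unfolding mem_box_cart by (simp only: vector_add_component one_index zero_index)
    qed
    then show ?thesis by (auto simp: inner_axis)
  qed
  have high: "?B \<inter> {x. x \<bullet> ?e \<ge> 1} = cbox ?e (1 + s *\<^sub>R ?e)"
  proof -
    have "(x \<in> ?B \<and> 1 \<le> x $ i) = (x \<in> cbox ?e (1 + s *\<^sub>R ?e))" for x
      unfolding mem_box_cart using s by (auto simp: axis_def split: if_splits)
    then show ?thesis by (auto simp: inner_axis)
  qed
  have wrap: "integral (cbox ?e (1 + s *\<^sub>R ?e)) f = integral (torus_cell \<inter> {x. x \<bullet> ?e \<le> s}) f"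
  proof -
    have "1 + s *\<^sub>R ?e - ?e = ?b" by (auto simp: vec_eq_iff axis_def)
    moreover have "x \<in> cbox 0 ?b \<longleftrightarrow> x \<in> torus_cell \<and> x $ i \<le> s" for x
    proof -
      have "0 \<le> x $ j \<and> x $ j \<le> (if j = i then s else 1) \<longleftrightarrow>
          (0 \<le> x $ j \<and> x $ j \<le> 1) \<and> (j = i \<longrightarrow> x $ i \<le> s)" for j
        using s by (cases "j = i") auto
      then have "(\<forall>j. 0 \<le> x $ j \<and> x $ j \<le> (if j = i then s else 1)) \<longleftrightarrow>
          (\<forall>j. 0 \<le> x $ j \<and> x $ j \<le> 1) \<and> x $ i \<le> s"
        by metis
      then show ?thesis
        unfolding mem_box_cart by simp
    qed
    then have "cbox 0 ?b = torus_cell \<inter> {x. x \<bullet> ?e \<le> s}" by (auto simp: inner_axis)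
    moreover have "f (x + ?e) = f x" for x using f(2) by (simp add: periodic_def)
    ultimately show ?thesis
      using integral_shift_cbox[of ?e ?e "1 + s *\<^sub>R ?e" f] by (simp only: diff_self)
  qed
  have "integral ?B f = integral (?B \<inter> {x. x \<bullet> ?e \<le> 1}) f + integral (?B \<inter> {x. x \<bullet> ?e \<ge> 1}) f"
    by (rule integral_split[OF int e])
  moreover have "integral torus_cell f =
      integral (torus_cell \<inter> {x. x \<bullet> ?e \<le> s}) f + integral (torus_cell \<inter> {x. x \<bullet> ?e \<ge> s}) f"
    by (rule integral_split[OF int e])
  ultimately show ?thesis
    unfolding shift low high wrap by simp
qed

lemma integral_cell_shift:
  fixes f :: "real^3 \<Rightarrow> real" and x :: "real^3"
  assumes f: "continuous_on UNIV f" "periodic f" and x: "x \<in> torus_cell"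
  shows "integral torus_cell (\<lambda>y. f (y + x)) = integral torus_cell f"
proof -
  have "integral torus_cell (\<lambda>y. f (y + (\<Sum>i\<in>A. x $ i *\<^sub>R axis i 1))) = integral torus_cell f"
    if "finite A" for A
    using that
  proof induction
    case (insert i A)
    let ?v = "\<Sum>i\<in>A. x $ i *\<^sub>R axis i 1 :: real^3"
    let ?g = "\<lambda>y. f (y + ?v)"
    have "continuous_on UNIV ?g"
      by (rule continuous_on_compose2[OF f(1)]) (auto intro!: continuous_intros)
    moreover have "periodic ?g"
      using f(2) by (simp add: periodic_def add.assoc add.commute[of "axis _ 1"])
        (simp add: add.assoc[symmetric])
    ultimately have "integral torus_cell (\<lambda>y. ?g (y + x $ i *\<^sub>R axis i 1)) = integral torus_cell ?g"
      using x by (intro integral_cell_shift_axis) (auto simp: mem_box_cart)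
    with insert show ?case by (simp add: add_ac)
  qed simp
  from this[of UNIV] show ?thesis
    by (simp add: basis_expansion[of x, unfolded scalar_mult_eq_scaleR])
qed

definition has_partial :: "3 \<Rightarrow> (real^3 \<Rightarrow> real) \<Rightarrow> (real^3 \<Rightarrow> real) \<Rightarrow> bool" where
  "has_partial i f g \<longleftrightarrow> (\<forall>x. ((\<lambda>s. f (x + s *\<^sub>R axis i 1)) has_real_derivative g x) (at 0))"

lemma has_partial_at:
  assumes "has_partial i f g"
  shows "((\<lambda>s. f (x + s *\<^sub>R axis i 1)) has_real_derivative g (x + s *\<^sub>R axis i 1)) (at s)"
proof -
  let ?\<phi> = "\<lambda>s. f (x + s *\<^sub>R axis i 1)"
  have "((\<lambda>r. f (x + s *\<^sub>R axis i 1 + r *\<^sub>R axis i 1)) has_real_derivative g (x + s *\<^sub>R axis i 1)) (at 0)"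
    using assms by (simp add: has_partial_def)
  then have "((\<lambda>r. ?\<phi> (r + s)) has_real_derivative g (x + s *\<^sub>R axis i 1)) (at 0)"
    by (simp add: algebra_simps)
  then show ?thesis
    using DERIV_shift[of ?\<phi> _ 0 s] by simp
qed

text \<open>
  Only derivatives along the coordinate axes enter the integration by parts, so the gradient is given
  by its components \<open>g i\<close> instead of a total derivative.
\<close>

definition C1per :: "(real^3 \<Rightarrow> real) \<Rightarrow> (3 \<Rightarrow> real^3 \<Rightarrow> real) \<Rightarrow> bool" where
  "C1per f g \<longleftrightarrow> continuous_on UNIV f \<and> periodic f \<and>
     (\<forall>i. continuous_on UNIV (g i) \<and> periodic (g i) \<and> has_partial i f (g i))"

lemma C1per_mult:
  assumes "C1per f f'" "C1per g g'"
  shows "C1per (\<lambda>x. f x * g x) (\<lambda>i x. f' i x * g x + f x * g' i x)"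
  unfolding C1per_def has_partial_def
proof (intro conjI allI)
  fix i x
  have "((\<lambda>s. f (x + s *\<^sub>R axis i 1)) has_real_derivative f' i x) (at 0)"
    "((\<lambda>s. g (x + s *\<^sub>R axis i 1)) has_real_derivative g' i x) (at 0)"
    using assms by (auto simp: C1per_def has_partial_def)
  from DERIV_mult[OF this]
  show "((\<lambda>s. f (x + s *\<^sub>R axis i 1) * g (x + s *\<^sub>R axis i 1)) has_real_derivative
      f' i x * g x + f x * g' i x) (at 0)" by (simp add: algebra_simps)
qed (use assms in \<open>auto simp: C1per_def periodic_def intro!: continuous_intros\<close>)

lemma C1per_compose:
  assumes "C1per f f'" and h: "\<And>s. (h has_real_derivative h' s) (at s)" "continuous_on UNIV h'"
  shows "C1per (\<lambda>x. h (f x)) (\<lambda>i x. h' (f x) * f' i x)"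
  unfolding C1per_def has_partial_def
proof (intro conjI allI)
  have "continuous_on UNIV h"
    by (meson DERIV_isCont continuous_at_imp_continuous_on h(1))
  then show "continuous_on UNIV (\<lambda>x. h (f x))"
    using assms(1) by (auto simp: C1per_def intro: continuous_on_compose2)
  fix i
  show "continuous_on UNIV (\<lambda>x. h' (f x) * f' i x)"
    using assms(1) h(2) by (auto simp: C1per_def intro!: continuous_intros intro: continuous_on_compose2)
  fix x
  have "((\<lambda>s. f (x + s *\<^sub>R axis i 1)) has_real_derivative f' i x) (at 0)"
    using assms by (auto simp: C1per_def has_partial_def)
  from DERIV_chain2[OF h(1) this]
  show "((\<lambda>s. h (f (x + s *\<^sub>R axis i 1))) has_real_derivative h' (f x) * f' i x) (at 0)"
    by simp
qed (use assms in \<open>auto simp: C1per_def periodic_def\<close>)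

text \<open>
  Averaging the identity \<open>f (x + e) - f x = \<integral> (\<partial>\<^sub>i f) (x + s e) ds\<close> over the cell: the left-hand side
  vanishes by periodicity, and the right-hand side does not depend on the shift \<open>s e\<close>.
\<close>

lemma integral_has_partial_eq_0:
  assumes "C1per f g"
  shows "(LINT x|torus. g i x) = 0"
proof -
  have f: "continuous_on UNIV f" "periodic f" and g: "continuous_on UNIV (g i)" "periodic (g i)"
    and d: "has_partial i f (g i)" using assms by (auto simp: C1per_def)
  let ?e = "axis i 1 :: real^3"
  have cont: "continuous_on S (\<lambda>(s, x). g i (x + s *\<^sub>R ?e))" for S
    unfolding case_prod_unfold
    by (rule continuous_on_compose2[OF g(1)]) (auto intro!: continuous_intros)
  have "integral torus_cell (g i) = integral {0..1} (\<lambda>s::real. integral torus_cell (g i))"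
    by simp
  also have "\<dots> = integral {0..1} (\<lambda>s. integral torus_cell (\<lambda>x. g i (x + s *\<^sub>R ?e)))"
    by (rule integral_cong) (use integral_cell_shift_axis[OF g] in auto)
  also have "\<dots> = integral torus_cell (\<lambda>x. integral {0..1} (\<lambda>s. g i (x + s *\<^sub>R ?e)))"
    using integral_swap_continuous[of 0 0 1 1 "\<lambda>s x. g i (x + s *\<^sub>R ?e)"] cont by simp
  also have "\<dots> = integral torus_cell (\<lambda>x. 0)"
  proof (rule integral_cong)
    fix x
    have "((\<lambda>s. g i (x + s *\<^sub>R ?e)) has_integral f (x + 1 *\<^sub>R ?e) - f (x + 0 *\<^sub>R ?e)) {0..1}"
      by (rule fundamental_theorem_of_calculus)
         (auto intro!: has_vector_derivative_at_within
           has_partial_at[OF d, unfolded has_real_derivative_iff_has_vector_derivative])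
    moreover have "f (x + ?e) = f x" using f(2) by (simp add: periodic_def)
    ultimately show "integral {0..1} (\<lambda>s. g i (x + s *\<^sub>R ?e)) = 0"
      by (simp add: integral_unique)
  qed
  finally show ?thesis
    using lint_torus_eq_integral[OF g(1)] by simp
qed

lemma integration_by_parts:
  assumes "C1per f f'" "C1per g g'"
  shows "(LINT x|torus. f x * g' i x) = - (LINT x|torus. f' i x * g x)"
proof -
  have c: "continuous_on UNIV f" "continuous_on UNIV g" "continuous_on UNIV (f' i)" "continuous_on UNIV (g' i)"
    using assms by (auto simp: C1per_def)
  have "(LINT x|torus. f' i x * g x + f x * g' i x) = 0"
    using integral_has_partial_eq_0[OF C1per_mult[OF assms]] .
  then show ?thesis
    by (subst (asm) Bochner_Integration.integral_add)
       (auto intro!: continuous_integrable_torus continuous_intros c)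
qed

lemma has_partial_Ker_right: "has_partial i (\<lambda>y. Ker n m (y - x)) (\<lambda>y. Ker n (inc i m) (y - x))"
  unfolding has_partial_def
proof
  fix y
  have "((\<lambda>s. y + s *\<^sub>R axis i 1 - x) has_derivative (\<lambda>s. s *\<^sub>R axis i 1)) (at (0::real))"
    by (auto intro!: derivative_eq_intros)
  from has_derivative_compose[OF this Ker_has_derivative]
  have "((\<lambda>s. Ker n m (y + s *\<^sub>R axis i 1 - x)) has_derivative
      (\<lambda>s. \<Sum>j\<in>UNIV. (s *\<^sub>R axis i 1) $ j * Ker n (inc j m) (y - x))) (at 0)"
    by simp
  moreover have "(\<Sum>j\<in>UNIV. (s *\<^sub>R axis i 1) $ j * Ker n (inc j m) (y - x)) = Ker n (inc i m) (y - x) * s" for s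
    using sum_axis_scaleR[of i "\<lambda>j. s * Ker n (inc j m) (y - x)"] by (simp add: mult_ac)
  ultimately show "((\<lambda>s. Ker n m (y + s *\<^sub>R axis i 1 - x)) has_real_derivative Ker n (inc i m) (y - x)) (at 0)"
    by (simp add: has_field_derivative_def)
qed

lemma has_partial_Ker_left: "has_partial i (\<lambda>x. Ker n m (y - x)) (\<lambda>x. - Ker n (inc i m) (y - x))"
  unfolding has_partial_def
proof
  fix x
  have "((\<lambda>s. y - (x + s *\<^sub>R axis i 1)) has_derivative (\<lambda>s. - (s *\<^sub>R axis i 1))) (at (0::real))"
    by (auto intro!: derivative_eq_intros)
  from has_derivative_compose[OF this Ker_has_derivative]
  have "((\<lambda>s. Ker n m (y - (x + s *\<^sub>R axis i 1))) has_derivative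
      (\<lambda>s. \<Sum>j\<in>UNIV. (- (s *\<^sub>R axis i 1)) $ j * Ker n (inc j m) (y - x))) (at 0)"
    by simp
  moreover have "(\<Sum>j\<in>UNIV. (- (s *\<^sub>R axis i 1)) $ j * Ker n (inc j m) (y - x)) = - Ker n (inc i m) (y - x) * s" for s
    using sum_axis_scaleR[of i "\<lambda>j. - s * Ker n (inc j m) (y - x)"] by (simp add: mult_ac)
  ultimately show "((\<lambda>s. Ker n m (y - (x + s *\<^sub>R axis i 1))) has_real_derivative - Ker n (inc i m) (y - x)) (at 0)"
    unfolding has_field_derivative_def by (simp only:)
qed

lemma Ker_periodic_diff: "Ker n m (y - (x + axis i 1)) = Ker n m (y - x)"
  using Ker_periodic[of n m "y - (x + axis i 1)" i] by simp

lemma Ker_periodic_diff': "Ker n m (y + axis i 1 - x) = Ker n m (y - x)"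
  using Ker_periodic[of n m "y - x" i] by (simp add: algebra_simps)

lemma C1per_Ker_right: "C1per (\<lambda>y. Ker n m (y - x)) (\<lambda>i y. Ker n (inc i m) (y - x))"
  unfolding C1per_def periodic_def
  by (intro conjI allI has_partial_Ker_right continuous_intros Ker_periodic_diff')

lemma C1per_Ker_left: "C1per (\<lambda>x. Ker n m (y - x)) (\<lambda>i x. - Ker n (inc i m) (y - x))"
  unfolding C1per_def periodic_def
  by (intro conjI allI has_partial_Ker_left continuous_intros arg_cong[of _ _ uminus] Ker_periodic_diff)

section \<open>Mass and concentration of the kernels\<close>

text \<open>
  The kernels are the normalized powers of a weight with values in \<open>[0, 1]\<close> that equals \<open>1\<close> only at the
  lattice points.
\<close>

definition wgt :: "real^3 \<Rightarrow> real" where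
  "wgt z = (\<Prod>j\<in>UNIV. cosbump 1 (z $ j))"

lemma cosbump_range: "0 \<le> cosbump n s" "cosbump n s \<le> 1"
proof -
  have "0 \<le> (1 + cos (2 * pi * s)) / 2" "(1 + cos (2 * pi * s)) / 2 \<le> 1"
    using cos_ge_minus_one[of "2 * pi * s"] cos_le_one[of "2 * pi * s"] by (simp_all add: field_simps del: cos_ge_minus_one cos_le_one)
  then show "0 \<le> cosbump n s" "cosbump n s \<le> 1"
    unfolding cosbump_def by (blast intro: zero_le_power power_le_one)+
qed

lemma wgt_range: "0 \<le> wgt z" "wgt z \<le> 1"
  unfolding wgt_def by (auto intro!: prod_nonneg prod_le_1 cosbump_range)

lemma wgt_continuous: "continuous_on A wgt"
  unfolding wgt_def cosbump_def by (intro continuous_intros) auto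

lemma cell_mass_wgt: "cell_mass n = (LINT z|torus. wgt z ^ n)"
  unfolding cell_mass_def wgt_def by (simp add: prod_power_distrib cosbump_def)

text \<open>
  The weight exceeds \<open>r\<close> on a nonempty open set, near the origin. Hence the normalizing constants decay
  more slowly than any geometric sequence, and the kernels tend to \<open>0\<close> where the weight stays
  below a constant less than \<open>1\<close>.
\<close>

lemma cell_mass_lower:
  assumes "0 \<le> r" "r < 1"
  obtains c where "c > 0" "\<And>n. c * r ^ n \<le> cell_mass n"
proof -
  let ?U = "box 0 1 \<inter> {z. r < wgt z}"
  have op: "open ?U"
    by (intro open_Int open_box open_Collect_less wgt_continuous continuous_intros)
  have "((\<lambda>t. wgt (t *\<^sub>R 1)) \<longlongrightarrow> wgt (0 *\<^sub>R 1)) (at_right 0)"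
  proof -
    have "continuous_on UNIV (\<lambda>t. wgt (t *\<^sub>R 1))"
      by (rule continuous_on_compose2[OF wgt_continuous]) (auto intro!: continuous_intros)
    then have "isCont (\<lambda>t. wgt (t *\<^sub>R 1)) 0"
      by (simp add: continuous_on_eq_continuous_at)
    then show ?thesis
      unfolding isCont_def by (rule filterlim_mono) (auto intro: at_le)
  qed
  moreover have "wgt (0 *\<^sub>R 1) = 1" by (simp add: wgt_def cosbump_def)
  ultimately have "\<forall>\<^sub>F t in at_right 0. r < wgt (t *\<^sub>R 1)"
    using assms(2) by (auto intro: order_tendstoD)
  moreover have "\<forall>\<^sub>F t in at_right (0::real). t \<in> {0<..<1}"
    by (rule eventually_at_right_real) simp
  ultimately have "\<forall>\<^sub>F t in at_right 0. t *\<^sub>R 1 \<in> ?U"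
    by eventually_elim (auto simp: mem_box_cart)
  then obtain t :: real where "t *\<^sub>R 1 \<in> ?U"
    using eventually_happens by fastforce
  then have ne: "?U \<noteq> {}" by blast
  have sub: "?U \<subseteq> torus_cell" using box_subset_cbox by blast
  have m: "?U \<in> lmeasurable"
    using op bounded_subset[OF bounded_cbox sub] by (intro lmeasurable_open) auto
  have "measure lebesgue ?U \<noteq> 0"
    using open_not_negligible[OF op ne] m by (simp add: negligible_iff_measure)
  then have pos: "measure lebesgue ?U > 0"
    by (simp add: zero_less_measure_iff)
  have "measure lebesgue ?U * r ^ n \<le> cell_mass n" for n
  proof -
    have "measure torus ?U = measure lebesgue ?U"
      using sub m by (subst measure_restrict_space) auto
    moreover have Ut: "?U \<in> sets torus" using sub m by (auto simp: sets_restrict_space_iff)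
    ultimately have "measure lebesgue ?U * r ^ n = (LINT z|torus. indicator ?U z * r ^ n)"
      using sub by (simp add: Int_absorb2 Int_absorb1)
    also have "\<dots> \<le> (LINT z|torus. wgt z ^ n)"
    proof (rule integral_mono)
      show "integrable torus (\<lambda>z. indicator ?U z * r ^ n)"
        using Ut torus.emeasure_finite[of ?U]
        by (intro integrable_mult_left integrable_real_indicator) (auto simp: less_top[symmetric])
      show "integrable torus (\<lambda>z. wgt z ^ n)"
        by (intro continuous_integrable_torus continuous_intros wgt_continuous)
      show "indicator ?U z * r ^ n \<le> wgt z ^ n" for z
        using assms(1) wgt_range(1)[of z] by (auto simp: indicator_def intro: power_mono)
    qed
    finally show ?thesis by (simp add: cell_mass_wgt)
  qed
  with pos that show thesis by blast
qed

lemma cell_mass_pos: "cell_mass n > 0"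
proof -
  obtain c :: real where "c > 0" "c * (1/2) ^ n \<le> cell_mass n"
    using cell_mass_lower[of "1/2"] by auto
  then show ?thesis
    by (meson less_le_trans mult_pos_pos zero_less_power half_gt_zero zero_less_one)
qed

lemma Ker_wgt: "Ker n O3 z = wgt z ^ n / cell_mass n"
  unfolding Ker_def wgt_def by (simp add: prod_power_distrib cosbump_def)

lemma Ker_nonneg: "0 \<le> Ker n O3 z"
  using cell_mass_pos[of n] wgt_range[of z] by (simp add: Ker_wgt)

lemma Ker_commute: "Ker n O3 (y - x) = Ker n O3 (x - y)"
  using Ker_even[of n "x - y"] by simp

lemma Ker_mass_right:
  assumes "x \<in> torus_cell"
  shows "(LINT y|torus. Ker n O3 (y - x)) = 1"
proof -
  have "(LINT y|torus. Ker n O3 (y - x)) = integral torus_cell (\<lambda>y. Ker n O3 (y - x))"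
    by (intro lint_torus_eq_integral continuous_intros)
  also have "\<dots> = integral torus_cell (\<lambda>y. Ker n O3 (y + x - x))"
    by (rule integral_cell_shift[symmetric])
       (use assms in \<open>auto intro!: continuous_intros Ker_periodic_diff' simp: periodic_def\<close>)
  also have "\<dots> = (LINT y|torus. Ker n O3 y)"
    by (simp, rule lint_torus_eq_integral[symmetric]) (intro continuous_intros)
  also have "\<dots> = 1"
    using cell_mass_pos[of n] by (simp add: Ker_wgt cell_mass_wgt)
  finally show ?thesis .
qed

lemma Ker_mass_left:
  assumes "y \<in> torus_cell"
  shows "(LINT x|torus. Ker n O3 (y - x)) = 1"
  using Ker_mass_right[OF assms, of n] by (subst Ker_commute)

lemma Ker_concentration:
  assumes "0 \<le> r" "r < 1" "\<epsilon> > 0"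
  shows "\<forall>\<^sub>F n in sequentially. \<forall>z. wgt z \<le> r \<longrightarrow> Ker n O3 z < \<epsilon>"
proof -
  \<comment> \<open>Any ratio strictly between \<open>r\<close> and \<open>1\<close> would do.\<close>
  let ?q = "(1 + r) / 2"
  have q: "0 < ?q" "?q < 1" "r < ?q" using assms by auto
  obtain c where c: "c > 0" "\<And>n. c * ?q ^ n \<le> cell_mass n"
    using cell_mass_lower[of ?q] q by auto
  have "(\<lambda>n. (r / ?q) ^ n / c) \<longlonglongrightarrow> 0 / c"
    using q assms by (intro tendsto_divide LIMSEQ_power_zero tendsto_const) (use c in auto)
  then have "\<forall>\<^sub>F n in sequentially. (r / ?q) ^ n / c < \<epsilon>"
    using \<open>\<epsilon> > 0\<close> by (auto intro: order_tendstoD)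
  then show ?thesis
  proof eventually_elim
    case (elim n)
    show ?case
    proof (intro allI impI)
      fix z assume "wgt z \<le> r"
      then have "wgt z ^ n / cell_mass n \<le> r ^ n / (c * ?q ^ n)"
        using c q wgt_range(1)[of z] assms
        by (intro frac_le power_mono zero_le_power mult_pos_pos zero_less_power) auto
      also have "\<dots> = (r / ?q) ^ n / c"
        by (simp add: power_divide)
      finally show "Ker n O3 z < \<epsilon>"
        using elim by (simp add: Ker_wgt)
    qed
  qed
qed

section \<open>Mollified functions\<close>

text \<open>
  Convolution with a derivative of the kernel. The kernel is differentiated as a function of \<open>y - x\<close>,
  so each derivative in \<open>x\<close> costs a sign; \<open>conv n O3 f\<close> is the mollification of \<open>f\<close>, and for an \<open>f\<close> with a
  weak derivative \<open>g\<close> in direction \<open>i\<close>, \<open>conv n (inc i m) f = - conv n m g\<close>.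
\<close>

definition conv :: "nat \<Rightarrow> (3 \<Rightarrow> nat) \<Rightarrow> (real^3 \<Rightarrow> real) \<Rightarrow> real^3 \<Rightarrow> real" where
  "conv n m f x = (LINT y|torus. Ker n m (y - x) * f y)"

lemma integrable_Ker_mult:
  assumes "integrable torus f"
  shows "integrable torus (\<lambda>y. Ker n m (y - x) * f y)"
proof -
  obtain C where C: "\<And>z. \<bar>Ker n m z\<bar> \<le> C" using Ker_bounded by blast
  have [measurable]: "f \<in> borel_measurable torus" using assms by auto
  show ?thesis
  proof (rule Bochner_Integration.integrable_bound)
    show "integrable torus (\<lambda>y. C * f y)" using assms by simp
    show "AE y in torus. norm (Ker n m (y - x) * f y) \<le> norm (C * f y)"
    proof (rule AE_I2)
      fix y
      have "\<bar>Ker n m (y - x)\<bar> * \<bar>f y\<bar> \<le> C * \<bar>f y\<bar>" using C by (intro mult_right_mono) auto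
      also have "\<dots> \<le> \<bar>C\<bar> * \<bar>f y\<bar>" by (intro mult_right_mono) auto
      finally show "norm (Ker n m (y - x) * f y) \<le> norm (C * f y)" by (simp add: abs_mult)
    qed
  qed measurable
qed

lemma conv_bound:
  assumes C: "\<And>z. \<bar>Ker n m z\<bar> \<le> C" and f: "integrable torus f"
  shows "\<bar>conv n m f x\<bar> \<le> C * (LINT y|torus. \<bar>f y\<bar>)"
proof -
  have "\<bar>conv n m f x\<bar> \<le> (LINT y|torus. \<bar>Ker n m (y - x) * f y\<bar>)"
    unfolding conv_def by (rule integral_abs_bound)
  also have "\<dots> \<le> (LINT y|torus. C * \<bar>f y\<bar>)"
    using f by (intro integral_mono integrable_abs integrable_Ker_mult)
      (auto simp: abs_mult intro!: mult_right_mono C)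
  finally show ?thesis by simp
qed

lemma conv_C1per:
  assumes f: "integrable torus f"
  shows "C1per (conv n m f) (\<lambda>i x. - conv n (inc i m) f x)"
proof -
  have [measurable]: "f \<in> borel_measurable torus" using f by auto
  have cont: "continuous_on UNIV (conv n m f)" for m
  proof (intro continuous_at_imp_continuous_on ballI continuous_at_sequentiallyI)
    fix u and x :: "real^3" assume u: "u \<longlonglongrightarrow> x"
    obtain C where C: "\<And>z. \<bar>Ker n m z\<bar> \<le> C" using Ker_bounded by blast
    show "(\<lambda>k. conv n m f (u k)) \<longlonglongrightarrow> conv n m f x"
      unfolding conv_def
    proof (rule integral_dominated_convergence)
      show "integrable torus (\<lambda>y. C * \<bar>f y\<bar>)" using f by auto
      show "AE y in torus. (\<lambda>k. Ker n m (y - u k) * f y) \<longlonglongrightarrow> Ker n m (y - x) * f y"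
      proof (rule AE_I2)
        fix y
        have "continuous_on UNIV (\<lambda>x. Ker n m (y - x))" by (intro continuous_intros)
        from continuous_on_tendsto_compose[OF this u]
        show "(\<lambda>k. Ker n m (y - u k) * f y) \<longlonglongrightarrow> Ker n m (y - x) * f y"
          by (intro tendsto_mult) auto
      qed
      show "AE y in torus. norm (Ker n m (y - u k) * f y) \<le> C * \<bar>f y\<bar>" for k
        by (rule AE_I2) (auto simp: abs_mult intro!: mult_right_mono C)
    qed measurable
  qed
  have deriv: "has_partial i (conv n m f) (\<lambda>x. - conv n (inc i m) f x)" for i
    unfolding has_partial_def
  proof
    fix x
    let ?e = "axis i 1 :: real^3"
    obtain C where C: "\<And>z. \<bar>Ker n (inc i m) z\<bar> \<le> C" using Ker_bounded by blast
    have quot: "\<bar>(Ker n m (y - (x + s *\<^sub>R ?e)) - Ker n m (y - x)) / s\<bar> \<le> C" if "s \<noteq> 0" for y s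
    proof -
      have "\<bar>Ker n m (y - (x + s *\<^sub>R ?e)) - Ker n m (y - (x + 0 *\<^sub>R ?e))\<bar> \<le> C * \<bar>s - 0\<bar>"
        by (rule field_differentiable_bound[where S=UNIV
            and f'="\<lambda>s. - Ker n (inc i m) (y - (x + s *\<^sub>R ?e))", unfolded real_norm_def])
           (use has_partial_at[OF has_partial_Ker_left] C in auto)
      then show ?thesis using that by (simp add: abs_divide field_simps)
    qed
    have "(\<lambda>k. (conv n m f (x + s k *\<^sub>R ?e) - conv n m f x) / s k) \<longlonglongrightarrow> - conv n (inc i m) f x"
      if s: "\<And>k. s k \<noteq> 0" "s \<longlonglongrightarrow> 0" for s
    proof -
      have "(conv n m f (x + s k *\<^sub>R ?e) - conv n m f x) / s k =
          (LINT y|torus. ((Ker n m (y - (x + s k *\<^sub>R ?e)) - Ker n m (y - x)) / s k) * f y)" for k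
        unfolding conv_def
        using integrable_Ker_mult[OF f, of n m] by (simp add: left_diff_distrib diff_divide_distrib)
      moreover have "(\<lambda>k. LINT y|torus. ((Ker n m (y - (x + s k *\<^sub>R ?e)) - Ker n m (y - x)) / s k) * f y)
          \<longlonglongrightarrow> (LINT y|torus. - Ker n (inc i m) (y - x) * f y)"
      proof (rule integral_dominated_convergence)
        show "integrable torus (\<lambda>y. C * \<bar>f y\<bar>)" using f by auto
        show "AE y in torus. (\<lambda>k. ((Ker n m (y - (x + s k *\<^sub>R ?e)) - Ker n m (y - x)) / s k) * f y)
            \<longlonglongrightarrow> - Ker n (inc i m) (y - x) * f y"
        proof (rule AE_I2)
          fix y
          have "((\<lambda>s. Ker n m (y - (x + s *\<^sub>R ?e))) has_real_derivative - Ker n (inc i m) (y - x)) (at 0)"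
            using has_partial_Ker_left[of i n m y] by (simp add: has_partial_def)
          then have "((\<lambda>s. (Ker n m (y - (x + s *\<^sub>R ?e)) - Ker n m (y - x)) / s) \<longlongrightarrow>
              - Ker n (inc i m) (y - x)) (at 0)"
            by (simp add: DERIV_def)
          moreover have "filterlim s (at 0) sequentially"
            using s by (simp add: filterlim_at)
          ultimately have "(\<lambda>k. (Ker n m (y - (x + s k *\<^sub>R ?e)) - Ker n m (y - x)) / s k) \<longlonglongrightarrow>
              - Ker n (inc i m) (y - x)"
            by (rule filterlim_compose)
          then show "(\<lambda>k. ((Ker n m (y - (x + s k *\<^sub>R ?e)) - Ker n m (y - x)) / s k) * f y)
            \<longlonglongrightarrow> - Ker n (inc i m) (y - x) * f y"
            by (intro tendsto_mult) auto
        qed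
        show "AE y in torus. norm (((Ker n m (y - (x + s k *\<^sub>R ?e)) - Ker n m (y - x)) / s k) * f y) \<le> C * \<bar>f y\<bar>" for k
          unfolding norm_mult unfolding real_norm_def
          by (rule AE_I2, rule mult_right_mono[OF quot]) (use s in auto)
      qed measurable
      ultimately show ?thesis by (simp only: conv_def mult_minus_left integral_minus)
    qed
    then show "((\<lambda>s. conv n m f (x + s *\<^sub>R ?e)) has_real_derivative - conv n (inc i m) f x) (at 0)"
      unfolding DERIV_def tendsto_at_iff_sequentially by (auto simp: o_def)
  qed
  have per: "periodic (conv n m f)" for m
    unfolding periodic_def conv_def by (simp only: Ker_periodic_diff) simp
  show ?thesis
    unfolding C1per_def using cont deriv per
    by (auto intro!: continuous_intros simp: periodic_def)
qed

lemma conv_continuous: "integrable torus f \<Longrightarrow> continuous_on UNIV (conv n m f)"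
  using conv_C1per by (auto simp: C1per_def)

section \<open>Square integrable functions and pairs of points of the torus\<close>

lemma measure_torus_cell [simp]: "measure torus torus_cell = 1"
  using measure_torus by simp

lemma (in pair_sigma_finite) integrable_mult_pair:
  fixes f g :: "_ \<Rightarrow> real"
  assumes f: "integrable M1 f" and g: "integrable M2 g"
  shows "integrable (M1 \<Otimes>\<^sub>M M2) (\<lambda>z. f (fst z) * g (snd z))"
proof (rule Fubini_integrable)
  have [measurable]: "f \<in> borel_measurable M1" "g \<in> borel_measurable M2" using f g by auto
  show "(\<lambda>z. f (fst z) * g (snd z)) \<in> borel_measurable (M1 \<Otimes>\<^sub>M M2)" by measurable
  have "(\<integral>y. norm (f (fst (x, y)) * g (snd (x, y))) \<partial>M2) = \<bar>f x\<bar> * (\<integral>y. \<bar>g y\<bar> \<partial>M2)" for x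
    by (simp add: abs_mult)
  then show "integrable M1 (\<lambda>x. \<integral>y. norm (f (fst (x, y)) * g (snd (x, y))) \<partial>M2)"
    using f by simp
qed (use g in auto)

lemma (in pair_sigma_finite) lint_lint_fst:
  fixes H :: "_ \<Rightarrow> _ \<Rightarrow> real"
  assumes "integrable (M1 \<Otimes>\<^sub>M M2) (\<lambda>z. H (fst z) (snd z))"
  shows "(\<integral>x. (\<integral>y. H x y \<partial>M2) \<partial>M1) = (\<integral>z. H (fst z) (snd z) \<partial>(M1 \<Otimes>\<^sub>M M2))"
  using integral_fst'[OF assms] by simp

lemma (in pair_sigma_finite) lint_lint_snd:
  fixes H :: "_ \<Rightarrow> _ \<Rightarrow> real"
  assumes "integrable (M1 \<Otimes>\<^sub>M M2) (\<lambda>z. H (fst z) (snd z))"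
  shows "(\<integral>y. (\<integral>x. H x y \<partial>M1) \<partial>M2) = (\<integral>z. H (fst z) (snd z) \<partial>(M1 \<Otimes>\<^sub>M M2))"
  using integral_snd[of H] assms by (simp add: case_prod_unfold)

abbreviation torus2 :: "((real^3) \<times> (real^3)) measure" where
  "torus2 \<equiv> torus \<Otimes>\<^sub>M torus"

interpretation torus2: pair_sigma_finite torus torus ..

lemma space_torus2: "z \<in> space torus2 \<Longrightarrow> fst z \<in> torus_cell \<and> snd z \<in> torus_cell"
  by (auto simp: space_pair_measure space_restrict_space)

lemma Ker_measurable_torus2 [measurable]:
  "(\<lambda>z. Ker n m (snd z - fst z)) \<in> borel_measurable torus2"
proof -
  have "(\<lambda>z. snd z - fst z) \<in> borel_measurable torus2"
    by (intro borel_measurable_diff measurable_compose[OF measurable_snd measurable_ident_torus]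
      measurable_compose[OF measurable_fst measurable_ident_torus])
  then show ?thesis by measurable
qed

lemma integrable_Ker_mult2:
  assumes "integrable torus2 f"
  shows "integrable torus2 (\<lambda>z. Ker n m (snd z - fst z) * f z)"
proof -
  obtain C where C: "\<And>z. \<bar>Ker n m z\<bar> \<le> C" using Ker_bounded by blast
  have [measurable]: "f \<in> borel_measurable torus2" using assms by auto
  show ?thesis
  proof (rule Bochner_Integration.integrable_bound)
    show "integrable torus2 (\<lambda>z. C * \<bar>f z\<bar>)" using assms by simp
    have "0 \<le> C" using C[of 0] by linarith
    then show "AE z in torus2. norm (Ker n m (snd z - fst z) * f z) \<le> norm (C * \<bar>f z\<bar>)"
      by (intro AE_I2) (auto simp: abs_mult intro!: mult_right_mono C)
  qed measurable
qed

lemma integrable_fst_torus2: "integrable torus f \<Longrightarrow> integrable torus2 (\<lambda>z. f (fst z) :: real)"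
  using torus2.integrable_mult_pair[of f "\<lambda>_. 1"] by simp

lemma integrable_snd_torus2: "integrable torus f \<Longrightarrow> integrable torus2 (\<lambda>z. f (snd z) :: real)"
  using torus2.integrable_mult_pair[of "\<lambda>_. 1" f] by simp

lemma Ker_mass_fst:
  assumes "integrable torus f"
  shows "(LINT z|torus2. Ker n O3 (snd z - fst z) * f (fst z)) = (LINT x|torus. f x)"
proof -
  have "(LINT x|torus. LINT y|torus. Ker n O3 (y - x) * f x) = (LINT x|torus. f x)"
    by (intro Bochner_Integration.integral_cong) (auto simp: Ker_mass_right)
  then show ?thesis
    using torus2.lint_lint_fst[OF integrable_Ker_mult2[OF integrable_fst_torus2[OF assms]], of n O3]
    by simp
qed

lemma Ker_mass_snd:
  assumes "integrable torus f"
  shows "(LINT z|torus2. Ker n O3 (snd z - fst z) * f (snd z)) = (LINT y|torus. f y)"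
proof -
  have "(LINT y|torus. LINT x|torus. Ker n O3 (y - x) * f y) = (LINT y|torus. f y)"
    by (intro Bochner_Integration.integral_cong) (auto simp: Ker_mass_left)
  then show ?thesis
    using torus2.lint_lint_snd[OF integrable_Ker_mult2[OF integrable_snd_torus2[OF assms]], of n O3]
    by simp
qed

definition sqint :: "(real^3 \<Rightarrow> real) \<Rightarrow> bool" where
  "sqint f \<longleftrightarrow> f \<in> borel_measurable torus \<and> integrable torus (\<lambda>x. (f x)\<^sup>2)"

lemma sqint_measurable: "sqint f \<Longrightarrow> f \<in> borel_measurable torus"
  and sqint_square: "sqint f \<Longrightarrow> integrable torus (\<lambda>x. (f x)\<^sup>2)"
  by (auto simp: sqint_def)

lemma abs_mult_le_squares: "\<bar>a * b\<bar> \<le> (a\<^sup>2 + b\<^sup>2 :: real)"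
proof -
  have "0 \<le> (\<bar>a\<bar> - \<bar>b\<bar>)\<^sup>2" by simp
  then have "2 * (\<bar>a\<bar> * \<bar>b\<bar>) \<le> a\<^sup>2 + b\<^sup>2" by (simp add: power2_diff)
  moreover have "0 \<le> \<bar>a\<bar> * \<bar>b\<bar>" by simp
  ultimately show ?thesis unfolding abs_mult by linarith
qed

lemma sqint_mult_integrable:
  assumes "sqint f" "sqint g" shows "integrable torus (\<lambda>x. f x * g x)"
proof (rule Bochner_Integration.integrable_bound)
  note [measurable] = assms[THEN sqint_measurable]
  show "integrable torus (\<lambda>x. (f x)\<^sup>2 + (g x)\<^sup>2)" using assms by (simp add: sqint_def)
  show "(\<lambda>x. f x * g x) \<in> borel_measurable torus" by measurable
  show "AE x in torus. norm (f x * g x) \<le> norm ((f x)\<^sup>2 + (g x)\<^sup>2)"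
    using abs_mult_le_squares by (intro AE_I2) auto
qed

lemma sqint_const: "sqint (\<lambda>_. c)"
  by (simp add: sqint_def)

lemma sqint_integrable: "sqint f \<Longrightarrow> integrable torus f"
  using sqint_mult_integrable[OF _ sqint_const[of 1]] by simp

lemma sqint_mult_continuous:
  assumes c: "continuous_on UNIV c" and f: "sqint f"
  shows "sqint (\<lambda>x. c x * f x)"
proof -
  note [measurable] = f[THEN sqint_measurable]
  have [measurable]: "c \<in> borel_measurable torus"
    by (intro borel_measurable_torus borel_measurable_continuous_onI c)
  have "compact (c ` torus_cell)"
    by (intro compact_continuous_image compact_cbox continuous_on_subset[OF c]) auto
  then obtain C where C: "\<And>x. x \<in> torus_cell \<Longrightarrow> \<bar>c x\<bar> \<le> C"
    by (metis bounded_iff compact_imp_bounded image_eqI real_norm_def)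
  have "integrable torus (\<lambda>x. (c x * f x)\<^sup>2)"
  proof (rule Bochner_Integration.integrable_bound)
    show "integrable torus (\<lambda>x. C\<^sup>2 * (f x)\<^sup>2)" using f by (simp add: sqint_def)
    show "AE x in torus. norm ((c x * f x)\<^sup>2) \<le> norm (C\<^sup>2 * (f x)\<^sup>2)"
    proof (rule AE_I2)
      fix x assume "x \<in> space torus"
      then have "\<bar>c x\<bar>\<^sup>2 \<le> C\<^sup>2" using C by (intro power_mono) auto
      then show "norm ((c x * f x)\<^sup>2) \<le> norm (C\<^sup>2 * (f x)\<^sup>2)"
        by (simp add: power_mult_distrib mult_right_mono)
    qed
  qed measurable
  then show ?thesis by (simp add: sqint_def)
qed

lemma sqint_continuous: "continuous_on UNIV c \<Longrightarrow> sqint c"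
  using sqint_mult_continuous[OF _ sqint_const[of 1]] by simp

lemma sqint_diff:
  assumes "sqint f" "sqint g" shows "sqint (\<lambda>x. f x - g x)"
  using assms sqint_mult_integrable[OF assms]
  by (auto simp: sqint_def power2_diff mult.assoc)

section \<open>The averaged modulus of continuity in \<open>L\<^sup>2\<close>\<close>

text \<open>
  All mollification errors below are bounded by this quantity, since they are averages against the
  kernel of products with a difference \<open>f x - f y\<close>.
\<close>

definition omega :: "nat \<Rightarrow> (real^3 \<Rightarrow> real) \<Rightarrow> real" where
  "omega n f = (LINT z|torus2. Ker n O3 (snd z - fst z) * (f (fst z) - f (snd z))\<^sup>2)"

lemma integrable_sq_diff:
  assumes "sqint f" shows "integrable torus2 (\<lambda>z. (f (fst z) - f (snd z))\<^sup>2)"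
proof -
  have "integrable torus2 (\<lambda>z. 2 * (f (fst z) * f (snd z)))"
    using torus2.integrable_mult_pair sqint_integrable assms by auto
  moreover have "integrable torus2 (\<lambda>z. (f (fst z))\<^sup>2 + (f (snd z))\<^sup>2)"
    using integrable_fst_torus2[OF sqint_square] integrable_snd_torus2[OF sqint_square] assms by auto
  ultimately have "integrable torus2 (\<lambda>z. (f (fst z))\<^sup>2 + (f (snd z))\<^sup>2 - 2 * (f (fst z) * f (snd z)))"
    by (rule Bochner_Integration.integrable_diff[rotated])
  then show ?thesis by (simp add: power2_diff mult.assoc)
qed

lemma omega_nonneg: "0 \<le> omega n f"
  unfolding omega_def by (intro integral_nonneg_AE AE_I2 mult_nonneg_nonneg Ker_nonneg) simp

lemma omega_le:
  assumes f: "sqint f" and h: "sqint h"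
  shows "omega n f \<le> 2 * omega n h + 8 * (LINT x|torus. (f x - h x)\<^sup>2)"
proof -
  let ?k = "\<lambda>z::(real^3)\<times>(real^3). Ker n O3 (snd z - fst z)" and ?r = "\<lambda>x. f x - h x"
  have r: "sqint ?r" by (rule sqint_diff[OF f h])
  have i1: "integrable torus2 (\<lambda>z. ?k z * (h (fst z) - h (snd z))\<^sup>2)"
    by (intro integrable_Ker_mult2 integrable_sq_diff h)
  have i2: "integrable torus2 (\<lambda>z. ?k z * (?r (fst z))\<^sup>2)"
    by (intro integrable_Ker_mult2 integrable_fst_torus2[OF sqint_square[OF r]])
  have i3: "integrable torus2 (\<lambda>z. ?k z * (?r (snd z))\<^sup>2)"
    by (intro integrable_Ker_mult2 integrable_snd_torus2[OF sqint_square[OF r]])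
  have "omega n f \<le> (LINT z|torus2. 2 * (?k z * (h (fst z) - h (snd z))\<^sup>2) +
      4 * (?k z * (?r (fst z))\<^sup>2) + 4 * (?k z * (?r (snd z))\<^sup>2))"
    unfolding omega_def
  proof (rule integral_mono)
    fix z
    have sq2: "(a + b)\<^sup>2 \<le> 2 * a\<^sup>2 + 2 * b\<^sup>2" for a b :: real
      using zero_le_power2[of "a - b"] by (simp add: power2_sum power2_diff)
    have "(f (fst z) - f (snd z))\<^sup>2 = ((h (fst z) - h (snd z)) + (?r (fst z) + - ?r (snd z)))\<^sup>2"
      by simp
    also have "\<dots> \<le> 2 * (h (fst z) - h (snd z))\<^sup>2 + 2 * (?r (fst z) + - ?r (snd z))\<^sup>2" by (rule sq2)
    also have "\<dots> \<le> 2 * (h (fst z) - h (snd z))\<^sup>2 + 2 * (2 * (?r (fst z))\<^sup>2 + 2 * (- ?r (snd z))\<^sup>2)"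
      by (intro add_left_mono mult_left_mono sq2) simp
    finally have "(f (fst z) - f (snd z))\<^sup>2 \<le> 2 * (h (fst z) - h (snd z))\<^sup>2 + 4 * (?r (fst z))\<^sup>2 + 4 * (?r (snd z))\<^sup>2"
    proof -
      have arith: "X \<le> 2 * A + 4 * B + 4 * C" if "X \<le> 2 * A + 2 * (2 * B + 2 * C)" for X A B C :: real
        using that by simp
      assume "(f (fst z) - f (snd z))\<^sup>2
        \<le> 2 * (h (fst z) - h (snd z))\<^sup>2 + 2 * (2 * (?r (fst z))\<^sup>2 + 2 * (- ?r (snd z))\<^sup>2)"
      then show ?thesis unfolding power2_minus by (rule arith)
    qed
    from mult_left_mono[OF this Ker_nonneg]
    show "?k z * (f (fst z) - f (snd z))\<^sup>2 \<le> 2 * (?k z * (h (fst z) - h (snd z))\<^sup>2) +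
      4 * (?k z * (?r (fst z))\<^sup>2) + 4 * (?k z * (?r (snd z))\<^sup>2)"
      by (simp add: algebra_simps)
  qed (use i1 i2 i3 integrable_Ker_mult2[OF integrable_sq_diff[OF f]] in auto)
  also have "\<dots> = 2 * omega n h + 4 * (LINT z|torus2. ?k z * (?r (fst z))\<^sup>2) + 4 * (LINT z|torus2. ?k z * (?r (snd z))\<^sup>2)"
    using i1 i2 i3 by (simp add: omega_def)
  finally show ?thesis
    using Ker_mass_fst[OF sqint_square[OF r], of n] Ker_mass_snd[OF sqint_square[OF r], of n] by simp
qed

lemma omega_bound: "sqint f \<Longrightarrow> omega n f \<le> 8 * (LINT x|torus. (f x)\<^sup>2)"
  using omega_le[of f "\<lambda>_. 0" n] by (simp add: sqint_const omega_def)

lemma wgt_eq_1: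
  assumes "wgt z = 1" shows "z $ j \<in> \<int>"
proof -
  have "cosbump 1 (z $ j) = 1"
  proof (rule ccontr)
    assume "cosbump 1 (z $ j) \<noteq> 1"
    then have lt: "cosbump 1 (z $ j) < 1" using cosbump_range[of 1] by (simp add: less_le)
    have "wgt z = cosbump 1 (z $ j) * (\<Prod>k\<in>UNIV - {j}. cosbump 1 (z $ k))"
      unfolding wgt_def by (rule prod.remove) auto
    also have "\<dots> \<le> cosbump 1 (z $ j) * 1"
      by (intro mult_left_mono prod_le_1) (auto simp: cosbump_range)
    finally show False using lt assms by simp
  qed
  then have "cos (2 * pi * z $ j) = 1" by (simp add: cosbump_def)
  then obtain k :: int where "2 * pi * z $ j = real_of_int k * 2 * pi" using cos_one_2pi_int by blast
  then have "z $ j = of_int k" by simp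
  then show ?thesis by simp
qed

text \<open>
  Two different points of the closed cell that differ by a lattice vector lie on its boundary, where \<open>h\<close>
  vanishes; so \<open>wgt (y - x) = 1\<close> forces \<open>h x = h y\<close>. By compactness there is a bound \<open>r < 1\<close> such that
  \<open>h x\<close> and \<open>h y\<close> are close whenever \<open>wgt (y - x) > r\<close>, and elsewhere the kernel is small.
\<close>

lemma omega_tendsto_continuous:
  assumes h: "continuous_on UNIV h" and bd: "\<And>x. x \<in> torus_cell - box 0 1 \<Longrightarrow> h x = 0"
  shows "(\<lambda>n. omega n h) \<longlonglongrightarrow> 0"
proof (rule LIMSEQ_I)
  fix \<epsilon> :: real assume "\<epsilon> > 0"
  define e where "e = \<epsilon> / 3"
  have e: "e > 0" using \<open>\<epsilon> > 0\<close> by (simp add: e_def)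
  let ?S = "{z \<in> torus_cell \<times> torus_cell. e \<le> (h (fst z) - h (snd z))\<^sup>2}"
  have hc: "continuous_on A (\<lambda>z. h (fst z))" "continuous_on A (\<lambda>z. h (snd z))" for A :: "((real^3)\<times>(real^3)) set"
    by (rule continuous_on_compose2[OF h]; auto intro!: continuous_intros)+
  have "closed {z. e \<le> (h (fst z) - h (snd z))\<^sup>2}"
    by (intro closed_Collect_le continuous_intros hc)
  then have "compact ((torus_cell \<times> torus_cell) \<inter> {z. e \<le> (h (fst z) - h (snd z))\<^sup>2})"
    by (intro compact_Int_closed compact_Times compact_cbox)
  then have comp: "compact ?S"
    by (simp add: Int_def)
  have wc: "continuous_on ?S (\<lambda>z. wgt (snd z - fst z))"
    by (rule continuous_on_compose2[OF wgt_continuous[of UNIV]]) (auto intro!: continuous_intros)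
  have lt1: "wgt (snd z - fst z) < 1" if z: "z \<in> ?S" for z
  proof (rule ccontr)
    assume "\<not> wgt (snd z - fst z) < 1"
    then have w: "wgt (snd z - fst z) = 1" using wgt_range[of "snd z - fst z"] by linarith
    have cell: "fst z \<in> torus_cell" "snd z \<in> torus_cell" using z by auto
    have "fst z \<noteq> snd z" using z e by auto
    then obtain j where j: "fst z $ j \<noteq> snd z $ j" by (auto simp: vec_eq_iff)
    have rng: "0 \<le> fst z $ j" "fst z $ j \<le> 1" "0 \<le> snd z $ j" "snd z $ j \<le> 1"
      using cell by (auto simp: mem_box_cart)
    obtain k :: int where k: "snd z $ j - fst z $ j = of_int k"
      using wgt_eq_1[OF w, of j] by (auto elim!: Ints_cases)
    with j have "k \<noteq> 0" by auto
    then have "k \<le> -1 \<or> 1 \<le> k" by linarith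
    then have "real_of_int k \<le> -1 \<or> 1 \<le> real_of_int k" by auto
    with k rng have "(fst z $ j = 0 \<or> fst z $ j = 1) \<and> (snd z $ j = 0 \<or> snd z $ j = 1)"
      by linarith
    then have "fst z \<notin> box 0 1" "snd z \<notin> box 0 1"
      unfolding mem_box_cart by (auto intro!: exI[of _ j])
    then have "h (fst z) = 0" "h (snd z) = 0" using cell bd by auto
    with z e show False by simp
  qed
  have "\<exists>r. 0 \<le> r \<and> r < 1 \<and> (\<forall>z\<in>?S. wgt (snd z - fst z) \<le> r)"
  proof (cases "?S = {}")
    case True
    then have "\<forall>z\<in>?S. wgt (snd z - fst z) \<le> 0" by blast
    then show ?thesis by (intro exI[of _ 0] conjI) auto
  next
    case False
    then obtain z0 where "z0 \<in> ?S" "\<And>z. z \<in> ?S \<Longrightarrow> wgt (snd z - fst z) \<le> wgt (snd z0 - fst z0)"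
      using continuous_attains_sup[OF comp _ wc] by blast
    then show ?thesis using wgt_range lt1 by blast
  qed
  then obtain r where r: "0 \<le> r" "r < 1" "\<And>z. z \<in> ?S \<Longrightarrow> wgt (snd z - fst z) \<le> r"
    by blast
  have "compact (h ` torus_cell)"
    by (intro compact_continuous_image compact_cbox continuous_on_subset[OF h]) auto
  then obtain C where C: "\<And>x. x \<in> torus_cell \<Longrightarrow> \<bar>h x\<bar> \<le> C"
    by (metis bounded_iff compact_imp_bounded image_eqI real_norm_def)
  define M where "M = (2 * C)\<^sup>2 + 1"
  have M: "M > 0" unfolding M_def by (intro add_nonneg_pos) auto
  have hM: "(h x - h y)\<^sup>2 \<le> M" if "x \<in> torus_cell" "y \<in> torus_cell" for x y
  proof -
    have "\<bar>h x - h y\<bar> \<le> 2 * C" using C[OF that(1)] C[OF that(2)] by linarith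
    then have "\<bar>h x - h y\<bar>\<^sup>2 \<le> (2 * C)\<^sup>2" by (intro power_mono) auto
    then show ?thesis by (simp add: M_def)
  qed
  have "\<forall>\<^sub>F n in sequentially. \<forall>z. wgt z \<le> r \<longrightarrow> Ker n O3 z < e / M"
    using r e M by (intro Ker_concentration) auto
  then obtain N where N: "\<And>n z. n \<ge> N \<Longrightarrow> wgt z \<le> r \<Longrightarrow> Ker n O3 z < e / M"
    by (auto simp: eventually_sequentially)
  have int1: "integrable torus2 (\<lambda>z. 1::real)" using integrable_fst_torus2[of "\<lambda>_. 1"] by simp
  show "\<exists>no. \<forall>n\<ge>no. norm (omega n h - 0) < \<epsilon>"
  proof (intro exI[of _ N] allI impI)
    fix n assume n: "n \<ge> N"
    let ?k = "\<lambda>z::(real^3)\<times>(real^3). Ker n O3 (snd z - fst z)"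
    have "omega n h \<le> (LINT z|torus2. e * (?k z * 1) + e * 1)"
      unfolding omega_def
    proof (rule integral_mono)
      fix z assume "z \<in> space torus2"
      then have cell: "fst z \<in> torus_cell" "snd z \<in> torus_cell" using space_torus2 by auto
      show "?k z * (h (fst z) - h (snd z))\<^sup>2 \<le> e * (?k z * 1) + e * 1"
      proof (cases "z \<in> ?S")
        case True
        then have "?k z \<le> e / M" using N[OF n] r(3) by (auto intro: less_imp_le)
        then have "?k z * (h (fst z) - h (snd z))\<^sup>2 \<le> (e / M) * M"
          using hM[OF cell] M e by (intro mult_mono) auto
        then show ?thesis using M e Ker_nonneg[of n "snd z - fst z"] by (simp add: add_increasing)
      next
        case False
        then have "(h (fst z) - h (snd z))\<^sup>2 \<le> e" using cell by (cases z) auto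
        then have "?k z * (h (fst z) - h (snd z))\<^sup>2 \<le> ?k z * e"
          by (rule mult_left_mono[OF _ Ker_nonneg])
        then show ?thesis using e by (simp add: mult.commute)
      qed
    qed (intro integrable_Ker_mult2 integrable_sq_diff sqint_continuous h
        Bochner_Integration.integrable_add integrable_mult_right int1)+
    also have "\<dots> = e * (LINT z|torus2. ?k z * 1) + e * (LINT z|torus2. 1)"
      by (subst Bochner_Integration.integral_add)
         (intro integrable_mult_right integrable_Ker_mult2 int1, intro integrable_mult_right int1,
          simp only: integral_mult_right_zero)
    also have "(LINT z|torus2. ?k z * 1) = 1"
      using Ker_mass_fst[of "\<lambda>_. 1" n] by simp
    also have "(LINT z|torus2. (1::real)) = 1"
      using torus2.lint_lint_fst[of "\<lambda>_ _. 1"] int1 by simp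
    finally have "omega n h \<le> 2 * e" by simp
    then show "norm (omega n h - 0) < \<epsilon>"
      using omega_nonneg[of n h] \<open>\<epsilon> > 0\<close> by (simp add: e_def)
  qed
qed

text \<open>
  A measurable function is almost everywhere a limit of continuous functions. Clipping these and
  multiplying them by a cutoff that grows to \<open>1\<close> in the open cell makes the convergence dominated
  and the boundary values \<open>0\<close>.
\<close>

lemma sqint_approx_bounded:
  fixes f :: "real^3 \<Rightarrow> real"
  assumes f: "f \<in> borel_measurable torus" and fM: "\<And>x. \<bar>f x\<bar> \<le> M" and \<epsilon>: "\<epsilon> > 0"
  shows "\<exists>h. continuous_on UNIV h \<and> (\<forall>x \<in> torus_cell - box 0 1. h x = 0) \<and>
    (LINT x|torus. (f x - h x)\<^sup>2) < \<epsilon>"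
proof -
  note [measurable] = f
  have "f measurable_on torus_cell"
    using f measurable_on_iff_borel_measurable[of torus_cell f] by simp
  then obtain N g where N: "negligible N" and g: "\<And>k. continuous_on UNIV (g k)"
    and lim: "\<And>x. x \<notin> N \<Longrightarrow> (\<lambda>k::nat. g k x) \<longlonglongrightarrow> (if x \<in> torus_cell then f x else 0)"
    unfolding measurable_on_def by blast
  define b :: "real^3 \<Rightarrow> real" where "b x = \<bar>\<Prod>j\<in>UNIV. x $ j * (1 - x $ j)\<bar>" for x
  define h where "h k x = max (- M) (min M (g k x)) * min 1 (real k * b x)" for k x
  have hc: "continuous_on UNIV (h k)" for k
    unfolding h_def b_def by (intro continuous_intros g)
  have b0: "b x = 0" if x: "x \<in> torus_cell - box 0 1" for x
  proof -
    obtain j where "\<not> (0 < x $ j \<and> x $ j < 1)" using x by (auto simp: mem_box_cart)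
    moreover have "0 \<le> x $ j" "x $ j \<le> 1" using x by (auto simp: mem_box_cart)
    ultimately have "x $ j * (1 - x $ j) = 0" by auto
    then have "(\<Prod>j\<in>UNIV. x $ j * (1 - x $ j)) = 0" by (intro prod_zero) auto
    then show ?thesis by (simp add: b_def)
  qed
  have bpos: "b x > 0" if "x \<in> box 0 1" for x
  proof -
    have "(\<Prod>j\<in>UNIV. x $ j * (1 - x $ j)) > 0"
      using that by (intro prod_pos) (auto simp: mem_box_cart)
    then show ?thesis by (simp add: b_def)
  qed
  have M0: "0 \<le> M" using fM[of 0] by linarith
  have hM: "\<bar>h k x\<bar> \<le> M" for k x
  proof -
    have "\<bar>max (- M) (min M (g k x))\<bar> \<le> M" using M0 by linarith
    moreover have "0 \<le> real k * b x" by (simp add: b_def)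
    then have "\<bar>min 1 (real k * b x)\<bar> \<le> 1" by linarith
    ultimately have "\<bar>h k x\<bar> \<le> M * 1" unfolding h_def abs_mult by (intro mult_mono) auto
    then show ?thesis by simp
  qed
  have ae: "AE x in torus. x \<in> box 0 1 \<and> x \<notin> N"
  proof -
    have "negligible (N \<union> (torus_cell - box 0 1))"
      by (rule negligible_Un[OF N negligible_frontier_interval])
    then have "N \<union> (torus_cell - box 0 1) \<in> null_sets lebesgue" by (simp add: negligible_iff_null_sets)
    then have "AE x in lebesgue. x \<notin> N \<union> (torus_cell - box 0 1)" by (rule AE_not_in)
    then have "AE x in torus. x \<notin> N \<union> (torus_cell - box 0 1)"
      by (subst AE_restrict_space_iff) auto
    then show ?thesis
      using AE_space by eventually_elim (auto simp: space_restrict_space)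
  qed
  have "(\<lambda>k. LINT x|torus. (f x - h k x)\<^sup>2) \<longlonglongrightarrow> (LINT x|torus. 0)"
  proof (rule integral_dominated_convergence)
    show "integrable torus (\<lambda>x. (2 * M)\<^sup>2)" by simp
    have [measurable]: "h k \<in> borel_measurable torus" for k
      by (intro borel_measurable_torus borel_measurable_continuous_onI hc)
    show "(\<lambda>x. (f x - h k x)\<^sup>2) \<in> borel_measurable torus" for k by measurable
    show "AE x in torus. norm ((f x - h k x)\<^sup>2) \<le> (2 * M)\<^sup>2" for k
    proof (rule AE_I2)
      fix x
      have "\<bar>f x - h k x\<bar> \<le> 2 * M" using fM[of x] hM[of k x] by linarith
      then have "\<bar>f x - h k x\<bar>\<^sup>2 \<le> (2 * M)\<^sup>2" by (intro power_mono) auto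
      then show "norm ((f x - h k x)\<^sup>2) \<le> (2 * M)\<^sup>2" by simp
    qed
    show "AE x in torus. (\<lambda>k. (f x - h k x)\<^sup>2) \<longlonglongrightarrow> 0"
      using ae AE_space
    proof eventually_elim
      case (elim x)
      have "(\<lambda>k. g k x) \<longlonglongrightarrow> f x" using elim lim[of x] by (auto simp: space_restrict_space)
      then have "(\<lambda>k. max (- M) (min M (g k x))) \<longlonglongrightarrow> max (- M) (min M (f x))"
        by (intro tendsto_intros)
      also have "max (- M) (min M (f x)) = f x" using fM[of x] by linarith
      finally have 1: "(\<lambda>k. max (- M) (min M (g k x))) \<longlonglongrightarrow> f x" .
      have "\<forall>\<^sub>F k in sequentially. 1 / b x \<le> real k"
        using real_arch_simple by (metis eventually_sequentially order_trans of_nat_le_iff)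
      then have "\<forall>\<^sub>F k in sequentially. min 1 (real k * b x) = 1"
        using bpos[of x] elim by (auto elim!: eventually_mono simp: field_simps)
      then have 2: "(\<lambda>k. min 1 (real k * b x)) \<longlonglongrightarrow> 1" by (rule tendsto_eventually)
      have "(\<lambda>k. (f x - h k x)\<^sup>2) \<longlonglongrightarrow> (f x - f x * 1)\<^sup>2"
        unfolding h_def by (intro tendsto_intros 1 2)
      then show ?case by simp
    qed
  qed simp
  then have "\<forall>\<^sub>F k in sequentially. (LINT x|torus. (f x - h k x)\<^sup>2) < \<epsilon>"
    by (rule order_tendstoD(2)) (use \<epsilon> in simp)
  then obtain k where "(LINT x|torus. (f x - h k x)\<^sup>2) < \<epsilon>"
    by (auto simp: eventually_sequentially)
  moreover have "h k x = 0" if "x \<in> torus_cell - box 0 1" for x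
    using b0[OF that] by (simp add: h_def)
  ultimately show ?thesis using hc by blast
qed

lemma sqint_approx:
  assumes f: "sqint f" and \<epsilon>: "\<epsilon> > 0"
  shows "\<exists>h. continuous_on UNIV h \<and> (\<forall>x \<in> torus_cell - box 0 1. h x = 0) \<and>
    (LINT x|torus. (f x - h x)\<^sup>2) < \<epsilon>"
proof -
  note [measurable] = f[THEN sqint_measurable]
  define c where "c k x = max (- real k) (min (real k) (f x))" for k x
  have [measurable]: "c k \<in> borel_measurable torus" for k unfolding c_def by measurable
  have ck: "\<bar>c k x\<bar> \<le> real k" for k x unfolding c_def by linarith
  have fc: "\<bar>f x - c k x\<bar> \<le> \<bar>f x\<bar>" for k x unfolding c_def by linarith
  have "(\<lambda>k. LINT x|torus. (f x - c k x)\<^sup>2) \<longlonglongrightarrow> (LINT x|torus. 0)"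
  proof (rule integral_dominated_convergence)
    show "integrable torus (\<lambda>x. (f x)\<^sup>2)" using f by (simp add: sqint_def)
    show "AE x in torus. norm ((f x - c k x)\<^sup>2) \<le> (f x)\<^sup>2" for k
      using power_mono[OF fc abs_ge_zero, of _ k 2] by (intro AE_I2) simp
    show "AE x in torus. (\<lambda>k. (f x - c k x)\<^sup>2) \<longlonglongrightarrow> 0"
    proof (rule AE_I2)
      fix x
      have "\<forall>\<^sub>F k in sequentially. \<bar>f x\<bar> \<le> real k"
        using real_arch_simple by (metis eventually_sequentially order_trans of_nat_le_iff)
      then have "\<forall>\<^sub>F k in sequentially. (f x - c k x)\<^sup>2 = 0"
        by eventually_elim (auto simp: c_def)
      then show "(\<lambda>k. (f x - c k x)\<^sup>2) \<longlonglongrightarrow> 0" by (rule tendsto_eventually)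
    qed
  qed measurable
  then have "\<forall>\<^sub>F k in sequentially. (LINT x|torus. (f x - c k x)\<^sup>2) < \<epsilon> / 4"
    by (rule order_tendstoD(2)) (use \<epsilon> in simp)
  then obtain k where k: "(LINT x|torus. (f x - c k x)\<^sup>2) < \<epsilon> / 4"
    by (auto simp: eventually_sequentially)
  obtain h where h: "continuous_on UNIV h" "\<forall>x \<in> torus_cell - box 0 1. h x = 0"
    and ch: "(LINT x|torus. (c k x - h x)\<^sup>2) < \<epsilon> / 4"
    using sqint_approx_bounded[of "c k" "real k" "\<epsilon> / 4"] ck \<epsilon> by auto
  have c: "sqint (c k)"
    unfolding sqint_def
  proof
    show "integrable torus (\<lambda>x. (c k x)\<^sup>2)"
    proof (rule Bochner_Integration.integrable_bound)
      show "integrable torus (\<lambda>x. (real k)\<^sup>2)" by simp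
      show "AE x in torus. norm ((c k x)\<^sup>2) \<le> norm ((real k)\<^sup>2)"
        using power_mono[OF ck abs_ge_zero, of _ _ 2] by (intro AE_I2) simp
    qed measurable
  qed measurable
  have i: "integrable torus (\<lambda>x. (f x - c k x)\<^sup>2)" "integrable torus (\<lambda>x. (c k x - h x)\<^sup>2)"
    "integrable torus (\<lambda>x. (f x - h x)\<^sup>2)"
    by (intro sqint_square sqint_diff f c sqint_continuous h)+
  have "(LINT x|torus. (f x - h x)\<^sup>2) \<le> (LINT x|torus. 2 * (f x - c k x)\<^sup>2 + 2 * (c k x - h x)\<^sup>2)"
  proof (rule integral_mono)
    fix x
    show "(f x - h x)\<^sup>2 \<le> 2 * (f x - c k x)\<^sup>2 + 2 * (c k x - h x)\<^sup>2"
      using zero_le_power2[of "(f x - c k x) - (c k x - h x)"]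
      by (simp add: power2_eq_square algebra_simps)
  qed (use i in auto)
  also have "\<dots> = 2 * (LINT x|torus. (f x - c k x)\<^sup>2) + 2 * (LINT x|torus. (c k x - h x)\<^sup>2)"
    using i by simp
  finally have "(LINT x|torus. (f x - h x)\<^sup>2) < \<epsilon>"
    using k ch by linarith
  then show ?thesis using h by blast
qed

lemma omega_tendsto:
  assumes f: "sqint f"
  shows "(\<lambda>n. omega n f) \<longlonglongrightarrow> 0"
proof (rule LIMSEQ_I)
  fix \<epsilon> :: real assume "\<epsilon> > 0"
  then obtain h where h: "continuous_on UNIV h" "\<forall>x \<in> torus_cell - box 0 1. h x = 0"
    and fh: "(LINT x|torus. (f x - h x)\<^sup>2) < \<epsilon> / 16"
    using sqint_approx[OF f, of "\<epsilon> / 16"] by auto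
  have "(\<lambda>n. omega n h) \<longlonglongrightarrow> 0"
    using h by (intro omega_tendsto_continuous) auto
  then obtain N where N: "\<And>n. n \<ge> N \<Longrightarrow> omega n h < \<epsilon> / 4"
    using \<open>\<epsilon> > 0\<close> order_tendstoD(2)[of _ 0 sequentially "\<epsilon> / 4"] by (auto simp: eventually_sequentially)
  have "omega n f < \<epsilon>" if "n \<ge> N" for n
    using omega_le[OF f sqint_continuous[OF h(1)], of n] N[OF that] fh by linarith
  then show "\<exists>no. \<forall>n\<ge>no. norm (omega n f - 0) < \<epsilon>"
    using omega_nonneg by auto
qed

section \<open>Errors of mollification\<close>

lemma young_half:
  fixes a b \<theta> :: real
  assumes "\<theta> > 0"
  shows "\<bar>a * b\<bar> \<le> (\<theta> * a\<^sup>2 + b\<^sup>2 / \<theta>) / 2"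
proof -
  have "0 \<le> (\<bar>a\<bar> - \<bar>b / \<theta>\<bar>)\<^sup>2" by simp
  then have "2 * \<bar>a\<bar> * \<bar>b / \<theta>\<bar> \<le> a\<^sup>2 + (b / \<theta>)\<^sup>2" by (simp only: power2_diff power2_abs)
  from mult_left_mono[OF this less_imp_le[OF assms]]
  have "2 * (\<theta> * \<bar>a\<bar> * \<bar>b / \<theta>\<bar>) \<le> \<theta> * a\<^sup>2 + \<theta> * (b / \<theta>)\<^sup>2" by (simp add: algebra_simps)
  moreover have "\<theta> * \<bar>a\<bar> * \<bar>b / \<theta>\<bar> = \<bar>a * b\<bar>" "\<theta> * (b / \<theta>)\<^sup>2 = b\<^sup>2 / \<theta>"
    using assms by (simp_all add: abs_mult abs_divide power2_eq_square)
  ultimately show ?thesis by simp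
qed

text \<open>
  The common form of the errors below: an average of products of some \<open>a\<close>, taken at either of the two
  points, with the oscillation of \<open>w\<close>. The parameter \<open>\<theta>\<close> replaces the Cauchy-Schwarz inequality and
  keeps the bound linear, so that it can be integrated in time.
\<close>

lemma oscillation_average_bound:
  assumes a: "sqint a" and w: "sqint w" and \<theta>: "\<theta> > 0"
    and c: "c \<in> borel_measurable torus2" "\<And>z. \<bar>c z\<bar> \<le> 1"
  shows "integrable torus2 (\<lambda>z. Ker n O3 (snd z - fst z) * (c z * (a (fst z) * (w (snd z) - w (fst z)))))" (is ?I1)
    and "\<bar>LINT z|torus2. Ker n O3 (snd z - fst z) * (c z * (a (fst z) * (w (snd z) - w (fst z))))\<bar>
      \<le> (\<theta> * (LINT x|torus. (a x)\<^sup>2) + omega n w / \<theta>) / 2" (is ?B1)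
    and "integrable torus2 (\<lambda>z. Ker n O3 (snd z - fst z) * (c z * (a (snd z) * (w (snd z) - w (fst z)))))" (is ?I2)
    and "\<bar>LINT z|torus2. Ker n O3 (snd z - fst z) * (c z * (a (snd z) * (w (snd z) - w (fst z))))\<bar>
      \<le> (\<theta> * (LINT x|torus. (a x)\<^sup>2) + omega n w / \<theta>) / 2" (is ?B2)
proof -
  let ?k = "\<lambda>z::(real^3)\<times>(real^3). Ker n O3 (snd z - fst z)"
  note [measurable] = a[THEN sqint_measurable] w[THEN sqint_measurable] c(1)
  have gen: "integrable torus2 (\<lambda>z. ?k z * (c z * (a (p z) * (w (snd z) - w (fst z))))) \<and>
      \<bar>LINT z|torus2. ?k z * (c z * (a (p z) * (w (snd z) - w (fst z))))\<bar>
      \<le> (\<theta> * (LINT x|torus. (a x)\<^sup>2) + omega n w / \<theta>) / 2"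
    if [measurable]: "p \<in> torus2 \<rightarrow>\<^sub>M torus"
      and ip: "integrable torus2 (\<lambda>z. ?k z * (a (p z))\<^sup>2)"
      and mass: "(LINT z|torus2. ?k z * (a (p z))\<^sup>2) = (LINT x|torus. (a x)\<^sup>2)" for p
  proof -
    let ?g = "\<lambda>z. (\<theta> * (?k z * (a (p z))\<^sup>2) + (?k z * (w (fst z) - w (snd z))\<^sup>2) / \<theta>) / 2"
    have iw: "integrable torus2 (\<lambda>z. ?k z * (w (fst z) - w (snd z))\<^sup>2)"
      by (intro integrable_Ker_mult2 integrable_sq_diff w)
    have ig: "integrable torus2 ?g"
      using ip iw by (intro integrable_divide Bochner_Integration.integrable_add integrable_mult_right)
    have bd: "\<bar>?k z * (c z * (a (p z) * (w (snd z) - w (fst z))))\<bar> \<le> ?g z" for z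
    proof -
      have "\<bar>c z\<bar> * \<bar>a (p z) * (w (snd z) - w (fst z))\<bar> \<le> 1 * ((\<theta> * (a (p z))\<^sup>2 + (w (snd z) - w (fst z))\<^sup>2 / \<theta>) / 2)"
        by (intro mult_mono c young_half \<theta>) auto
      from mult_left_mono[OF this Ker_nonneg[of n "snd z - fst z"]]
      have "?k z * (\<bar>c z\<bar> * \<bar>a (p z) * (w (snd z) - w (fst z))\<bar>) \<le>
          ?k z * ((\<theta> * (a (p z))\<^sup>2 + (w (fst z) - w (snd z))\<^sup>2 / \<theta>) / 2)"
        by (simp add: power2_commute)
      moreover have "\<bar>?k z * (c z * (a (p z) * (w (snd z) - w (fst z))))\<bar> =
          ?k z * (\<bar>c z\<bar> * \<bar>a (p z) * (w (snd z) - w (fst z))\<bar>)"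
        by (simp only: abs_mult abs_of_nonneg[OF Ker_nonneg])
      moreover have "?k z * ((\<theta> * (a (p z))\<^sup>2 + (w (fst z) - w (snd z))\<^sup>2 / \<theta>) / 2) = ?g z"
        by (simp add: distrib_left mult.left_commute)
      ultimately show ?thesis by simp
    qed
    have int: "integrable torus2 (\<lambda>z. ?k z * (c z * (a (p z) * (w (snd z) - w (fst z)))))"
    proof (rule Bochner_Integration.integrable_bound[OF ig])
      show "AE z in torus2. norm (?k z * (c z * (a (p z) * (w (snd z) - w (fst z))))) \<le> norm (?g z)"
        by (rule AE_I2, unfold real_norm_def, rule order_trans[OF bd abs_ge_self])
    qed measurable
    have "\<bar>LINT z|torus2. ?k z * (c z * (a (p z) * (w (snd z) - w (fst z))))\<bar> \<le>
        (LINT z|torus2. \<bar>?k z * (c z * (a (p z) * (w (snd z) - w (fst z))))\<bar>)"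
      by (rule integral_abs_bound)
    also have "\<dots> \<le> (LINT z|torus2. ?g z)"
      by (intro integral_mono integrable_abs int ig bd)
    also have "\<dots> = (\<theta> * (LINT z|torus2. ?k z * (a (p z))\<^sup>2) + omega n w / \<theta>) / 2"
      unfolding omega_def using ip iw by simp
    finally show ?thesis using int mass by simp
  qed
  have 1: "integrable torus2 (\<lambda>z. ?k z * (a (fst z))\<^sup>2)"
    by (intro integrable_Ker_mult2 integrable_fst_torus2[OF sqint_square] a)
  have 2: "integrable torus2 (\<lambda>z. ?k z * (a (snd z))\<^sup>2)"
    by (intro integrable_Ker_mult2 integrable_snd_torus2[OF sqint_square] a)
  show ?I1 ?B1
    using gen[OF measurable_fst 1 Ker_mass_fst[OF sqint_square[OF a]]] by blast+
  show ?I2 ?B2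
    using gen[OF measurable_snd 2 Ker_mass_snd[OF sqint_square[OF a]]] by blast+
qed

lemma integrable_Ker_mult_pair:
  assumes "integrable torus f" "integrable torus w"
  shows "integrable torus2 (\<lambda>z. Ker n m (snd z - fst z) * (f (fst z) * w (snd z)))"
  using assms by (intro integrable_Ker_mult2 torus2.integrable_mult_pair)

lemma lint_mult_conv:
  assumes "integrable torus f" "integrable torus w"
  shows "(LINT x|torus. f x * conv n m w x) = (LINT z|torus2. Ker n m (snd z - fst z) * (f (fst z) * w (snd z)))"
proof -
  have "(LINT x|torus. f x * conv n m w x) = (LINT x|torus. LINT y|torus. Ker n m (y - x) * (f x * w y))"
    by (simp add: conv_def mult_ac)
  then show ?thesis
    using torus2.lint_lint_fst[OF integrable_Ker_mult_pair[OF assms]] by simp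
qed

lemma pairing_error:
  assumes f: "sqint f" and w: "sqint w" and \<theta>: "\<theta> > 0"
  shows "\<bar>(LINT x|torus. f x * conv n O3 w x) - (LINT x|torus. f x * w x)\<bar>
    \<le> (\<theta> * (LINT x|torus. (f x)\<^sup>2) + omega n w / \<theta>) / 2"
proof -
  let ?k = "\<lambda>z::(real^3)\<times>(real^3). Ker n O3 (snd z - fst z)"
  have "(LINT x|torus. f x * conv n O3 w x) - (LINT x|torus. f x * w x) =
      (LINT z|torus2. ?k z * (f (fst z) * w (snd z))) - (LINT z|torus2. ?k z * (f (fst z) * w (fst z)))"
    using lint_mult_conv[OF sqint_integrable[OF f] sqint_integrable[OF w]]
      Ker_mass_fst[OF sqint_mult_integrable[OF f w]] by simp
  also have "\<dots> = (LINT z|torus2. ?k z * (f (fst z) * w (snd z)) - ?k z * (f (fst z) * w (fst z)))"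
    by (rule Bochner_Integration.integral_diff[symmetric])
       (intro integrable_Ker_mult_pair sqint_integrable f w,
        intro integrable_Ker_mult2 integrable_fst_torus2[OF sqint_mult_integrable[OF f w]])
  also have "\<dots> = (LINT z|torus2. ?k z * (1 * (f (fst z) * (w (snd z) - w (fst z)))))"
    by (simp add: algebra_simps)
  finally show ?thesis
    using oscillation_average_bound(2)[OF f w \<theta>, of "\<lambda>_. 1" n] by simp
qed

text \<open>Let \<open>n\<close> tend to infinity for fixed \<open>\<theta>\<close>, and then \<open>\<theta>\<close> to zero.\<close>

lemma tendsto_of_young_bound:
  fixes x :: "nat \<Rightarrow> real"
  assumes bd: "\<And>n \<theta>. \<theta> > 0 \<Longrightarrow> \<bar>x n - L\<bar> \<le> (\<theta> * A + w n / \<theta>) / 2" and w: "w \<longlonglongrightarrow> 0" and A: "0 \<le> A"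
  shows "x \<longlonglongrightarrow> L"
proof (rule LIMSEQ_I)
  fix \<epsilon> :: real assume "\<epsilon> > 0"
  define \<theta> where "\<theta> = \<epsilon> / (A + 1)"
  have \<theta>: "\<theta> > 0" using \<open>\<epsilon> > 0\<close> A by (simp add: \<theta>_def)
  have "\<theta> * A \<le> \<epsilon>"
    using A \<open>\<epsilon> > 0\<close> by (simp add: \<theta>_def field_simps)
  have "(\<lambda>n. w n / \<theta>) \<longlonglongrightarrow> 0 / \<theta>" using \<theta> by (intro tendsto_intros w) auto
  then have "\<forall>\<^sub>F n in sequentially. w n / \<theta> < \<epsilon>"
    using \<open>\<epsilon> > 0\<close> by (auto intro: order_tendstoD)
  then obtain N where N: "\<And>n. n \<ge> N \<Longrightarrow> w n / \<theta> < \<epsilon>" by (auto simp: eventually_sequentially)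
  have "\<bar>x n - L\<bar> < \<epsilon>" if "n \<ge> N" for n
  proof -
    have "(P + Q) / 2 < \<epsilon>" if "P \<le> \<epsilon>" "Q < \<epsilon>" for P Q :: real using that by simp
    from le_less_trans[OF bd[OF \<theta>] this[OF \<open>\<theta> * A \<le> \<epsilon>\<close> N[OF that]]] show ?thesis .
  qed
  then show "\<exists>no. \<forall>n\<ge>no. norm (x n - L) < \<epsilon>" by auto
qed

lemma pairing_tendsto:
  assumes "sqint f" "sqint w"
  shows "(\<lambda>n. LINT x|torus. f x * conv n O3 w x) \<longlonglongrightarrow> (LINT x|torus. f x * w x)"
  by (rule tendsto_of_young_bound[OF pairing_error[OF assms] omega_tendsto[OF assms(2)]]) auto

lemma conv_L1_error:
  assumes w: "sqint w" and \<theta>: "\<theta> > 0"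
  shows "(LINT x|torus. \<bar>conv n O3 w x - w x\<bar>) \<le> (\<theta> + omega n w / \<theta>) / 2"
proof -
  note [measurable] = w[THEN sqint_measurable]
  let ?s = "\<lambda>z. sgn (conv n O3 w (fst z) - w (fst z))"
  have cv: "sqint (conv n O3 w)" by (intro sqint_continuous conv_continuous sqint_integrable w)
  note [measurable] = cv[THEN sqint_measurable]
  have s: "?s \<in> borel_measurable torus2" "\<And>z. \<bar>?s z\<bar> \<le> 1"
    subgoal by measurable
    subgoal by (simp add: abs_sgn_eq)
    done
  have eq: "\<bar>conv n O3 w x - w x\<bar> = (LINT y|torus. Ker n O3 (y - x) * (?s (x, y) * (1 * (w y - w x))))"
    if "x \<in> torus_cell" for x
  proof -
    have i: "integrable torus (\<lambda>y. Ker n O3 (y - x) * w y)" "integrable torus (\<lambda>y. Ker n O3 (y - x) * w x)"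
      by (intro integrable_Ker_mult sqint_integrable w, intro integrable_Ker_mult) simp
    have "conv n O3 w x - w x = (LINT y|torus. Ker n O3 (y - x) * w y) - (LINT y|torus. Ker n O3 (y - x) * w x)"
      by (simp add: conv_def Ker_mass_right[OF that])
    also have "\<dots> = (LINT y|torus. Ker n O3 (y - x) * (w y - w x))"
      using i by (simp add: right_diff_distrib)
    finally have "sgn (conv n O3 w x - w x) * (conv n O3 w x - w x) =
        (LINT y|torus. sgn (conv n O3 w x - w x) * (Ker n O3 (y - x) * (w y - w x)))"
      by simp
    then show ?thesis by (simp add: mult_ac abs_sgn)
  qed
  have "(LINT x|torus. \<bar>conv n O3 w x - w x\<bar>) =
      (LINT x|torus. LINT y|torus. Ker n O3 (y - x) * (?s (x, y) * (1 * (w y - w x))))"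
    by (intro Bochner_Integration.integral_cong eq) auto
  also have "\<dots> = (LINT z|torus2. Ker n O3 (snd z - fst z) * (?s z * (1 * (w (snd z) - w (fst z)))))"
    using torus2.lint_lint_fst[of "\<lambda>x y. Ker n O3 (y - x) * (?s (x, y) * (1 * (w y - w x)))"]
      oscillation_average_bound(1)[OF sqint_const[of 1] w \<theta> s, of n] by simp
  also have "\<dots> \<le> (\<theta> + omega n w / \<theta>) / 2"
    using oscillation_average_bound(2)[OF sqint_const[of 1] w \<theta> s, of n] by simp
  finally show ?thesis .
qed

section \<open>The advection-diffusion operator at a fixed time\<close>

text \<open>
  The mollification of \<open>\<nu> \<Delta>d - div (d u)\<close>, with all derivatives moved to the kernel.
\<close>

definition advdiff :: "real \<Rightarrow> (real^3 \<Rightarrow> real) \<Rightarrow> (3 \<Rightarrow> real^3 \<Rightarrow> real) \<Rightarrow> nat \<Rightarrow> real^3 \<Rightarrow> real" where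
  "advdiff \<nu> d u n x = \<nu> * (\<Sum>i\<in>UNIV. conv n (inc i (inc i O3)) d x)
    + (\<Sum>i\<in>UNIV. conv n (inc i O3) (\<lambda>y. d y * u i y) x)"

text \<open>
  A scalar \<open>d\<close> with weak gradient \<open>G\<close> and a velocity \<open>u\<close> of weak divergence zero, where both weak
  identities are only required for the translates of the kernels.
\<close>

locale slice =
  fixes d :: "real^3 \<Rightarrow> real" and u G :: "3 \<Rightarrow> real^3 \<Rightarrow> real"
  assumes d: "sqint d" and u: "\<And>i. sqint (u i)" and G: "\<And>i. sqint (G i)"
    and weak_grad: "\<And>n i m x. conv n (inc i m) d x = - conv n m (G i) x"
    and weak_div: "\<And>n x. (\<Sum>i\<in>UNIV. conv n (inc i O3) (u i) x) = 0"
begin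

lemma uG: "integrable torus (\<lambda>y. u i y * G i y)"
  by (rule sqint_mult_integrable[OF u G])

lemma C1per_conv_d: "C1per (conv n O3 d) (\<lambda>i. conv n O3 (G i))"
  using conv_C1per[OF sqint_integrable[OF d], of n O3] weak_grad[of n O3] by simp

text \<open>Incompressibility extends from the kernels to all \<open>C\<^sup>1\<close> test functions by mollifying \<open>u\<close>.\<close>

lemma incompressible:
  assumes g: "C1per g g'"
  shows "(\<Sum>i\<in>UNIV. LINT x|torus. u i x * g' i x) = 0"
proof -
  have gc: "sqint g" "\<And>i. sqint (g' i)"
    using g by (auto simp: C1per_def intro: sqint_continuous)
  have "(\<Sum>i\<in>UNIV. LINT x|torus. g' i x * conv m O3 (u i) x) = 0" for m
  proof -
    have "(LINT x|torus. g' i x * conv m O3 (u i) x) = (LINT x|torus. g x * conv m (inc i O3) (u i) x)" for i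
      using integration_by_parts[OF g conv_C1per[OF sqint_integrable[OF u], of m O3 i], of i] by simp
    then have "(\<Sum>i\<in>UNIV. LINT x|torus. g' i x * conv m O3 (u i) x) =
        (\<Sum>i\<in>UNIV. LINT x|torus. g x * conv m (inc i O3) (u i) x)" by simp
    also have "\<dots> = (LINT x|torus. (\<Sum>i\<in>UNIV. g x * conv m (inc i O3) (u i) x))"
      by (intro Bochner_Integration.integral_sum[symmetric] sqint_mult_integrable gc
        sqint_continuous conv_continuous sqint_integrable u)
    also have "\<dots> = 0" by (simp add: sum_distrib_left[symmetric] weak_div)
    finally show ?thesis .
  qed
  moreover have "(\<lambda>m. \<Sum>i\<in>UNIV. LINT x|torus. g' i x * conv m O3 (u i) x) \<longlonglongrightarrow>
      (\<Sum>i\<in>UNIV. LINT x|torus. g' i x * u i x)"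
    by (intro tendsto_sum pairing_tendsto gc u)
  ultimately have "(\<lambda>m. 0) \<longlonglongrightarrow> (\<Sum>i\<in>UNIV. LINT x|torus. g' i x * u i x)" by simp
  from LIMSEQ_unique[OF tendsto_const this]
  have "(\<Sum>i\<in>UNIV. LINT x|torus. g' i x * u i x) = 0" ..
  then show ?thesis by (simp add: mult.commute)
qed

text \<open>
  The product rule \<open>div (d u) = u \<cdot> \<nabla>d\<close>, tested with a kernel: incompressibility tested with the
  product of the kernel and the mollified \<open>d\<close>.
\<close>

lemma advection_product_rule:
  "(\<Sum>i\<in>UNIV. conv n (inc i O3) (\<lambda>y. d y * u i y) x) = - (\<Sum>i\<in>UNIV. conv n O3 (\<lambda>y. u i y * G i y) x)"
proof -
  let ?\<phi> = "\<lambda>y. Ker n O3 (y - x)" and ?\<phi>' = "\<lambda>i y. Ker n (inc i O3) (y - x)"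
  have s: "sqint (\<lambda>y. ?\<phi>' i y * u i y)" "sqint (\<lambda>y. ?\<phi> y * u i y)" for i
    by (intro sqint_mult_continuous u continuous_intros)+
  have cv: "sqint (conv m O3 d)" "sqint (conv m O3 (G i))" for m i
    by (intro sqint_continuous conv_continuous sqint_integrable d G)+
  have "(\<Sum>i\<in>UNIV. (LINT y|torus. ?\<phi>' i y * u i y * conv m O3 d y) + (LINT y|torus. ?\<phi> y * u i y * conv m O3 (G i) y)) = 0" for m
  proof -
    have "0 = (\<Sum>i\<in>UNIV. LINT y|torus. u i y * (?\<phi>' i y * conv m O3 d y + ?\<phi> y * conv m O3 (G i) y))"
      using incompressible[OF C1per_mult[OF C1per_Ker_right C1per_conv_d]] by simp
    also have "\<dots> = (\<Sum>i\<in>UNIV. LINT y|torus. ?\<phi>' i y * u i y * conv m O3 d y + ?\<phi> y * u i y * conv m O3 (G i) y)"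
      by (simp add: algebra_simps)
    also have "\<dots> = (\<Sum>i\<in>UNIV. (LINT y|torus. ?\<phi>' i y * u i y * conv m O3 d y) + (LINT y|torus. ?\<phi> y * u i y * conv m O3 (G i) y))"
      by (intro sum.cong refl Bochner_Integration.integral_add sqint_mult_integrable s cv)
    finally show ?thesis by simp
  qed
  moreover have "(\<lambda>m. \<Sum>i\<in>UNIV. (LINT y|torus. ?\<phi>' i y * u i y * conv m O3 d y) + (LINT y|torus. ?\<phi> y * u i y * conv m O3 (G i) y))
      \<longlonglongrightarrow> (\<Sum>i\<in>UNIV. (LINT y|torus. ?\<phi>' i y * u i y * d y) + (LINT y|torus. ?\<phi> y * u i y * G i y))"
    by (intro tendsto_sum tendsto_add pairing_tendsto s d G)
  ultimately have "(\<lambda>m. 0) \<longlonglongrightarrow> (\<Sum>i\<in>UNIV. (LINT y|torus. ?\<phi>' i y * u i y * d y) + (LINT y|torus. ?\<phi> y * u i y * G i y))"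
    by simp
  from LIMSEQ_unique[OF tendsto_const this]
  have "(\<Sum>i\<in>UNIV. (LINT y|torus. ?\<phi>' i y * u i y * d y) + (LINT y|torus. ?\<phi> y * u i y * G i y)) = 0" ..
  then have "(\<Sum>i\<in>UNIV. LINT y|torus. ?\<phi>' i y * u i y * d y) = - (\<Sum>i\<in>UNIV. LINT y|torus. ?\<phi> y * u i y * G i y)"
    by (simp add: sum.distrib)
  then show ?thesis by (simp add: conv_def mult_ac)
qed

lemma advdiff_eq:
  "advdiff \<nu> d u n x = - (\<nu> * (\<Sum>i\<in>UNIV. conv n (inc i O3) (G i) x)) - (\<Sum>i\<in>UNIV. conv n O3 (\<lambda>y. u i y * G i y) x)"
proof -
  have "conv n (inc i (inc i O3)) d x = - conv n (inc i O3) (G i) x" for i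
    by (rule weak_grad)
  then show ?thesis
    unfolding advdiff_def advection_product_rule by (simp only: sum_negf mult_minus_right)
qed

text \<open>
  Diffusion has a sign because \<open>b\<close> is convex. The advection term of the mollified function, tested
  with \<open>b' (d\<^sub>n)\<close>, vanishes by incompressibility; subtracting it from the mollified advection term
  leaves an average of products of \<open>G\<close> with the oscillation of \<open>u\<close>.
\<close>

lemma energy_inequality:
  assumes \<nu>: "\<nu> \<ge> 0" and \<theta>: "\<theta> > 0"
    and b: "\<And>s. (b has_real_derivative b' s) (at s)" "\<And>s. (b' has_real_derivative b'' s) (at s)"
      "continuous_on UNIV b''" "\<And>s. 0 \<le> b'' s" "\<And>s. \<bar>b' s\<bar> \<le> 1"
  shows "(LINT x|torus. b' (conv n O3 d x) * advdiff \<nu> d u n x)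
    \<le> (\<Sum>i\<in>UNIV. (\<theta> * (LINT x|torus. (G i x)\<^sup>2) + omega n (u i) / \<theta>) / 2)"
proof -
  let ?k = "\<lambda>z::(real^3)\<times>(real^3). Ker n O3 (snd z - fst z)"
  let ?b = "\<lambda>x. b' (conv n O3 d x)"
  have b'c: "continuous_on UNIV b'"
    by (meson DERIV_isCont continuous_at_imp_continuous_on b(2))
  have dc: "continuous_on UNIV (conv n O3 d)" by (intro conv_continuous sqint_integrable d)
  have bc: "continuous_on UNIV ?b" by (rule continuous_on_compose2[OF b'c dc]) auto
  have GI: "integrable torus (G i)" for i by (intro sqint_integrable G)
  have [measurable]: "?b \<in> borel_measurable torus"
    by (intro borel_measurable_torus borel_measurable_continuous_onI bc)
  have iCV: "integrable torus (\<lambda>x. ?b x * conv n m f x)" if "integrable torus f" for m f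
    by (intro continuous_integrable_torus continuous_intros bc conv_continuous that)
  have diffusion: "0 \<le> (LINT x|torus. ?b x * conv n (inc i O3) (G i) x)" for i
  proof -
    have "(LINT x|torus. ?b x * - conv n (inc i O3) (G i) x) =
        - (LINT x|torus. (b'' (conv n O3 d x) * conv n O3 (G i) x) * conv n O3 (G i) x)"
      using integration_by_parts[OF C1per_compose[OF C1per_conv_d b(2,3)] conv_C1per[OF GI, of n O3 i]] by simp
    moreover have "0 \<le> (LINT x|torus. (b'' (conv n O3 d x) * conv n O3 (G i) x) * conv n O3 (G i) x)"
      using b(4) by (intro integral_nonneg_AE AE_I2) (simp add: mult.assoc)
    ultimately show ?thesis by simp
  qed
  have "(LINT x|torus. ?b x * advdiff \<nu> d u n x) = (LINT x|torus.
      - (\<nu> * (\<Sum>i\<in>UNIV. ?b x * conv n (inc i O3) (G i) x)) - (\<Sum>i\<in>UNIV. ?b x * conv n O3 (\<lambda>y. u i y * G i y) x))"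
    unfolding advdiff_eq by (simp add: algebra_simps sum_distrib_left)
  also have "\<dots> = - (\<nu> * (\<Sum>i\<in>UNIV. LINT x|torus. ?b x * conv n (inc i O3) (G i) x))
      - (\<Sum>i\<in>UNIV. LINT x|torus. ?b x * conv n O3 (\<lambda>y. u i y * G i y) x)"
    using iCV[OF GI] iCV[OF uG] by simp
  also have "\<dots> \<le> - (\<Sum>i\<in>UNIV. LINT x|torus. ?b x * conv n O3 (\<lambda>y. u i y * G i y) x)"
    using mult_nonneg_nonneg[OF \<nu> sum_nonneg[of UNIV, OF diffusion]] by simp
  also have "\<dots> = (\<Sum>i\<in>UNIV. (LINT x|torus. (?b x * u i x) * conv n O3 (G i) x)
      - (LINT x|torus. ?b x * conv n O3 (\<lambda>y. u i y * G i y) x))"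
    using incompressible[OF C1per_compose[OF C1per_conv_d b(1) b'c], of n]
    by (simp add: sum_subtractf mult_ac)
  also have "\<dots> \<le> (\<Sum>i\<in>UNIV. (\<theta> * (LINT x|torus. (G i x)\<^sup>2) + omega n (u i) / \<theta>) / 2)"
  proof (rule sum_mono)
    fix i
    let ?c = "\<lambda>z. - ?b (fst z)"
    have c: "?c \<in> borel_measurable torus2" "\<And>z. \<bar>?c z\<bar> \<le> 1"
      using b(5)[of "conv n O3 d _"] by (measurable, simp)
    have bu: "integrable torus (\<lambda>x. ?b x * u i x)"
      by (intro sqint_integrable sqint_mult_continuous bc u)
    have b1: "integrable torus ?b" by (intro continuous_integrable_torus bc)
    have "(LINT x|torus. (?b x * u i x) * conv n O3 (G i) x) - (LINT x|torus. ?b x * conv n O3 (\<lambda>y. u i y * G i y) x)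
        = (LINT z|torus2. ?k z * (?b (fst z) * u i (fst z) * G i (snd z))) - (LINT z|torus2. ?k z * (?b (fst z) * (u i (snd z) * G i (snd z))))"
      using lint_mult_conv[OF bu GI] lint_mult_conv[OF b1 uG] by simp
    also have "\<dots> = (LINT z|torus2. ?k z * (?b (fst z) * u i (fst z) * G i (snd z)) - ?k z * (?b (fst z) * (u i (snd z) * G i (snd z))))"
      using integrable_Ker_mult_pair[OF bu GI] integrable_Ker_mult_pair[OF b1 uG]
      by (rule Bochner_Integration.integral_diff[symmetric])
    also have "\<dots> = (LINT z|torus2. ?k z * (?c z * (G i (snd z) * (u i (snd z) - u i (fst z)))))"
      by (simp add: algebra_simps)
    also have "\<dots> \<le> (\<theta> * (LINT x|torus. (G i x)\<^sup>2) + omega n (u i) / \<theta>) / 2"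
      using oscillation_average_bound(4)[OF G u \<theta> c, of n i i] by linarith
    finally show "(LINT x|torus. (?b x * u i x) * conv n O3 (G i) x) - (LINT x|torus. ?b x * conv n O3 (\<lambda>y. u i y * G i y) x)
        \<le> (\<theta> * (LINT x|torus. (G i x)\<^sup>2) + omega n (u i) / \<theta>) / 2" .
  qed
  finally show ?thesis .
qed

end

section \<open>Weak ordinary differential equations\<close>

abbreviation tm :: "real \<Rightarrow> real measure" where
  "tm T \<equiv> lebesgue_on {0<..<T}"

lemma finite_measure_tm: "finite_measure (tm T)"
  by (intro finite_measure_lebesgue_on) (simp add: bounded_set_imp_lmeasurable)

lemma measurable_ident_tm [measurable]: "(\<lambda>x. x) \<in> tm T \<rightarrow>\<^sub>M borel"
  by (intro measurable_restrict_space1 measurable_completion) simp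

lemma borel_measurable_tm: "f \<in> borel_measurable borel \<Longrightarrow> f \<in> borel_measurable (tm T)"
  by (intro measurable_restrict_space1 measurable_completion) simp

lemma integrable_continuous_mult:
  assumes c: "continuous_on UNIV c" and f: "integrable (tm T) f"
  shows "integrable (tm T) (\<lambda>t. c t * f t :: real)"
proof -
  note [measurable] = borel_measurable_integrable[OF f] borel_measurable_tm[OF borel_measurable_continuous_onI[OF c]]
  have "compact (c ` {0..T})"
    by (intro compact_continuous_image continuous_on_subset[OF c]) auto
  then obtain C where C: "\<And>x. x \<in> {0..T} \<Longrightarrow> \<bar>c x\<bar> \<le> C"
    by (metis bounded_iff compact_imp_bounded image_eqI real_norm_def)
  show ?thesis
  proof (rule Bochner_Integration.integrable_bound)
    show "integrable (tm T) (\<lambda>t. C * f t)" using f by simp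
    show "AE t in tm T. norm (c t * f t) \<le> norm (C * f t)"
    proof (rule AE_I2)
      fix t assume "t \<in> space (tm T)"
      then have "\<bar>c t\<bar> \<le> \<bar>C\<bar>" using C[of t] by (auto simp: space_restrict_space)
      then show "norm (c t * f t) \<le> norm (C * f t)" by (simp add: abs_mult mult_right_mono)
    qed
  qed measurable
qed

lemma continuous_integrable_tm:
  fixes f :: "real \<Rightarrow> real"
  assumes "continuous_on UNIV f"
  shows "integrable (tm T) f"
  using integrable_continuous_mult[OF assms finite_measure.integrable_const[OF finite_measure_tm], of T 1]
  by simp

lemma lint_tm_eq:
  fixes f :: "real \<Rightarrow> real"
  assumes "integrable (tm T) f"
  shows "(f has_integral (LINT t|tm T. f t)) {0..T}"
proof -
  have "(f has_integral (LINT t|tm T. f t)) {0<..<T}"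
    by (rule has_integral_integral_lebesgue_on[OF assms]) simp
  then show ?thesis
    using has_integral_Icc_iff_Ioo by blast
qed

text \<open>
  The step of du Bois-Reymond's argument that turns functions of mean zero into admissible derivatives:
  the primitive starting at \<open>0\<close> vanishes again to the right of the support.
\<close>

lemma antiderivative_with_support:
  fixes \<xi> :: "real \<Rightarrow> real"
  assumes c: "continuous_on UNIV \<xi>" and supp: "\<And>t. t \<notin> {a..b} \<Longrightarrow> \<xi> t = 0" and ab: "0 < a" "b < T" "0 \<le> T"
    and zero: "(\<xi> has_integral 0) {0..T}"
  shows "\<exists>\<eta>. (\<forall>t. (\<eta> has_real_derivative \<xi> t) (at t)) \<and> (\<forall>t. t \<notin> {a..b} \<longrightarrow> \<eta> t = 0)"
proof (intro exI conjI allI impI)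
  define \<eta> where "\<eta> t = integral {0..t} \<xi>" for t
  have int: "\<xi> integrable_on {x..y}" for x y
    by (intro integrable_continuous_real continuous_on_subset[OF c]) auto
  have left: "\<eta> t = 0" if "t < a" for t
  proof -
    have "\<eta> t = integral {0..t} (\<lambda>_. 0)"
      unfolding \<eta>_def by (rule integral_cong) (use that supp in auto)
    then show ?thesis by simp
  qed
  show "(\<eta> has_real_derivative \<xi> t) (at t)" for t
  proof (cases "t < a")
    case True
    have "((\<lambda>_. 0) has_real_derivative 0) (at t)" by simp
    then have "(\<eta> has_real_derivative 0) (at t)"
      by (rule has_field_derivative_transform_within_open[where S="{..<a}"]) (use True left in auto)
    with True supp[of t] show ?thesis by simp
  next
    case False
    have "(\<eta> has_vector_derivative \<xi> t) (at t within {0..t + 1})"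
      unfolding \<eta>_def
      by (rule integral_has_vector_derivative[OF continuous_on_subset[OF c]]) (use False ab in auto)
    moreover have "at t within {0..t + 1} = at t"
      by (rule at_within_interior) (use False ab in \<open>auto simp: interior_atLeastAtMost_real\<close>)
    ultimately show ?thesis
      by (simp add: has_real_derivative_iff_has_vector_derivative)
  qed
  show "\<eta> t = 0" if t: "t \<notin> {a..b}" for t
  proof (cases "t < a")
    case False
    then have "b < t" "0 < t" using t ab by auto
    show ?thesis
    proof (cases "t \<le> T")
      case True
      have "integral {0..t} \<xi> + integral {t..T} \<xi> = integral {0..T} \<xi>"
        by (rule Henstock_Kurzweil_Integration.integral_combine) (use True \<open>0 < t\<close> int in auto)
      moreover have "integral {t..T} \<xi> = integral {t..T} (\<lambda>_. 0)"
        by (rule integral_cong) (use \<open>b < t\<close> supp in auto)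
      ultimately show ?thesis using zero by (simp add: \<eta>_def integral_unique)
    next
      case False
      have "integral {0..T} \<xi> + integral {T..t} \<xi> = integral {0..t} \<xi>"
        by (rule Henstock_Kurzweil_Integration.integral_combine) (use False ab int in auto)
      moreover have "integral {T..t} \<xi> = integral {T..t} (\<lambda>_. 0)"
        by (rule integral_cong) (use ab supp in auto)
      ultimately show ?thesis using zero by (simp add: \<eta>_def integral_unique)
    qed
  qed (use left in auto)
qed

text \<open>
  For large \<open>k\<close> a smooth approximation of the indicator function of the interval from \<open>p\<close> to \<open>q\<close>.
  The arguments of \<open>flat\<close> are expanded to match the affine form in the rules of \<open>elementary\<close>.
\<close>

definition bump :: "real \<Rightarrow> real \<Rightarrow> real \<Rightarrow> real \<Rightarrow> real" where
  "bump p q k t = flat 0 (k * t + - (k * p)) * flat 0 (- k * t + k * q)"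

lemma elementary_bump: "elementary (bump p q k)"
  unfolding bump_def[abs_def] by (rule elementary.mult[OF elementary.flat elementary.flat])

lemma bump_eq: "bump p q k t = flat 0 (k * (t - p)) * flat 0 (k * (q - t))"
proof -
  have "k * t + - (k * p) = k * (t - p)" "- k * t + k * q = k * (q - t)" by (simp_all add: algebra_simps)
  then show ?thesis unfolding bump_def by (simp only:)
qed

lemma bump_continuous: "continuous_on UNIV (bump p q k)"
  using smooth1_continuous[OF elementary_smooth1[OF elementary_bump], of UNIV 0] by simp

lemma flat_range: "0 \<le> flat 0 x" "flat 0 x \<le> 1"
  by (auto simp: flat_def)

lemma bump_range: "0 \<le> bump p q k t" "bump p q k t \<le> 1"
  unfolding bump_def using flat_range by (auto intro: mult_le_one)

lemma bump_support:
  assumes "k > 0" "t \<notin> {p<..<q}" shows "bump p q k t = 0"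
proof -
  have "k * (t - p) \<le> 0 \<or> k * (q - t) \<le> 0"
    using assms by (auto simp: mult_le_0_iff)
  then show ?thesis unfolding bump_eq by (auto simp: flat_def)
qed

lemma flat_scaled_tendsto_1:
  assumes "x > 0" shows "(\<lambda>k. flat 0 (real (Suc k) * x)) \<longlonglongrightarrow> 1"
proof -
  have "(\<lambda>k. exp (- (inverse (real (Suc k)) * inverse x))) \<longlonglongrightarrow> exp (- (0 * inverse x))"
    by (intro tendsto_intros LIMSEQ_inverse_real_of_nat)
  moreover have "flat 0 (real (Suc k) * x) = exp (- (inverse (real (Suc k)) * inverse x))" for k
    using assms by (simp add: flat_def mult_le_0_iff divide_inverse inverse_mult_distrib del: of_nat_Suc)
  ultimately show ?thesis by simp
qed

lemma bump_tendsto_indicator: "(\<lambda>k. bump p q (real (Suc k)) t) \<longlonglongrightarrow> indicator {p<..<q} t"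
proof (cases "t \<in> {p<..<q}")
  case True
  have "(\<lambda>k. flat 0 (real (Suc k) * (t - p)) * flat 0 (real (Suc k) * (q - t))) \<longlonglongrightarrow> 1 * 1"
    using True by (intro tendsto_mult flat_scaled_tendsto_1) auto
  with True show ?thesis by (simp only: bump_eq indicator_simps mult_1)
next
  case False
  then show ?thesis by (simp add: bump_support[OF _ False])
qed

lemma integrable_indicator_mult:
  fixes f :: "real \<Rightarrow> real"
  assumes "integrable (tm T) f" "A \<in> sets borel"
  shows "integrable (tm T) (\<lambda>s. indicator A s * f s)"
proof -
  have "{0<..<T} \<inter> A \<in> sets borel" using assms(2) by auto
  then have "A \<inter> {0<..<T} \<in> sets (tm T)" by (auto simp: sets_restrict_space_iff Int_commute)
  from integrable_mult_indicator[OF this assms(1)]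
  show ?thesis
    by (rule Bochner_Integration.integrable_cong[THEN iffD1, rotated 2])
       (auto simp: space_restrict_space indicator_def)
qed

text \<open>Lebesgue's differentiation theorem: the integrals over small intervals determine the function.\<close>

lemma AE_zero_of_interval_integrals:
  assumes f: "integrable (tm T) f"
    and zero: "\<And>p q. 0 < p \<Longrightarrow> p < q \<Longrightarrow> q < T \<Longrightarrow> (LINT t|tm T. indicator {p<..<q} t * f t) = 0"
  shows "AE t in tm T. f t = (0::real)"
proof -
  define h where "h t = (if t \<in> {0<..<T} then f t else 0)" for t
  have "(f has_integral (LINT t|tm T. f t)) {0<..<T}"
    by (rule has_integral_integral_lebesgue_on[OF f]) simp
  then have "h integrable_on UNIV"
    unfolding h_def integrable_restrict_UNIV by (rule has_integral_integrable)
  then have h: "h integrable_on cbox a b" for a b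
    by (rule integrable_on_subcbox) simp
  have h0: "integral (cbox p q) h = 0" if pq: "0 < p" "p < q" "q < T" for p q
  proof -
    have "integrable (tm T) (\<lambda>t. indicator {p<..<q} t * f t)"
      by (intro integrable_indicator_mult f) simp
    from has_integral_integral_lebesgue_on[OF this]
    have "((\<lambda>t. indicator {p<..<q} t * f t) has_integral 0) {0<..<T}"
      using zero[OF pq] by simp
    then have "((\<lambda>t. if t \<in> {0<..<T} then indicator {p<..<q} t * f t else 0) has_integral 0) UNIV"
      by (simp only: has_integral_restrict_UNIV)
    moreover have "(\<lambda>t. if t \<in> {0<..<T} then indicator {p<..<q} t * f t else 0) =
        (\<lambda>t. if t \<in> {p<..<q} then h t else 0)"
      using pq by (auto simp: fun_eq_iff h_def indicator_def)
    ultimately have "(h has_integral 0) {p<..<q}"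
      by (simp only: has_integral_restrict_UNIV)
    then have "(h has_integral 0) {p..q}"
      using has_integral_Icc_iff_Ioo by blast
    then show ?thesis by (simp add: integral_unique)
  qed
  obtain N where N: "negligible N"
    and lim: "\<And>x e. x \<notin> N \<Longrightarrow> 0 < e \<Longrightarrow> \<exists>r>0. \<forall>s. 0 < s \<and> s < r \<longrightarrow>
      norm (integral (cbox x (x + s *\<^sub>R One)) h /\<^sub>R s ^ DIM(real) - h x) < e"
    using integrable_ccontinuous_explicit[OF h] by blast
  have "h x = 0" if x: "x \<notin> N" "x \<in> {0<..<T}" for x
  proof (rule ccontr)
    assume "h x \<noteq> 0"
    then obtain r where r: "r > 0" "\<And>s. 0 < s \<Longrightarrow> s < r \<Longrightarrow> norm (integral (cbox x (x + s *\<^sub>R One)) h /\<^sub>R s ^ DIM(real) - h x) < \<bar>h x\<bar>"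
      using lim[OF x(1), of "\<bar>h x\<bar>"] by auto
    define s where "s = min r (T - x) / 2"
    have s: "0 < s" "s < r" using r(1) x(2) by (auto simp: s_def)
    have "s \<le> (T - x) / 2" by (simp add: s_def)
    then have "x + s < T" using x(2) by (simp add: field_simps)
    have "integral (cbox x (x + s)) h = 0" using h0[of x "x + s"] s x \<open>x + s < T\<close> by auto
    then show False using r(2)[OF s(1,2)] by simp
  qed
  then have "f x = 0" if "x \<notin> N" "x \<in> {0<..<T}" for x
    using that by (auto simp: h_def)
  moreover have "AE x in tm T. x \<notin> N"
  proof -
    have "AE x in lebesgue. x \<notin> N" using N by (intro AE_not_in) (simp add: negligible_iff_null_sets)
    then show ?thesis by (subst AE_restrict_space_iff) auto
  qed
  ultimately show ?thesis
    using AE_space by (auto simp: space_restrict_space intro: AE_mp)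
qed

lemma AE_zero_of_bump_integrals:
  fixes f :: "real \<Rightarrow> real"
  assumes f: "integrable (tm T) f"
    and zero: "\<And>p q k. 0 < p \<Longrightarrow> q < T \<Longrightarrow> k > 0 \<Longrightarrow> (LINT t|tm T. bump p q k t * f t) = 0"
  shows "AE t in tm T. f t = 0"
proof (rule AE_zero_of_interval_integrals[OF f])
  fix p q assume pq: "0 < p" "p < q" "q < T"
  have "(\<lambda>k. LINT t|tm T. bump p q (real (Suc k)) t * f t) \<longlonglongrightarrow> (LINT t|tm T. indicator {p<..<q} t * f t)"
  proof (rule integral_dominated_convergence)
    show "integrable (tm T) (\<lambda>t. \<bar>f t\<bar>)" using f by auto
    show "AE t in tm T. (\<lambda>k. bump p q (real (Suc k)) t * f t) \<longlonglongrightarrow> indicator {p<..<q} t * f t"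
      by (intro AE_I2 tendsto_mult bump_tendsto_indicator tendsto_const)
    show "AE t in tm T. norm (bump p q (real (Suc k)) t * f t) \<le> \<bar>f t\<bar>" for k
      using bump_range by (intro AE_I2) (simp add: abs_mult mult_left_le_one_le)
    show "(\<lambda>t. bump p q (real (Suc k)) t * f t) \<in> borel_measurable (tm T)" for k
      by (rule borel_measurable_integrable[OF integrable_continuous_mult[OF bump_continuous f]])
    show "(\<lambda>t. indicator {p<..<q} t * f t) \<in> borel_measurable (tm T)"
      by (rule borel_measurable_integrable[OF integrable_indicator_mult[OF f]]) simp
  qed
  then have "(\<lambda>k. 0) \<longlonglongrightarrow> (LINT t|tm T. indicator {p<..<q} t * f t)"
    using zero[OF pq(1,3)] by simp
  from LIMSEQ_unique[OF tendsto_const this]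
  show "(LINT t|tm T. indicator {p<..<q} t * f t) = 0" ..
qed

lemma convex_tangent:
  assumes b: "\<And>s. (b has_real_derivative b' s) (at s)" and mono: "\<And>r s. r \<le> s \<Longrightarrow> b' r \<le> b' s"
  shows "b x - b y \<le> b' x * (x - y)"
proof -
  consider "x = y" | "x < y" | "y < x" by linarith
  then show ?thesis
  proof cases
    case 2
    then obtain z where "x < z" "z < y" "b y - b x = (y - x) * b' z"
      using MVT2[of x y b b'] b by blast
    moreover have "(y - x) * b' x \<le> (y - x) * b' z"
      using 2 \<open>x < z\<close> mono by (intro mult_left_mono) auto
    ultimately show ?thesis by (simp add: algebra_simps)
  next
    case 3
    then obtain z where "y < z" "z < x" "b x - b y = (x - y) * b' z"
      using MVT2[of y x b b'] b by blast
    moreover have "(x - y) * b' z \<le> (x - y) * b' x"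
      using 3 \<open>z < x\<close> mono by (intro mult_left_mono) auto
    ultimately show ?thesis by (simp add: algebra_simps)
  qed simp
qed

text \<open>
  The weak formulation of \<open>g' = F\<close> on the open interval, together with the initial condition \<open>g 0 = 0\<close>
  in the essential sense.
\<close>

locale weak_ode =
  fixes T :: real and g F :: "real \<Rightarrow> real"
  assumes T: "T > 0" and g: "integrable (tm T) g" and F: "integrable (tm T) F"
    and eq: "\<And>\<eta> a b. smooth1 \<eta> \<Longrightarrow> 0 < a \<Longrightarrow> b < T \<Longrightarrow> (\<And>t. t \<notin> {a..b} \<Longrightarrow> \<eta> t = 0) \<Longrightarrow>
      (LINT t|tm T. deriv \<eta> t * g t + \<eta> t * F t) = 0"
    and init: "\<And>\<epsilon>. \<epsilon> > 0 \<Longrightarrow> \<exists>\<delta>>0. AE t in tm T. t < \<delta> \<longrightarrow> \<bar>g t\<bar> < \<epsilon>"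
begin

sublocale tm: finite_measure "tm T" by (rule finite_measure_tm)

sublocale tm2: pair_sigma_finite "tm T" "tm T" ..

definition primitive :: "real \<Rightarrow> real" where
  "primitive t = (LINT s|tm T. indicator {..t} s * F s)"

lemma F_measurable [measurable]: "F \<in> borel_measurable (tm T)"
  and g_measurable [measurable]: "g \<in> borel_measurable (tm T)"
  using F g by auto

lemma AE_neq: "AE s in tm T. s \<noteq> c"
proof -
  have "AE s in lebesgue. s \<notin> {c}" by (intro AE_not_in) (simp add: negligible_iff_null_sets[symmetric])
  then show ?thesis by (subst AE_restrict_space_iff) auto
qed

lemma primitive_continuous: "continuous_on UNIV primitive"
proof (intro continuous_at_imp_continuous_on ballI continuous_at_sequentiallyI)
  fix v and t :: real assume v: "v \<longlonglongrightarrow> t"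
  show "(\<lambda>k. primitive (v k)) \<longlonglongrightarrow> primitive t"
    unfolding primitive_def
  proof (rule integral_dominated_convergence)
    show "integrable (tm T) (\<lambda>s. \<bar>F s\<bar>)" using F by auto
    show "AE s in tm T. norm (indicator {..v k} s * F s) \<le> \<bar>F s\<bar>" for k
      by (intro AE_I2) (auto simp: indicator_def)
    show "AE s in tm T. (\<lambda>k. indicator {..v k} s * F s) \<longlonglongrightarrow> indicator {..t} s * F s"
      using AE_neq[of t]
    proof eventually_elim
      case (elim s)
      have "\<forall>\<^sub>F k in sequentially. indicator {..v k} s = (indicator {..t} s :: real)"
      proof (cases "s < t")
        case True
        then have "\<forall>\<^sub>F k in sequentially. s < v k" using v by (auto intro: order_tendstoD)
        then show ?thesis by eventually_elim (use True in auto)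
      next
        case False
        then have "t < s" using elim by auto
        then have "\<forall>\<^sub>F k in sequentially. v k < s" using v by (auto intro: order_tendstoD)
        then show ?thesis by eventually_elim (use \<open>t < s\<close> in auto)
      qed
      then have "(\<lambda>k. indicator {..v k} s :: real) \<longlonglongrightarrow> indicator {..t} s" by (rule tendsto_eventually)
      then show ?case by (intro tendsto_mult) auto
    qed
  qed measurable
qed

lemma primitive_le_0: "t \<le> 0 \<Longrightarrow> primitive t = 0"
  unfolding primitive_def
  by (subst Bochner_Integration.integral_cong[where g="\<lambda>_. 0"]) (auto simp: space_restrict_space)

lemma measurable_le_tm2 [measurable]: "(\<lambda>z. indicator {..fst z} (snd z) :: real) \<in> borel_measurable (tm T \<Otimes>\<^sub>M tm T)"
proof -
  have [measurable]: "(\<lambda>z. fst z) \<in> borel_measurable (tm T \<Otimes>\<^sub>M tm T)" "(\<lambda>z. snd z) \<in> borel_measurable (tm T \<Otimes>\<^sub>M tm T)"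
    by (intro measurable_compose[OF measurable_fst measurable_ident_tm]
      measurable_compose[OF measurable_snd measurable_ident_tm])+
  have "(\<lambda>z. if snd z \<le> fst z then 1 else 0 :: real) \<in> borel_measurable (tm T \<Otimes>\<^sub>M tm T)" by measurable
  then show ?thesis by (simp add: indicator_def)
qed

lemma lint_triangle:
  fixes h f :: "real \<Rightarrow> real"
  assumes h: "integrable (tm T) h" and f: "integrable (tm T) f"
  shows "(LINT t|tm T. h t * (LINT s|tm T. indicator {..t} s * f s)) = (LINT s|tm T. f s * (LINT t|tm T. indicator {s..} t * h t))"
    and "integrable (tm T) (\<lambda>t. h t * (LINT s|tm T. indicator {..t} s * f s))"
proof -
  note [measurable] = borel_measurable_integrable[OF h] borel_measurable_integrable[OF f]
  have i: "integrable (tm T \<Otimes>\<^sub>M tm T) (\<lambda>z. h (fst z) * (indicator {..fst z} (snd z) * f (snd z)))"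
  proof (rule Bochner_Integration.integrable_bound[OF tm2.integrable_mult_pair[OF h f]])
    show "AE z in tm T \<Otimes>\<^sub>M tm T. norm (h (fst z) * (indicator {..fst z} (snd z) * f (snd z))) \<le> norm (h (fst z) * f (snd z))"
      by (intro AE_I2) (auto simp: indicator_def)
  qed measurable
  have e: "h t * (indicator {..t} s * f s) = f s * (indicator {s..} t * h t)" for s t
    by (simp add: indicator_def)
  have "(LINT t|tm T. h t * (LINT s|tm T. indicator {..t} s * f s)) = (LINT t|tm T. LINT s|tm T. h t * (indicator {..t} s * f s))"
    by simp
  also have "\<dots> = (LINT s|tm T. LINT t|tm T. h t * (indicator {..t} s * f s))"
    unfolding tm2.lint_lint_fst[of "\<lambda>t s. h t * (indicator {..t} s * f s)", OF i]
      tm2.lint_lint_snd[of "\<lambda>t s. h t * (indicator {..t} s * f s)", OF i] ..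
  also have "\<dots> = (LINT s|tm T. LINT t|tm T. f s * (indicator {s..} t * h t))"
    by (simp only: e)
  finally show "(LINT t|tm T. h t * (LINT s|tm T. indicator {..t} s * f s)) = (LINT s|tm T. f s * (LINT t|tm T. indicator {s..} t * h t))"
    by simp
  show "integrable (tm T) (\<lambda>t. h t * (LINT s|tm T. indicator {..t} s * f s))"
    using tm2.integrable_fst'[OF i] by simp
qed

lemma primitive_weak_derivative:
  assumes \<eta>: "smooth1 \<eta>" and ab: "0 < a" "b < T" and supp: "\<And>t. t \<notin> {a..b} \<Longrightarrow> \<eta> t = 0"
  shows "(LINT t|tm T. deriv \<eta> t * primitive t) = - (LINT s|tm T. \<eta> s * F s)"
    and "integrable (tm T) (\<lambda>t. deriv \<eta> t * primitive t)"
proof -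
  have dc: "continuous_on UNIV (deriv \<eta>)" using smooth1_continuous[OF \<eta>, of UNIV 1] by simp
  have di: "integrable (tm T) (deriv \<eta>)" by (rule continuous_integrable_tm[OF dc])
  have inner: "(LINT t|tm T. indicator {s..} t * deriv \<eta> t) = - \<eta> s" if s: "s \<in> {0<..<T}" for s
  proof -
    have "((\<lambda>t. indicator {s..} t * deriv \<eta> t) has_integral (LINT t|tm T. indicator {s..} t * deriv \<eta> t)) {0..T}"
      by (intro lint_tm_eq integrable_indicator_mult di) auto
    moreover have "((\<lambda>t. indicator {s..} t * deriv \<eta> t) has_integral (\<eta> T - \<eta> s)) {0..T}"
    proof -
      have "(deriv \<eta> has_integral (\<eta> T - \<eta> s)) {s..T}"
        using s smooth1_deriv[OF \<eta>, of 0]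
        by (intro fundamental_theorem_of_calculus)
           (auto simp: has_real_derivative_iff_has_vector_derivative intro: has_vector_derivative_at_within)
      then have "((\<lambda>t. if t \<in> {s..T} then deriv \<eta> t else 0) has_integral (\<eta> T - \<eta> s)) {0..T}"
        using s by (subst has_integral_restrict) auto
      then show ?thesis
        by (rule has_integral_eq[rotated]) (auto simp: indicator_def)
    qed
    ultimately show ?thesis using supp[of T] ab by (auto dest: has_integral_unique)
  qed
  have "(LINT t|tm T. deriv \<eta> t * primitive t) = (LINT s|tm T. F s * (LINT t|tm T. indicator {s..} t * deriv \<eta> t))"
    unfolding primitive_def by (rule lint_triangle(1)[OF di F])
  also have "\<dots> = (LINT s|tm T. F s * - \<eta> s)"
    by (intro Bochner_Integration.integral_cong refl) (simp add: inner space_restrict_space)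
  finally show "(LINT t|tm T. deriv \<eta> t * primitive t) = - (LINT s|tm T. \<eta> s * F s)"
    by (simp add: mult.commute)
  show "integrable (tm T) (\<lambda>t. deriv \<eta> t * primitive t)"
    unfolding primitive_def by (rule lint_triangle(2)[OF di F])
qed

lemma integrable_primitive: "integrable (tm T) primitive"
  by (rule continuous_integrable_tm[OF primitive_continuous])

text \<open>
  Du Bois-Reymond: \<open>g - primitive\<close> is orthogonal to the derivatives of test functions, that is, to all
  test functions of mean zero; these are enough to identify a function up to a constant.
\<close>

lemma solution_minus_primitive_constant: "\<exists>c. AE t in tm T. g t - primitive t = c"
proof -
  define H where "H t = g t - primitive t" for t
  have H: "integrable (tm T) H"
    unfolding H_def[abs_def] by (intro Bochner_Integration.integrable_diff g integrable_primitive)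
  have orth: "(LINT t|tm T. deriv \<eta> t * H t) = 0"
    if \<eta>: "smooth1 \<eta>" and ab: "0 < a" "b < T" and supp: "\<And>t. t \<notin> {a..b} \<Longrightarrow> \<eta> t = 0" for \<eta> a b
  proof -
    have c: "continuous_on UNIV \<eta>" "continuous_on UNIV (deriv \<eta>)"
      using smooth1_continuous[OF \<eta>, of UNIV 0] smooth1_continuous[OF \<eta>, of UNIV 1] by simp_all
    have "(LINT t|tm T. deriv \<eta> t * g t) + (LINT t|tm T. \<eta> t * F t) = 0"
      using eq[OF \<eta> ab supp] integrable_continuous_mult[OF c(2) g] integrable_continuous_mult[OF c(1) F] by simp
    then show ?thesis
      using primitive_weak_derivative[OF \<eta> ab supp] integrable_continuous_mult[OF c(2) g]
      by (simp add: H_def right_diff_distrib)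
  qed
  note cont = bump_continuous
  have bi: "integrable (tm T) (bump p q k)" for p q k by (rule continuous_integrable_tm[OF cont])
  \<comment> \<open>A fixed test function of mass \<open>m > 0\<close>, multiples of which are subtracted to obtain mean zero.\<close>
  define z where "z = bump (T/3) (2*T/3) 1"
  define m where "m = (LINT t|tm T. z t)"
  have zc: "continuous_on UNIV z" unfolding z_def by (rule cont)
  have "m > 0"
  proof -
    have "m \<ge> 0" unfolding m_def z_def by (intro integral_nonneg_AE AE_I2 bump_range)
    moreover have "m \<noteq> 0"
    proof
      assume "m = 0"
      then have "(z has_integral 0) (cbox 0 T)"
        using lint_tm_eq[OF bi, of "T/3" "2*T/3" 1] by (simp add: m_def z_def)
      then have "z (T/2) = 0"
        using T by (intro has_integral_0_cbox_imp_0[of 0 T z] continuous_on_subset[OF zc])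
          (auto simp: z_def bump_range)
      then show False using T by (simp add: z_def bump_def flat_def)
    qed
    ultimately show ?thesis by simp
  qed
  define c where "c = (LINT t|tm T. z t * H t) / m"
  have test: "(LINT t|tm T. bump p q k t * (H t - c)) = 0" if pq: "0 < p" "q < T" and k: "k > 0" for p q k
  proof -
    define w where "w = (LINT t|tm T. bump p q k t) / m"
    define \<xi> where "\<xi> t = bump p q k t - w * z t" for t
    have \<xi>e: "elementary \<xi>"
      unfolding \<xi>_def[abs_def] z_def by (intro elementary_diff elementary_cmult elementary_bump)
    have \<xi>c: "continuous_on UNIV \<xi>"
      using smooth1_continuous[OF elementary_smooth1[OF \<xi>e], of UNIV 0] by simp
    have supp: "\<xi> t = 0" if "t \<notin> {min p (T/3)..max q (2*T/3)}" for t
    proof -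
      have "t \<notin> {p<..<q}" "t \<notin> {T/3<..<2*T/3}" using that by auto
      then show ?thesis
        unfolding \<xi>_def z_def using k by (simp add: bump_support del: greaterThanLessThan_iff)
    qed
    have "(LINT t|tm T. \<xi> t) = 0"
      using \<open>m > 0\<close> bi unfolding \<xi>_def z_def m_def w_def by simp
    then have "(\<xi> has_integral 0) {0..T}"
      using lint_tm_eq[OF continuous_integrable_tm[OF \<xi>c, of T]] by simp
    then obtain \<eta> where \<eta>: "\<And>t. (\<eta> has_real_derivative \<xi> t) (at t)"
      and s: "\<And>t. t \<notin> {min p (T/3)..max q (2*T/3)} \<Longrightarrow> \<eta> t = 0"
      using antiderivative_with_support[OF \<xi>c, of "min p (T/3)" "max q (2*T/3)" T] supp pq T by auto
    have "smooth1 \<eta>" "deriv \<eta> = \<xi>"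
      using smooth1_antiderivative[OF elementary_smooth1[OF \<xi>e] \<eta>] by auto
    then have "(LINT t|tm T. \<xi> t * H t) = 0"
      using orth[OF \<open>smooth1 \<eta>\<close>, of "min p (T/3)" "max q (2*T/3)"] s pq T by auto
    then have "(LINT t|tm T. bump p q k t * H t) = w * (LINT t|tm T. z t * H t)"
      using integrable_continuous_mult[OF cont H] integrable_continuous_mult[OF zc H]
      by (simp add: \<xi>_def left_diff_distrib mult.assoc)
    also have "\<dots> = (LINT t|tm T. bump p q k t) * c" by (simp add: w_def c_def)
    finally show ?thesis
      using integrable_continuous_mult[OF cont H] bi by (simp add: right_diff_distrib)
  qed
  have "AE t in tm T. H t - c = 0"
    by (rule AE_zero_of_bump_integrals) (use H test in auto)
  then show ?thesis unfolding H_def by (intro exI[of _ c]) simp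
qed

lemma solution_eq_primitive: "AE t in tm T. g t = primitive t"
proof -
  obtain c where c: "AE t in tm T. g t - primitive t = c"
    using solution_minus_primitive_constant by blast
  have "\<bar>c\<bar> \<le> 2 * \<epsilon>" if "\<epsilon> > 0" for \<epsilon>
  proof (rule ccontr)
    assume big: "\<not> \<bar>c\<bar> \<le> 2 * \<epsilon>"
    obtain \<delta> where \<delta>: "\<delta> > 0" "AE t in tm T. t < \<delta> \<longrightarrow> \<bar>g t\<bar> < \<epsilon>" using init[OF \<open>\<epsilon> > 0\<close>] by blast
    have "isCont primitive 0" using primitive_continuous by (simp add: continuous_on_eq_continuous_at)
    then obtain r where r: "r > 0" "\<And>t. \<bar>t\<bar> < r \<Longrightarrow> \<bar>primitive t\<bar> < \<epsilon>"
      using \<open>\<epsilon> > 0\<close> primitive_le_0[of 0] unfolding continuous_at_eps_delta by (auto simp: dist_real_def)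
    define m where "m = min T (min \<delta> r)"
    have m: "m > 0" using T \<delta> r by (simp add: m_def)
    have "AE t in tm T. \<not> t < m"
      using c \<delta>(2) AE_space
    proof eventually_elim
      case (elim t)
      show ?case
      proof
        assume "t < m"
        then have "\<bar>g t\<bar> < \<epsilon>" "\<bar>primitive t\<bar> < \<epsilon>"
          using elim r(2)[of t] by (auto simp: m_def space_restrict_space)
        then show False using elim(1) big by linarith
      qed
    qed
    then have "AE t in lebesgue. t \<in> {0<..<T} \<longrightarrow> \<not> t < m"
      by (subst (asm) AE_restrict_space_iff) auto
    then have "AE t in lebesgue. t \<notin> {0<..<m}"
      by eventually_elim (auto simp: m_def)
    then have "negligible {0<..<m}"
      by (simp add: negligible_iff_null_sets AE_iff_null_sets)
    then show False using open_not_negligible[of "{0<..<m}"] m by auto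
  qed
  then have "c = 0"
    by (metis abs_le_zero_iff field_le_epsilon field_sum_of_halves half_gt_zero add_0 mult_2)
  with c show ?thesis by simp
qed

text \<open>
  A convex function of a primitive: on a fine partition the increments are controlled by the tangents
  at the right end points, which yields one half of the chain rule.
\<close>

lemma convex_primitive_le:
  assumes b: "\<And>s. (b has_real_derivative b' s) (at s)" and mono: "\<And>r s. r \<le> s \<Longrightarrow> b' r \<le> b' s"
    and b'c: "continuous_on UNIV b'" and b0: "b 0 = 0" and t: "0 \<le> t" "t \<le> T"
  shows "b (primitive t) \<le> (LINT s|tm T. indicator {..t} s * (b' (primitive s) * F s))"
proof (rule field_le_epsilon)
  fix e :: real assume e: "e > 0"
  let ?G = "primitive"
  define A where "A = (LINT s|tm T. \<bar>F s\<bar>)"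
  have A: "A \<ge> 0" unfolding A_def by (intro integral_nonneg_AE AE_I2) auto
  define \<epsilon> where "\<epsilon> = e / (A + 1)"
  have \<epsilon>: "\<epsilon> > 0" "\<epsilon> * A \<le> e" using e A by (simp_all add: \<epsilon>_def field_simps)
  have bGc: "continuous_on UNIV (\<lambda>s. b' (?G s))"
    by (rule continuous_on_compose2[OF b'c primitive_continuous]) auto
  have "uniformly_continuous_on {0..T} (\<lambda>s. b' (?G s))"
    by (intro compact_uniformly_continuous continuous_on_subset[OF bGc]) auto
  then obtain \<delta> where \<delta>: "\<delta> > 0" "\<And>r s. r \<in> {0..T} \<Longrightarrow> s \<in> {0..T} \<Longrightarrow> \<bar>s - r\<bar> < \<delta> \<Longrightarrow> \<bar>b' (?G s) - b' (?G r)\<bar> < \<epsilon>"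
    using \<epsilon>(1) unfolding uniformly_continuous_on_def dist_real_def by blast
  obtain N where "T / \<delta> < real N" using reals_Archimedean2 by blast
  then have N: "T < real N * \<delta>" using \<delta>(1) by (simp add: field_simps)
  then have "N > 0" using T \<delta>(1) by (cases N) auto
  have iF: "integrable (tm T) (\<lambda>s. b' (?G s) * F s)" by (rule integrable_continuous_mult[OF bGc F])
  have iA: "integrable (tm T) (\<lambda>s. \<bar>F s\<bar>)" using F by auto
  \<comment> \<open>The partition points; the mesh \<open>t / N\<close> is below the modulus of continuity \<open>\<delta>\<close> for \<open>\<epsilon>\<close>.\<close>
  define p where "p i = real i * t / real N" for i :: nat
  have p: "0 \<le> p i" "p i \<le> p (Suc i)" "p (Suc i) - p i < \<delta>" for i
    using t N \<open>N > 0\<close> by (simp_all add: p_def field_simps)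
  have pT: "p i \<le> T" if "i \<le> N" for i
  proof -
    have "real i * t \<le> real N * T" using that t by (intro mult_mono) auto
    then show ?thesis using \<open>N > 0\<close> by (simp add: p_def field_simps)
  qed
  have "b (?G (p i)) \<le> (LINT s|tm T. indicator {..p i} s * (b' (?G s) * F s)) + \<epsilon> * (LINT s|tm T. indicator {..p i} s * \<bar>F s\<bar>)"
    if "i \<le> N" for i
    using that
  proof (induction i)
    case 0
    have "(LINT s|tm T. indicator {..0} s * f s) = 0" for f :: "real \<Rightarrow> real"
      by (subst Bochner_Integration.integral_cong[where g="\<lambda>_. 0"]) (auto simp: space_restrict_space)
    then show ?case by (simp add: p_def primitive_le_0 b0)
  next
    case (Suc i)
    let ?I = "{p i<..p (Suc i)}"
    have split: "(LINT s|tm T. indicator {..p (Suc i)} s * f s) = (LINT s|tm T. indicator {..p i} s * f s) + (LINT s|tm T. indicator ?I s * f s)"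
      if "integrable (tm T) f" for f :: "real \<Rightarrow> real"
    proof -
      have "indicator {..p (Suc i)} s * f s = indicator {..p i} s * f s + indicator ?I s * f s" for s
        using p(2)[of i] by (auto simp: indicator_def)
      then show ?thesis
        using integrable_indicator_mult[OF that] by simp
    qed
    have "b (?G (p (Suc i))) - b (?G (p i)) \<le> b' (?G (p (Suc i))) * (?G (p (Suc i)) - ?G (p i))"
      by (rule convex_tangent[OF b mono])
    also have "\<dots> = b' (?G (p (Suc i))) * (LINT s|tm T. indicator ?I s * F s)"
      using split[OF F] by (simp add: primitive_def)
    also have "\<dots> = (LINT s|tm T. b' (?G (p (Suc i))) * (indicator ?I s * F s))" by simp
    also have "\<dots> \<le> (LINT s|tm T. indicator ?I s * (b' (?G s) * F s) + \<epsilon> * (indicator ?I s * \<bar>F s\<bar>))"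
    proof (rule integral_mono)
      show "integrable (tm T) (\<lambda>s. b' (?G (p (Suc i))) * (indicator ?I s * F s))"
        by (intro integrable_mult_right integrable_indicator_mult F) auto
      show "integrable (tm T) (\<lambda>s. indicator ?I s * (b' (?G s) * F s) + \<epsilon> * (indicator ?I s * \<bar>F s\<bar>))"
        by (intro Bochner_Integration.integrable_add integrable_mult_right integrable_indicator_mult iF iA) auto
      fix s
      show "b' (?G (p (Suc i))) * (indicator ?I s * F s) \<le> indicator ?I s * (b' (?G s) * F s) + \<epsilon> * (indicator ?I s * \<bar>F s\<bar>)"
      proof (cases "s \<in> ?I")
        case True
        then have "\<bar>b' (?G (p (Suc i))) - b' (?G s)\<bar> < \<epsilon>"
          using p[of i] p(1)[of "Suc i"] pT[OF Suc.prems] by (intro \<delta>(2)) auto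
        then have "\<bar>(b' (?G (p (Suc i))) - b' (?G s)) * F s\<bar> \<le> \<epsilon> * \<bar>F s\<bar>"
          unfolding abs_mult by (intro mult_right_mono) auto
        then have "(b' (?G (p (Suc i))) - b' (?G s)) * F s \<le> \<epsilon> * \<bar>F s\<bar>" by linarith
        then show ?thesis using True by (simp add: algebra_simps)
      qed simp
    qed
    also have "\<dots> = (LINT s|tm T. indicator ?I s * (b' (?G s) * F s)) + \<epsilon> * (LINT s|tm T. indicator ?I s * \<bar>F s\<bar>)"
      using integrable_indicator_mult[OF iF, of ?I] integrable_indicator_mult[OF iA, of ?I] by simp
    finally show ?case
      using Suc split[OF iF] split[OF iA] by (simp add: algebra_simps)
  qed
  from this[of N] have "b (?G t) \<le> (LINT s|tm T. indicator {..t} s * (b' (?G s) * F s)) + \<epsilon> * (LINT s|tm T. indicator {..t} s * \<bar>F s\<bar>)"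
    using \<open>N > 0\<close> by (simp add: p_def)
  also have "(LINT s|tm T. indicator {..t} s * \<bar>F s\<bar>) \<le> A"
    unfolding A_def by (intro integral_mono integrable_indicator_mult iA) (auto simp: indicator_def)
  finally show "b (?G t) \<le> (LINT s|tm T. indicator {..t} s * (b' (?G s) * F s)) + e"
    using \<epsilon> by (smt (verit) mult_left_mono)
qed

text \<open>
  Integrating the previous estimate over all final times \<open>t\<close> gives each \<open>s\<close> the weight \<open>T - s\<close>. In this
  form the inequality does not refer to a particular representative of \<open>g\<close>, which allows integrating
  it in space as well.
\<close>

lemma renormalized_estimate:
  assumes b: "\<And>s. (b has_real_derivative b' s) (at s)" and mono: "\<And>r s. r \<le> s \<Longrightarrow> b' r \<le> b' s"
    and b'c: "continuous_on UNIV b'" and b0: "b 0 = 0"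
  shows "(LINT t|tm T. b (g t)) \<le> (LINT s|tm T. (T - s) * (b' (g s) * F s))"
proof -
  have bc: "continuous_on UNIV b" by (meson DERIV_isCont continuous_at_imp_continuous_on b)
  note [measurable] = borel_measurable_continuous_onI[OF bc] borel_measurable_continuous_onI[OF b'c]
    borel_measurable_integrable[OF integrable_primitive]
  have bGc: "continuous_on UNIV (\<lambda>s. b' (primitive s))" "continuous_on UNIV (\<lambda>s. b (primitive s))"
    by (rule continuous_on_compose2[OF _ primitive_continuous], rule b'c bc, simp)+
  have iF: "integrable (tm T) (\<lambda>s. b' (primitive s) * F s)" by (rule integrable_continuous_mult[OF bGc(1) F])
  have "(LINT t|tm T. b (g t)) = (LINT t|tm T. b (primitive t))"
    using solution_eq_primitive by (intro integral_cong_AE) auto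
  also have "\<dots> \<le> (LINT t|tm T. 1 * (LINT s|tm T. indicator {..t} s * (b' (primitive s) * F s)))"
  proof (rule integral_mono_AE)
    show "integrable (tm T) (\<lambda>t. b (primitive t))" by (rule continuous_integrable_tm[OF bGc(2)])
    show "integrable (tm T) (\<lambda>t. 1 * (LINT s|tm T. indicator {..t} s * (b' (primitive s) * F s)))"
      by (rule lint_triangle(2)[OF _ iF]) simp
    show "AE t in tm T. b (primitive t) \<le> 1 * (LINT s|tm T. indicator {..t} s * (b' (primitive s) * F s))"
      using convex_primitive_le[OF b mono b'c b0] by (intro AE_I2) (auto simp: space_restrict_space)
  qed
  also have "\<dots> = (LINT s|tm T. (b' (primitive s) * F s) * (LINT t|tm T. indicator {s..} t * 1))"
    by (rule lint_triangle(1)[OF _ iF]) simp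
  also have "\<dots> = (LINT s|tm T. (T - s) * (b' (primitive s) * F s))"
  proof (intro Bochner_Integration.integral_cong refl)
    fix s assume s: "s \<in> space (tm T)"
    have "integrable (tm T) (\<lambda>t. indicator {s..} t * 1 :: real)"
      by (intro integrable_indicator_mult) auto
    then have "((\<lambda>t. indicator {s..} t * 1) has_integral (LINT t|tm T. indicator {s..} t * 1 :: real)) {0..T}"
      by (rule lint_tm_eq)
    moreover have "((\<lambda>t. indicator {s..} t * 1 :: real) has_integral (T - s)) {0..T}"
    proof -
      have "((\<lambda>t. 1::real) has_integral (T - s)) {s..T}"
        using has_integral_const_real[of "1::real" s T] s by (simp add: space_restrict_space)
      then have "((\<lambda>t. if t \<in> {s..T} then 1 else 0 :: real) has_integral (T - s)) {0..T}"
        using s by (subst has_integral_restrict) (auto simp: space_restrict_space)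
      then show ?thesis by (rule has_integral_eq[rotated]) (auto simp: indicator_def)
    qed
    ultimately have "(LINT t|tm T. indicator {s..} t * 1 :: real) = T - s" by (rule has_integral_unique)
    then show "b' (primitive s) * F s * (LINT t|tm T. indicator {s..} t * 1) = (T - s) * (b' (primitive s) * F s)"
      by simp
  qed
  also have "\<dots> = (LINT s|tm T. (T - s) * (b' (g s) * F s))"
    using solution_eq_primitive by (intro integral_cong_AE) auto
  finally show ?thesis .
qed

end

section \<open>Uniqueness for the advection-diffusion equation\<close>

abbreviation strip :: "real \<Rightarrow> (real \<times> (real^3)) measure" where
  "strip T \<equiv> tm T \<Otimes>\<^sub>M torus"

text \<open>
  The function \<open>b\<close> of the renormalization. Its derivative has to be bounded, since the commutator
  converges in \<open>L\<^sup>1\<close> only.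
\<close>

definition cvx :: "real \<Rightarrow> real" where "cvx s = sqrt (1 + s\<^sup>2) - 1"
definition cvx' :: "real \<Rightarrow> real" where "cvx' s = s / sqrt (1 + s\<^sup>2)"
definition cvx'' :: "real \<Rightarrow> real" where "cvx'' s = 1 / (1 + s\<^sup>2) / sqrt (1 + s\<^sup>2)"

lemma one_plus_sq_pos: "0 < 1 + (s::real)\<^sup>2"
  by (rule add_pos_nonneg) auto

lemma sqrt_one_plus_sq_deriv: "((\<lambda>s. sqrt (1 + s\<^sup>2)) has_real_derivative s / sqrt (1 + s\<^sup>2)) (at s)"
proof -
  have "((\<lambda>s. 1 + s\<^sup>2) has_real_derivative 2 * s) (at s)"
    by (auto intro!: derivative_eq_intros)
  from DERIV_chain2[OF DERIV_real_sqrt[OF one_plus_sq_pos] this]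
  show ?thesis by (rule DERIV_cong) (simp only: divide_inverse, simp)
qed

lemma cvx_deriv: "(cvx has_real_derivative cvx' s) (at s)"
  unfolding cvx_def[abs_def] cvx'_def
  using DERIV_diff[OF sqrt_one_plus_sq_deriv DERIV_const] by simp

lemma cvx'_deriv: "(cvx' has_real_derivative cvx'' s) (at s)"
proof -
  let ?r = "sqrt (1 + s\<^sup>2)"
  have r: "?r \<noteq> 0" using one_plus_sq_pos[of s] by simp
  have "(1 * r - s * (s / r)) / (r * r) = 1 / (1 + s\<^sup>2) / r"
    if "r \<noteq> 0" "r * r = 1 + s\<^sup>2" for r
  proof -
    have "1 * r - s * (s / r) = (r * r - s\<^sup>2) / r"
      using that(1) by (simp add: diff_divide_distrib power2_eq_square)
    then show ?thesis unfolding that(2) by simp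
  qed
  from this[OF r] have "(1 * ?r - s * (s / ?r)) / (?r * ?r) = cvx'' s"
    unfolding cvx''_def using one_plus_sq_pos[of s] by (simp only: real_sqrt_mult_self abs_of_pos)
  from DERIV_cong[OF DERIV_divide[OF DERIV_ident sqrt_one_plus_sq_deriv r] this]
  show ?thesis unfolding cvx'_def[abs_def] .
qed

lemma cvx''_nonneg: "0 \<le> cvx'' s"
  unfolding cvx''_def using one_plus_sq_pos[of s] by simp

lemma cvx''_continuous: "continuous_on UNIV cvx''"
proof -
  have "1 + s\<^sup>2 \<noteq> 0" for s :: real using one_plus_sq_pos[of s] by linarith
  then show ?thesis unfolding cvx''_def by (intro continuous_intros) auto
qed

lemma cvx'_continuous: "continuous_on UNIV cvx'"
  by (meson DERIV_isCont continuous_at_imp_continuous_on cvx'_deriv)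

lemma cvx_continuous: "continuous_on UNIV cvx"
  by (meson DERIV_isCont continuous_at_imp_continuous_on cvx_deriv)

lemma cvx'_mono: "r \<le> s \<Longrightarrow> cvx' r \<le> cvx' s"
  by (rule DERIV_nonneg_imp_nondecreasing) (use cvx'_deriv cvx''_nonneg in blast)+

lemma cvx'_bound: "\<bar>cvx' s\<bar> \<le> 1"
proof -
  have "\<bar>s\<bar> \<le> sqrt (1 + s\<^sup>2)" by (rule real_le_rsqrt) simp
  then show ?thesis
    using one_plus_sq_pos[of s] by (simp add: cvx'_def abs_divide)
qed

lemma cvx_lipschitz: "\<bar>cvx r - cvx s\<bar> \<le> \<bar>r - s\<bar>"
  using field_differentiable_bound[of UNIV cvx cvx' 1 r s] cvx_deriv cvx'_bound by simp

lemma cvx_0 [simp]: "cvx 0 = 0"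
  by (simp add: cvx_def)

lemma cvx_nonneg: "0 \<le> cvx s"
  by (simp add: cvx_def)

lemma cvx_eq_0: "cvx s = 0 \<Longrightarrow> s = 0"
  by (simp add: cvx_def)

lemma conv_measurable:
  assumes f: "(\<lambda>z. f (fst z) (snd z)) \<in> borel_measurable (strip T)"
    and q: "q \<in> N \<rightarrow>\<^sub>M tm T" and p: "p \<in> borel_measurable N"
  shows "(\<lambda>w. conv n m (f (q w)) (p w)) \<in> borel_measurable N"
proof -
  note [measurable] = f q p
  have [measurable]: "(\<lambda>v. (q (fst v), snd v)) \<in> N \<Otimes>\<^sub>M torus \<rightarrow>\<^sub>M strip T" by measurable
  have 1: "(\<lambda>v. f (q (fst v)) (snd v)) \<in> borel_measurable (N \<Otimes>\<^sub>M torus)"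
    using measurable_compose[OF \<open>(\<lambda>v. (q (fst v), snd v)) \<in> N \<Otimes>\<^sub>M torus \<rightarrow>\<^sub>M strip T\<close> f] by simp
  have 2: "(\<lambda>v. snd v) \<in> borel_measurable (N \<Otimes>\<^sub>M torus)"
    by (rule measurable_compose[OF measurable_snd measurable_ident_torus])
  have 3: "(\<lambda>v. p (fst v)) \<in> borel_measurable (N \<Otimes>\<^sub>M torus)"
    by (rule measurable_compose[OF measurable_fst p])
  have "(\<lambda>v. Ker n m (snd v - p (fst v)) * f (q (fst v)) (snd v)) \<in> borel_measurable (N \<Otimes>\<^sub>M torus)"
    by (intro borel_measurable_times 1 measurable_compose[OF borel_measurable_diff[OF 2 3] Ker_measurable])
  then have "(\<lambda>(w, y). Ker n m (y - p w) * f (q w) y) \<in> borel_measurable (N \<Otimes>\<^sub>M torus)"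
    by (simp add: case_prod_unfold)
  then show ?thesis
    unfolding conv_def by (rule torus.borel_measurable_lebesgue_integral)
qed

locale time_strip =
  fixes T :: real
  assumes T: "T > 0"
begin

sublocale tm: finite_measure "tm T" by (rule finite_measure_tm)

sublocale strip: pair_sigma_finite "tm T" torus ..

lemma lint_tm_const: "(LINT t|tm T. c) = T * (c::real)"
  using T by (simp add: measure_restrict_space)

lemma integrable_conv_strip:
  assumes f: "integrable (strip T) (\<lambda>z. f (fst z) (snd z))"
    and c: "c \<in> borel_measurable (strip T)" "\<And>z. z \<in> space (strip T) \<Longrightarrow> \<bar>c z\<bar> \<le> C"
  shows "integrable (strip T) (\<lambda>z. c z * conv n m (f (fst z)) (snd z))"
proof -
  note [measurable] = borel_measurable_integrable[OF f] c(1)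
  have [measurable]: "(\<lambda>z. conv n m (f (fst z)) (snd z)) \<in> borel_measurable (strip T)"
    by (rule conv_measurable[OF borel_measurable_integrable[OF f]])
       (auto intro: measurable_compose[OF measurable_snd measurable_ident_torus])
  obtain K where K: "\<And>z. \<bar>Ker n m z\<bar> \<le> K" using Ker_bounded by blast
  have K0: "0 \<le> K" using K[of 0] by linarith
  have bd: "\<bar>c (t, x) * conv n m (f t) x\<bar> \<le> \<bar>C\<bar> * (K * (LINT y|torus. \<bar>f t y\<bar>))"
    if "integrable torus (f t)" "t \<in> space (tm T)" "x \<in> space torus" for t x
    unfolding abs_mult
    by (rule mult_mono[OF order_trans[OF c(2) abs_ge_self] conv_bound[OF K that(1)]])
       (use that in \<open>auto simp: space_pair_measure\<close>)
  have ae: "AE t in tm T. integrable torus (f t)"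
    using strip.AE_integrable_fst'[OF f] by simp
  have sec: "integrable torus (\<lambda>x. c (t, x) * conv n m (f t) x)"
    if t: "integrable torus (f t)" "t \<in> space (tm T)" for t
  proof (rule torus.integrable_const_bound)
    show "AE x in torus. norm (c (t, x) * conv n m (f t) x) \<le> \<bar>C\<bar> * (K * (LINT y|torus. \<bar>f t y\<bar>))"
      using bd[OF t] by (intro AE_I2) simp
    have "(\<lambda>z. c z * conv n m (f (fst z)) (snd z)) \<in> borel_measurable (strip T)" by measurable
    from measurable_compose[OF measurable_Pair1'[OF t(2)] this]
    show "(\<lambda>x. c (t, x) * conv n m (f t) x) \<in> borel_measurable torus" by simp
  qed
  show ?thesis
  proof (rule strip.Fubini_integrable)
    show "(\<lambda>z. c z * conv n m (f (fst z)) (snd z)) \<in> borel_measurable (strip T)" by measurable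
    show "AE t in tm T. integrable torus (\<lambda>y. c (t, y) * conv n m (f (fst (t, y))) (snd (t, y)))"
      using ae AE_space by eventually_elim (simp add: sec)
    show "integrable (tm T) (\<lambda>t. LINT y|torus. norm (c (t, y) * conv n m (f (fst (t, y))) (snd (t, y))))"
    proof (rule Bochner_Integration.integrable_bound)
      have "integrable (tm T) (\<lambda>t. LINT y|torus. \<bar>f t y\<bar>)"
        using strip.integrable_fst'[OF integrable_abs[OF f]] by simp
      then show "integrable (tm T) (\<lambda>t. \<bar>C\<bar> * (K * (LINT y|torus. \<bar>f t y\<bar>)))" by simp
      have "(\<lambda>z. norm (c z * conv n m (f (fst z)) (snd z))) \<in> borel_measurable (strip T)" by measurable
      then show "(\<lambda>t. LINT y|torus. norm (c (t, y) * conv n m (f (fst (t, y))) (snd (t, y)))) \<in> borel_measurable (tm T)"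
        by (intro torus.borel_measurable_lebesgue_integral) (simp add: case_prod_unfold)
      show "AE t in tm T. norm (LINT y|torus. norm (c (t, y) * conv n m (f (fst (t, y))) (snd (t, y))))
          \<le> norm (\<bar>C\<bar> * (K * (LINT y|torus. \<bar>f t y\<bar>)))"
        using ae AE_space
      proof eventually_elim
        case (elim t)
        have "(LINT y|torus. \<bar>c (t, y) * conv n m (f t) y\<bar>) \<le> (LINT y|torus. \<bar>C\<bar> * (K * (LINT y|torus. \<bar>f t y\<bar>)))"
          using elim by (intro integral_mono integrable_abs sec bd) auto
        moreover have "0 \<le> (LINT y|torus. \<bar>c (t, y) * conv n m (f t) y\<bar>)"
          by (intro integral_nonneg_AE AE_I2) simp
        ultimately show ?case by simp
      qed
    qed
  qed
qed

lemma integrable_conv_time: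
  assumes f: "integrable (strip T) (\<lambda>z. f (fst z) (snd z))"
  shows "integrable (tm T) (\<lambda>t. conv n m (f t) x)"
proof -
  obtain K where K: "\<And>z. \<bar>Ker n m z\<bar> \<le> K" using Ker_bounded by blast
  show ?thesis
  proof (rule Bochner_Integration.integrable_bound)
    show "integrable (tm T) (\<lambda>t. K * (LINT y|torus. \<bar>f t y\<bar>))"
      using strip.integrable_fst'[OF integrable_abs[OF f]] by simp
    show "(\<lambda>t. conv n m (f t) x) \<in> borel_measurable (tm T)"
      by (rule conv_measurable[OF borel_measurable_integrable[OF f]]) auto
    have "AE t in tm T. integrable torus (f t)"
      using strip.AE_integrable_fst'[OF f] by simp
    then show "AE t in tm T. norm (conv n m (f t) x) \<le> norm (K * (LINT y|torus. \<bar>f t y\<bar>))"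
    proof eventually_elim
      case (elim t)
      from conv_bound[OF K elim] show ?case by (metis abs_ge_self order_trans real_norm_def)
    qed
  qed
qed

definition sqint2 :: "(real \<Rightarrow> real^3 \<Rightarrow> real) \<Rightarrow> bool" where
  "sqint2 f \<longleftrightarrow> (\<lambda>z. f (fst z) (snd z)) \<in> borel_measurable (strip T) \<and>
     integrable (strip T) (\<lambda>z. (f (fst z) (snd z))\<^sup>2)"

lemma sqint2_mult:
  assumes "sqint2 f" "sqint2 g" shows "integrable (strip T) (\<lambda>z. f (fst z) (snd z) * g (fst z) (snd z))"
proof (rule Bochner_Integration.integrable_bound)
  note [measurable] = assms[unfolded sqint2_def, THEN conjunct1]
  show "integrable (strip T) (\<lambda>z. (f (fst z) (snd z))\<^sup>2 + (g (fst z) (snd z))\<^sup>2)"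
    using assms by (simp add: sqint2_def)
  show "(\<lambda>z. f (fst z) (snd z) * g (fst z) (snd z)) \<in> borel_measurable (strip T)" by measurable
  show "AE z in strip T. norm (f (fst z) (snd z) * g (fst z) (snd z)) \<le> norm ((f (fst z) (snd z))\<^sup>2 + (g (fst z) (snd z))\<^sup>2)"
    using abs_mult_le_squares by (intro AE_I2) auto
qed

lemma integrable_const_strip: "integrable (strip T) (\<lambda>_. c::real)"
  using strip.integrable_mult_pair[of "\<lambda>_. c" "\<lambda>_. 1"] by simp

lemma sqint2_integrable:
  assumes "sqint2 f" shows "integrable (strip T) (\<lambda>z. f (fst z) (snd z))"
proof -
  have "sqint2 (\<lambda>_ _. 1)" by (simp add: sqint2_def integrable_const_strip)
  from sqint2_mult[OF assms this] show ?thesis by simp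
qed

lemma sqint2_section:
  assumes "sqint2 f" shows "AE t in tm T. sqint (f t)"
proof -
  have m: "(\<lambda>z. f (fst z) (snd z)) \<in> borel_measurable (strip T)"
    and i: "integrable (strip T) (\<lambda>z. (f (fst z) (snd z))\<^sup>2)" using assms by (auto simp: sqint2_def)
  have "AE t in tm T. integrable torus (\<lambda>x. (f t x)\<^sup>2)"
    using strip.AE_integrable_fst'[OF i] by simp
  then show ?thesis
    using AE_space
  proof eventually_elim
    case (elim t)
    from measurable_compose[OF measurable_Pair1'[OF elim(2)] m] elim(1)
    show ?case by (simp add: sqint_def)
  qed
qed

lemma integrable_sq_norm: "sqint2 f \<Longrightarrow> integrable (tm T) (\<lambda>t. LINT x|torus. (f t x)\<^sup>2)"
  using strip.integrable_fst'[of "\<lambda>z. (f (fst z) (snd z))\<^sup>2"] by (simp add: sqint2_def)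

lemma omega_measurable:
  assumes f: "sqint2 f" shows "(\<lambda>t. omega n (f t)) \<in> borel_measurable (tm T)"
proof -
  have m: "(\<lambda>z. f (fst z) (snd z)) \<in> borel_measurable (strip T)" using f by (simp add: sqint2_def)
  have "(\<lambda>v. (fst v, fst (snd v))) \<in> tm T \<Otimes>\<^sub>M torus2 \<rightarrow>\<^sub>M strip T" by measurable
  from measurable_compose[OF this m]
  have 1: "(\<lambda>v. f (fst v) (fst (snd v))) \<in> borel_measurable (tm T \<Otimes>\<^sub>M torus2)" by simp
  have "(\<lambda>v. (fst v, snd (snd v))) \<in> tm T \<Otimes>\<^sub>M torus2 \<rightarrow>\<^sub>M strip T" by measurable
  from measurable_compose[OF this m]
  have 2: "(\<lambda>v. f (fst v) (snd (snd v))) \<in> borel_measurable (tm T \<Otimes>\<^sub>M torus2)" by simp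
  have 3: "(\<lambda>v. Ker n O3 (snd (snd v) - fst (snd v))) \<in> borel_measurable (tm T \<Otimes>\<^sub>M torus2)"
    by (rule measurable_compose[OF measurable_snd Ker_measurable_torus2])
  have sf: "sigma_finite_measure torus2"
    by (rule sigma_finite_pair_measure) unfold_locales
  have "(\<lambda>v. Ker n O3 (snd (snd v) - fst (snd v)) * (f (fst v) (fst (snd v)) - f (fst v) (snd (snd v)))\<^sup>2)
      \<in> borel_measurable (tm T \<Otimes>\<^sub>M torus2)"
    using 1 2 3 by measurable
  then show ?thesis
    unfolding omega_def by (intro sigma_finite_measure.borel_measurable_lebesgue_integral[OF sf]) (simp add: case_prod_unfold)
qed

lemma omega_time:
  assumes f: "sqint2 f"
  shows "integrable (tm T) (\<lambda>t. omega n (f t))" and "(\<lambda>n. LINT t|tm T. omega n (f t)) \<longlonglongrightarrow> 0"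
proof -
  have w: "integrable (tm T) (\<lambda>t. 8 * (LINT x|torus. (f t x)\<^sup>2))"
    using integrable_sq_norm[OF f] by simp
  have bd: "AE t in tm T. norm (omega n (f t)) \<le> 8 * (LINT x|torus. (f t x)\<^sup>2)" for n
    using sqint2_section[OF f] by eventually_elim (use omega_bound omega_nonneg in auto)
  have m: "(\<lambda>t. omega n (f t)) \<in> borel_measurable (tm T)" for n by (rule omega_measurable[OF f])
  have lim: "AE t in tm T. (\<lambda>n. omega n (f t)) \<longlonglongrightarrow> 0"
    using sqint2_section[OF f] by eventually_elim (rule omega_tendsto)
  show "integrable (tm T) (\<lambda>t. omega n (f t))"
    by (rule Bochner_Integration.integrable_bound[OF w m]) (use bd[of n] in \<open>eventually_elim, auto\<close>)
  have "(\<lambda>n. LINT t|tm T. omega n (f t)) \<longlonglongrightarrow> (LINT t|tm T. 0)"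
    by (rule integral_dominated_convergence[OF _ m w lim bd]) simp
  then show "(\<lambda>n. LINT t|tm T. omega n (f t)) \<longlonglongrightarrow> 0" by simp
qed

end

text \<open>
  A weak solution \<open>d\<close> of \<open>\<partial>\<^sub>t d + div (d u) = \<nu> \<Delta>d\<close> with weak gradient \<open>G\<close>, velocity \<open>u\<close> of weak
  divergence zero and initial value zero, where all weak formulations are only required for test
  functions \<open>\<eta> t * Ker n m (y - x)\<close>.
\<close>

locale advection_diffusion = time_strip +
  fixes \<nu> :: real and d :: "real \<Rightarrow> real^3 \<Rightarrow> real" and u G :: "3 \<Rightarrow> real \<Rightarrow> real^3 \<Rightarrow> real"
  assumes \<nu>: "\<nu> \<ge> 0" and d: "sqint2 d" and u: "\<And>i. sqint2 (u i)" and G: "\<And>i. sqint2 (G i)"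
    and weak_grad: "AE t in tm T. \<forall>n i m x. conv n (inc i m) (d t) x = - conv n m (G i t) x"
    and weak_div: "\<And>\<eta> a b n x. smooth1 \<eta> \<Longrightarrow> 0 < a \<Longrightarrow> b < T \<Longrightarrow> (\<And>t. t \<notin> {a..b} \<Longrightarrow> \<eta> t = 0) \<Longrightarrow>
      (LINT t|tm T. \<eta> t * (\<Sum>i\<in>UNIV. conv n (inc i O3) (u i t) x)) = 0"
    and equation: "\<And>\<eta> a b n x. smooth1 \<eta> \<Longrightarrow> 0 < a \<Longrightarrow> b < T \<Longrightarrow> (\<And>t. t \<notin> {a..b} \<Longrightarrow> \<eta> t = 0) \<Longrightarrow>
      (LINT t|tm T. deriv \<eta> t * conv n O3 (d t) x + \<eta> t * advdiff \<nu> (d t) (\<lambda>i. u i t) n x) = 0"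
    and initial: "\<And>n x \<epsilon>. \<epsilon> > 0 \<Longrightarrow> \<exists>\<delta>>0. AE t in tm T. t < \<delta> \<longrightarrow> \<bar>conv n O3 (d t) x\<bar> < \<epsilon>"
begin

lemmas ud = sqint2_mult[OF d u]

text \<open>The exceptional null set of times can be chosen independently of \<open>x\<close>, by density and continuity.\<close>

lemma AE_weak_div: "AE t in tm T. \<forall>n x. (\<Sum>i\<in>UNIV. conv n (inc i O3) (u i t) x) = 0"
proof -
  have 1: "AE t in tm T. (\<Sum>i\<in>UNIV. conv n (inc i O3) (u i t) x) = 0" for n x
  proof (rule AE_zero_of_bump_integrals)
    show "integrable (tm T) (\<lambda>t. \<Sum>i\<in>UNIV. conv n (inc i O3) (u i t) x)"
      by (intro Bochner_Integration.integrable_sum integrable_conv_time sqint2_integrable u)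
    show "(LINT t|tm T. bump p q k t * (\<Sum>i\<in>UNIV. conv n (inc i O3) (u i t) x)) = 0"
      if "0 < p" "q < T" "k > 0" for p q k
      by (rule weak_div[OF elementary_smooth1[OF elementary_bump] that(1,2)])
         (auto intro!: bump_support that)
  qed
  obtain D :: "(real^3) set" where D: "countable D" "closure D = UNIV"
    using separable[of "UNIV :: (real^3) set"] by (metis UNIV_eq_I subset_UNIV top.extremum_uniqueI)
  have "AE t in tm T. \<forall>n. \<forall>x\<in>D. (\<Sum>i\<in>UNIV. conv n (inc i O3) (u i t) x) = 0"
    unfolding AE_all_countable AE_ball_countable[OF D(1)] using 1 by blast
  moreover have "AE t in tm T. \<forall>i. sqint (u i t)"
    unfolding AE_all_countable using sqint2_section[OF u] by blast
  ultimately show ?thesis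
  proof eventually_elim
    case (elim t)
    show ?case
    proof (intro allI)
      fix n x
      have "continuous_on (closure D) (\<lambda>x. \<Sum>i\<in>UNIV. conv n (inc i O3) (u i t) x)"
        unfolding D(2) using elim(2) by (intro continuous_intros conv_continuous sqint_integrable) auto
      then show "(\<Sum>i\<in>UNIV. conv n (inc i O3) (u i t) x) = 0"
        by (rule continuous_constant_on_closure) (use elim D(2) in auto)
    qed
  qed
qed

lemma AE_slice: "AE t in tm T. slice (d t) (\<lambda>i. u i t) (\<lambda>i. G i t)"
proof -
  have "AE t in tm T. (\<forall>i. sqint (u i t)) \<and> (\<forall>i. sqint (G i t))"
    unfolding AE_conj_iff AE_all_countable using sqint2_section[OF u] sqint2_section[OF G] by blast
  then show ?thesis
    using sqint2_section[OF d] weak_grad AE_weak_div by eventually_elim (unfold_locales, auto)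
qed

lemma integrable_advdiff_time: "integrable (tm T) (\<lambda>t. advdiff \<nu> (d t) (\<lambda>i. u i t) n x)"
  unfolding advdiff_def
  by (intro Bochner_Integration.integrable_add integrable_mult_right Bochner_Integration.integrable_sum
    integrable_conv_time sqint2_integrable[OF d] ud)

lemma integrable_advdiff_strip:
  assumes c: "c \<in> borel_measurable (strip T)" "\<And>z. z \<in> space (strip T) \<Longrightarrow> \<bar>c z\<bar> \<le> C"
  shows "integrable (strip T) (\<lambda>z. c z * advdiff \<nu> (d (fst z)) (\<lambda>i. u i (fst z)) n (snd z))"
proof -
  have "integrable (strip T) (\<lambda>z. \<nu> * (\<Sum>i\<in>UNIV. c z * conv n (inc i (inc i O3)) (d (fst z)) (snd z))
    + (\<Sum>i\<in>UNIV. c z * conv n (inc i O3) (\<lambda>y. d (fst z) y * u i (fst z) y) (snd z)))"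
    by (intro Bochner_Integration.integrable_add integrable_mult_right Bochner_Integration.integrable_sum
      integrable_conv_strip[OF sqint2_integrable[OF d] c]
      integrable_conv_strip[of "\<lambda>t y. d t y * u _ t y", OF ud c])
  then show ?thesis
    unfolding advdiff_def by (simp add: algebra_simps sum_distrib_left)
qed

lemma dn_measurable: "(\<lambda>z. conv n O3 (d (fst z)) (snd z)) \<in> borel_measurable (strip T)"
  using borel_measurable_integrable[OF integrable_conv_strip[OF sqint2_integrable[OF d], of "\<lambda>_. 1" 1]] by simp

lemma cvx_dn_integrable: "integrable (strip T) (\<lambda>z. cvx (conv n O3 (d (fst z)) (snd z)))"
proof (rule Bochner_Integration.integrable_bound)
  show "integrable (strip T) (\<lambda>z. conv n O3 (d (fst z)) (snd z))"
    using integrable_conv_strip[OF sqint2_integrable[OF d], of "\<lambda>_. 1" 1] by simp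
  show "(\<lambda>z. cvx (conv n O3 (d (fst z)) (snd z))) \<in> borel_measurable (strip T)"
    by (rule measurable_compose[OF dn_measurable borel_measurable_continuous_onI[OF cvx_continuous]])
  show "AE z in strip T. norm (cvx (conv n O3 (d (fst z)) (snd z))) \<le> norm (conv n O3 (d (fst z)) (snd z))"
    using cvx_lipschitz[of _ 0] by (intro AE_I2) simp
qed

text \<open>
  The one-dimensional estimate for each \<open>x\<close>, integrated over the cell; after exchanging the integrals
  the energy inequality applies at almost every time.
\<close>

lemma renormalized_bound:
  assumes \<theta>: "\<theta> > 0"
  shows "(LINT z|strip T. cvx (conv n O3 (d (fst z)) (snd z))) \<le>
    T * (\<Sum>i\<in>UNIV. (\<theta> * (LINT t|tm T. LINT x|torus. (G i t x)\<^sup>2) + (LINT t|tm T. omega n (u i t)) / \<theta>) / 2)"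
proof -
  let ?dn = "\<lambda>t. conv n O3 (d t)" and ?R = "\<lambda>t. advdiff \<nu> (d t) (\<lambda>i. u i t) n"
  let ?c = "\<lambda>z. (T - fst z) * cvx' (?dn (fst z) (snd z))"
  let ?E = "\<lambda>t. \<Sum>i\<in>UNIV. (\<theta> * (LINT x|torus. (G i t x)\<^sup>2) + omega n (u i t) / \<theta>) / 2"
  have c: "?c \<in> borel_measurable (strip T)"
    by (intro borel_measurable_times borel_measurable_diff borel_measurable_const
      measurable_compose[OF measurable_fst measurable_ident_tm]
      measurable_compose[OF dn_measurable borel_measurable_continuous_onI[OF cvx'_continuous]])
  have cb: "\<bar>?c z\<bar> \<le> T" if "z \<in> space (strip T)" for z
  proof -
    have "\<bar>T - fst z\<bar> * \<bar>cvx' (?dn (fst z) (snd z))\<bar> \<le> T * 1"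
      using that by (intro mult_mono cvx'_bound) (auto simp: space_pair_measure space_restrict_space)
    then show ?thesis by (simp add: abs_mult)
  qed
  have ie: "integrable (strip T) (\<lambda>z. ?c z * ?R (fst z) (snd z))" by (rule integrable_advdiff_strip[OF c cb])
  have ode: "(LINT t|tm T. cvx (?dn t x)) \<le> (LINT t|tm T. (T - t) * (cvx' (?dn t x) * ?R t x))" for x
  proof -
    interpret weak_ode T "\<lambda>t. ?dn t x" "\<lambda>t. ?R t x"
      by unfold_locales
        (use T integrable_conv_time[OF sqint2_integrable[OF d]] integrable_advdiff_time equation initial in auto)
    show ?thesis
      by (rule renormalized_estimate[OF cvx_deriv cvx'_mono cvx'_continuous cvx_0])
  qed
  have "(LINT z|strip T. cvx (?dn (fst z) (snd z))) = (LINT x|torus. LINT t|tm T. cvx (?dn t x))"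
    by (rule strip.lint_lint_snd[of "\<lambda>t x. cvx (?dn t x)", symmetric]) (rule cvx_dn_integrable)
  also have "\<dots> \<le> (LINT x|torus. LINT t|tm T. ?c (t, x) * ?R t x)"
  proof (rule integral_mono)
    show "integrable torus (\<lambda>x. LINT t|tm T. cvx (?dn t x))"
      using strip.integrable_snd[of "\<lambda>t x. cvx (?dn t x)"] cvx_dn_integrable[of n] by (simp add: case_prod_unfold)
    show "integrable torus (\<lambda>x. LINT t|tm T. ?c (t, x) * ?R t x)"
      using strip.integrable_snd[of "\<lambda>t x. ?c (t, x) * ?R t x"] ie by (simp add: case_prod_unfold)
    show "(LINT t|tm T. cvx (?dn t x)) \<le> (LINT t|tm T. ?c (t, x) * ?R t x)" for x
      using ode[of x] by (simp add: mult.assoc)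
  qed
  also have "\<dots> = (LINT t|tm T. LINT x|torus. ?c (t, x) * ?R t x)"
    using strip.lint_lint_snd[of "\<lambda>t x. ?c (t, x) * ?R t x"] strip.lint_lint_fst[of "\<lambda>t x. ?c (t, x) * ?R t x"] ie
    by simp
  also have "\<dots> \<le> (LINT t|tm T. T * ?E t)"
  proof (rule integral_mono_AE)
    show "integrable (tm T) (\<lambda>t. LINT x|torus. ?c (t, x) * ?R t x)"
      using strip.integrable_fst'[OF ie] by simp
    show "integrable (tm T) (\<lambda>t. T * ?E t)"
      by (intro integrable_mult_right Bochner_Integration.integrable_sum integrable_divide
        Bochner_Integration.integrable_add integrable_sq_norm G omega_time(1) u)
    show "AE t in tm T. (LINT x|torus. ?c (t, x) * ?R t x) \<le> T * ?E t"
      using AE_slice AE_space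
    proof eventually_elim
      case (elim t)
      interpret slice "d t" "\<lambda>i. u i t" "\<lambda>i. G i t" by (rule elim(1))
      have t: "0 < t" "t < T" using elim(2) by (auto simp: space_restrict_space)
      have "(LINT x|torus. cvx' (?dn t x) * ?R t x) \<le> ?E t"
        by (rule energy_inequality[OF \<nu> \<theta> cvx_deriv cvx'_deriv cvx''_continuous cvx''_nonneg cvx'_bound])
      then have "(T - t) * (LINT x|torus. cvx' (?dn t x) * ?R t x) \<le> (T - t) * ?E t"
        using t by (intro mult_left_mono) auto
      also have "\<dots> \<le> T * ?E t"
        using t \<theta> by (intro mult_right_mono sum_nonneg divide_nonneg_pos add_nonneg_nonneg mult_nonneg_nonneg
          integral_nonneg_AE AE_I2 omega_nonneg) auto
      finally show ?case by (simp add: mult.assoc)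
    qed
  qed
  also have "\<dots> = T * (\<Sum>i\<in>UNIV. (\<theta> * (LINT t|tm T. LINT x|torus. (G i t x)\<^sup>2) + (LINT t|tm T. omega n (u i t)) / \<theta>) / 2)"
    using integrable_sq_norm[OF G] omega_time(1)[OF u] by simp
  finally show ?thesis .
qed

text \<open>
  The integral of \<open>cvx d\<close> differs from that of \<open>cvx\<close> of the mollified \<open>d\<close> by the mollification error of
  \<open>d\<close> in \<open>L\<^sup>1\<close>. Both contributions have the form required for letting \<open>n\<close> tend to infinity and then \<open>\<theta>\<close>
  to zero.
\<close>

theorem solution_zero: "AE t in tm T. AE x in torus. d t x = 0"
proof -
  let ?B = "LINT z|strip T. cvx (d (fst z) (snd z))"
  let ?A = "T * (\<Sum>i\<in>UNIV. LINT t|tm T. LINT x|torus. (G i t x)\<^sup>2) + T"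
  let ?w = "\<lambda>n. T * (\<Sum>i\<in>UNIV. LINT t|tm T. omega n (u i t)) + (LINT t|tm T. omega n (d t))"
  have dm: "(\<lambda>z. d (fst z) (snd z)) \<in> borel_measurable (strip T)" using d by (simp add: sqint2_def)
  have di: "integrable (strip T) (\<lambda>z. d (fst z) (snd z))" by (rule sqint2_integrable[OF d])
  have cdi: "integrable (strip T) (\<lambda>z. cvx (d (fst z) (snd z)))"
  proof (rule Bochner_Integration.integrable_bound[OF di])
    show "(\<lambda>z. cvx (d (fst z) (snd z))) \<in> borel_measurable (strip T)"
      by (rule measurable_compose[OF dm borel_measurable_continuous_onI[OF cvx_continuous]])
    show "AE z in strip T. norm (cvx (d (fst z) (snd z))) \<le> norm (d (fst z) (snd z))"
      using cvx_lipschitz[of _ 0] by (intro AE_I2) simp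
  qed
  have bound: "\<bar>?B - 0\<bar> \<le> (\<theta> * ?A + ?w n / \<theta>) / 2" if \<theta>: "\<theta> > 0" for n \<theta>
  proof -
    let ?dn = "\<lambda>t. conv n O3 (d t)"
    have dni: "integrable (strip T) (\<lambda>z. ?dn (fst z) (snd z))"
      using integrable_conv_strip[OF di, of "\<lambda>_. 1" 1] by simp
    have ie: "integrable (strip T) (\<lambda>z. \<bar>?dn (fst z) (snd z) - d (fst z) (snd z)\<bar>)"
      by (intro integrable_abs Bochner_Integration.integrable_diff dni di)
    have "?B \<le> (LINT z|strip T. cvx (?dn (fst z) (snd z)) + \<bar>?dn (fst z) (snd z) - d (fst z) (snd z)\<bar>)"
    proof (rule integral_mono[OF cdi])
      show "integrable (strip T) (\<lambda>z. cvx (?dn (fst z) (snd z)) + \<bar>?dn (fst z) (snd z) - d (fst z) (snd z)\<bar>)"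
        by (intro Bochner_Integration.integrable_add cvx_dn_integrable ie)
      show "cvx (d (fst z) (snd z)) \<le> cvx (?dn (fst z) (snd z)) + \<bar>?dn (fst z) (snd z) - d (fst z) (snd z)\<bar>" for z
        using cvx_lipschitz[of "?dn (fst z) (snd z)" "d (fst z) (snd z)"] by linarith
    qed
    also have "\<dots> = (LINT z|strip T. cvx (?dn (fst z) (snd z))) + (LINT z|strip T. \<bar>?dn (fst z) (snd z) - d (fst z) (snd z)\<bar>)"
      by (intro Bochner_Integration.integral_add cvx_dn_integrable ie)
    also have "(LINT z|strip T. \<bar>?dn (fst z) (snd z) - d (fst z) (snd z)\<bar>) = (LINT t|tm T. LINT x|torus. \<bar>?dn t x - d t x\<bar>)"
      using strip.lint_lint_fst[of "\<lambda>t x. \<bar>?dn t x - d t x\<bar>"] ie by simp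
    also have "\<dots> \<le> (LINT t|tm T. (\<theta> + omega n (d t) / \<theta>) / 2)"
    proof (rule integral_mono_AE)
      show "integrable (tm T) (\<lambda>t. LINT x|torus. \<bar>?dn t x - d t x\<bar>)"
        using strip.integrable_fst'[OF ie] by simp
      show "integrable (tm T) (\<lambda>t. (\<theta> + omega n (d t) / \<theta>) / 2)"
        by (intro integrable_divide Bochner_Integration.integrable_add omega_time(1) d tm.integrable_const)
      show "AE t in tm T. (LINT x|torus. \<bar>?dn t x - d t x\<bar>) \<le> (\<theta> + omega n (d t) / \<theta>) / 2"
        using sqint2_section[OF d] by eventually_elim (rule conv_L1_error[OF _ \<theta>])
    qed
    also have "\<dots> = (T * \<theta> + (LINT t|tm T. omega n (d t)) / \<theta>) / 2"
      using omega_time(1)[OF d] lint_tm_const[of \<theta>] by simp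
    finally have "?B \<le> T * (\<Sum>i\<in>UNIV. (\<theta> * (LINT t|tm T. LINT x|torus. (G i t x)\<^sup>2) + (LINT t|tm T. omega n (u i t)) / \<theta>) / 2)
        + (T * \<theta> + (LINT t|tm T. omega n (d t)) / \<theta>) / 2"
      using renormalized_bound[OF \<theta>, of n] by linarith
    also have "\<dots> = (\<theta> * ?A + ?w n / \<theta>) / 2"
      by (simp add: sum.distrib sum_divide_distrib[symmetric] sum_distrib_left[symmetric]
        add_divide_distrib distrib_left mult.commute mult.left_commute)
    finally have "?B \<le> (\<theta> * ?A + ?w n / \<theta>) / 2" .
    moreover have "0 \<le> ?B" by (intro integral_nonneg_AE AE_I2 cvx_nonneg)
    ultimately show ?thesis by simp
  qed
  have "?w \<longlonglongrightarrow> T * (\<Sum>i\<in>(UNIV::3 set). 0) + 0"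
    by (intro tendsto_add tendsto_mult tendsto_const tendsto_sum omega_time(2) u d)
  then have w: "?w \<longlonglongrightarrow> 0" by simp
  have "0 \<le> ?A"
    using T by (intro add_nonneg_nonneg mult_nonneg_nonneg sum_nonneg integral_nonneg_AE AE_I2) auto
  from tendsto_of_young_bound[of "\<lambda>_. ?B" 0 ?A ?w, OF bound w this]
  have "?B = 0" using LIMSEQ_unique[OF tendsto_const] by blast
  then have "AE z in strip T. cvx (d (fst z) (snd z)) = 0"
    using integral_nonneg_eq_0_iff_AE[OF cdi] cvx_nonneg by simp
  then have "AE z in strip T. d (fst z) (snd z) = 0"
    by eventually_elim (rule cvx_eq_0)
  from strip.AE_pair[OF this] show ?thesis by simp
qed

end

section \<open>Product measurable representatives\<close>

lemma borel_measurable_tm_AE: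
  fixes f g :: "real \<Rightarrow> real"
  assumes g: "g \<in> borel_measurable (tm T)" and ae: "AE t in tm T. f t = g t"
  shows "f \<in> borel_measurable (tm T)"
proof -
  let ?S = "{0<..<T}"
  have S: "?S \<in> sets lebesgue" by simp
  have "(\<lambda>t. if t \<in> ?S then g t else 0) \<in> borel_measurable lebesgue"
    by (rule borel_measurable_if_I[OF g S])
  moreover have "AE t in lebesgue. t \<in> ?S \<longrightarrow> f t = g t"
    using ae by (subst (asm) AE_restrict_space_iff) auto
  then have "AE t in lebesgue. (if t \<in> ?S then g t else 0) = (if t \<in> ?S then f t else 0)"
    by eventually_elim simp
  ultimately have "(\<lambda>t. if t \<in> ?S then f t else 0) \<in> borel_measurable lebesgue"
    by (rule borel_measurable_AE)
  then show ?thesis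
    by (rule borel_measurable_if_D)
qed

lemma lint_tm_cong_AE:
  fixes f g :: "real \<Rightarrow> real"
  assumes "g \<in> borel_measurable (tm T)" and "AE t in tm T. f t = g t"
  shows "(LINT t|tm T. f t) = (LINT t|tm T. g t)"
  by (rule integral_cong_AE[OF borel_measurable_tm_AE[OF assms] assms])

text \<open>
  Fubini's theorem needs measurability for the product of the two factor measures. Lebesgue
  measurability on the strip provides it only after a change on a null set, which turns the function
  into a Borel function.
\<close>

lemma product_measurable_version:
  fixes f :: "real \<Rightarrow> real^3 \<Rightarrow> real"
  assumes "st_measurable T f"
  shows "\<exists>g. (\<lambda>z. g (fst z) (snd z)) \<in> borel_measurable (strip T) \<and> (AE t in tm T. AE x in torus. f t x = g t x)"
proof -
  let ?S = "{0<..<T} \<times> torus_cell"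
  have "?S \<in> sets (borel \<Otimes>\<^sub>M borel)" by (intro pair_measureI) auto
  then have Sb: "?S \<in> sets borel" by (simp only: borel_prod)
  then have S: "?S \<in> sets lebesgue" by simp
  have "(\<lambda>z. if z \<in> ?S then f (fst z) (snd z) else 0) \<in> borel_measurable lebesgue"
    by (rule borel_measurable_if_I[OF _ S]) (use assms in \<open>simp only: st_measurable_def case_prod_unfold\<close>)
  then obtain h where h: "h \<in> borel_measurable lborel"
    and ae: "AE z in lborel. (if z \<in> ?S then f (fst z) (snd z) else 0) = h z"
    using completion_ex_borel_measurable_real by blast
  have "AE z in lborel \<Otimes>\<^sub>M lborel. (if z \<in> ?S then f (fst z) (snd z) else 0) = h z"
    using ae by (simp only: lborel_prod)
  from lborel_pair.AE_pair[OF this]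
  have "AE t in lborel. AE x in lborel. t \<in> {0<..<T} \<and> x \<in> torus_cell \<longrightarrow> f t x = h (t, x)"
  proof eventually_elim
    case (elim t)
    then show ?case by eventually_elim (auto split: if_splits)
  qed
  then have 1: "AE t in lebesgue. AE x in lborel. t \<in> {0<..<T} \<and> x \<in> torus_cell \<longrightarrow> f t x = h (t, x)"
    by (rule AE_completion)
  have "AE t in lebesgue. t \<in> {0<..<T} \<longrightarrow> (AE x in torus. f t x = h (t, x))"
    using 1
  proof eventually_elim
    case (elim t)
    show ?case
    proof
      assume t: "t \<in> {0<..<T}"
      have "AE x in lebesgue. t \<in> {0<..<T} \<and> x \<in> torus_cell \<longrightarrow> f t x = h (t, x)"
        using elim by (rule AE_completion)
      then have "AE x in lebesgue. x \<in> torus_cell \<longrightarrow> f t x = h (t, x)"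
        by eventually_elim (use t in auto)
      then show "AE x in torus. f t x = h (t, x)"
        by (subst AE_restrict_space_iff) auto
    qed
  qed
  then have "AE t in tm T. AE x in torus. f t x = h (t, x)"
    by (subst AE_restrict_space_iff) auto
  moreover have "(\<lambda>z. h (fst z, snd z)) \<in> borel_measurable (strip T)"
  proof -
    have "(\<lambda>z. (fst z, snd z)) \<in> strip T \<rightarrow>\<^sub>M borel \<Otimes>\<^sub>M borel"
      by (intro measurable_Pair measurable_compose[OF measurable_fst measurable_ident_tm]
        measurable_compose[OF measurable_snd measurable_ident_torus])
    then have "(\<lambda>z. (fst z, snd z)) \<in> strip T \<rightarrow>\<^sub>M borel" by (simp only: borel_prod)
    from measurable_compose[OF this] h show ?thesis by simp
  qed
  ultimately show ?thesis by (intro exI[of _ "\<lambda>t x. h (t, x)"]) auto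
qed

lemma (in time_strip) sqint2_version:
  fixes f :: "real \<Rightarrow> real^3 \<Rightarrow> real"
  assumes f: "st_measurable T f" and sq: "AE t in tm T. sqint (f t)"
    and w: "integrable (tm T) w" "AE t in tm T. (LINT x|torus. (f t x)\<^sup>2) \<le> w t"
  shows "\<exists>g. sqint2 g \<and> (AE t in tm T. AE x in torus. f t x = g t x)"
proof -
  obtain g where g: "(\<lambda>z. g (fst z) (snd z)) \<in> borel_measurable (strip T)"
    and ae: "AE t in tm T. AE x in torus. f t x = g t x"
    using product_measurable_version[OF f] by blast
  have sec: "AE t in tm T. integrable torus (\<lambda>x. (g t x)\<^sup>2) \<and> (LINT x|torus. (g t x)\<^sup>2) \<le> w t"
    using ae sq w(2) AE_space
  proof eventually_elim
    case (elim t)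
    have [measurable]: "g t \<in> borel_measurable torus"
      using measurable_compose[OF measurable_Pair1'[OF elim(4)] g] by simp
    have [measurable]: "f t \<in> borel_measurable torus" using elim(2) by (rule sqint_measurable)
    have eq: "AE x in torus. (f t x)\<^sup>2 = (g t x)\<^sup>2" using elim(1) by eventually_elim simp
    have "integrable torus (\<lambda>x. (g t x)\<^sup>2)"
      by (rule integrable_cong_AE_imp[OF sqint_square[OF elim(2)] _ eq]) measurable
    moreover have "(LINT x|torus. (f t x)\<^sup>2) = (LINT x|torus. (g t x)\<^sup>2)"
      by (rule integral_cong_AE[OF _ _ eq]) measurable
    ultimately show ?case using elim(3) by simp
  qed
  have "integrable (strip T) (\<lambda>z. (g (fst z) (snd z))\<^sup>2)"
  proof (rule strip.Fubini_integrable)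
    show m: "(\<lambda>z. (g (fst z) (snd z))\<^sup>2) \<in> borel_measurable (strip T)" using g by measurable
    show "AE t in tm T. integrable torus (\<lambda>x. (g (fst (t, x)) (snd (t, x)))\<^sup>2)"
      using sec by eventually_elim simp
    have "integrable (tm T) (\<lambda>t. LINT x|torus. (g t x)\<^sup>2)"
    proof (rule Bochner_Integration.integrable_bound[OF w(1)])
      show "(\<lambda>t. LINT x|torus. (g t x)\<^sup>2) \<in> borel_measurable (tm T)"
        using m by (intro torus.borel_measurable_lebesgue_integral) (simp add: case_prod_unfold)
      show "AE t in tm T. norm (LINT x|torus. (g t x)\<^sup>2) \<le> norm (w t)"
        using sec
      proof eventually_elim
        case (elim t)
        moreover have "0 \<le> (LINT x|torus. (g t x)\<^sup>2)" by (intro integral_nonneg_AE AE_I2) simp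
        ultimately show ?case by (simp only: real_norm_def) linarith
      qed
    qed
    then show "integrable (tm T) (\<lambda>t. LINT x|torus. norm ((g (fst (t, x)) (snd (t, x)))\<^sup>2))" by simp
  qed
  then show ?thesis using g ae by (auto simp: sqint2_def)
qed

lemma L2_torus_functional:
  fixes f :: "real^3 \<Rightarrow> 'b::euclidean_space"
  assumes f: "L2_torus f" and l: "bounded_linear l" "\<And>v. \<bar>l v\<bar> \<le> norm v"
  shows "sqint (\<lambda>x. l (f x))" and "(LINT x|torus. (l (f x))\<^sup>2) \<le> (LINT x|torus. (norm (f x))\<^sup>2)"
proof -
  have [measurable]: "f \<in> borel_measurable torus" and i: "integrable torus (\<lambda>x. (norm (f x))\<^sup>2)"
    using f by (auto simp: L2_torus_def)
  have "l \<in> borel_measurable borel"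
    by (intro borel_measurable_continuous_onI linear_continuous_on l)
  note [measurable] = measurable_compose[OF \<open>f \<in> borel_measurable torus\<close> this]
  have bd: "(l (f x))\<^sup>2 \<le> (norm (f x))\<^sup>2" for x
    using power_mono[OF l(2) abs_ge_zero, of "f x" 2] by simp
  show s: "sqint (\<lambda>x. l (f x))"
    unfolding sqint_def
  proof
    show "integrable torus (\<lambda>x. (l (f x))\<^sup>2)"
      by (rule Bochner_Integration.integrable_bound[OF i]) (use bd in \<open>measurable, auto\<close>)
  qed measurable
  show "(LINT x|torus. (l (f x))\<^sup>2) \<le> (LINT x|torus. (norm (f x))\<^sup>2)"
    by (intro integral_mono sqint_square s i bd)
qed

lemma (in time_strip) sqint2_functional_version:
  fixes f :: "real \<Rightarrow> real^3 \<Rightarrow> 'b::euclidean_space"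
  assumes f: "st_measurable T f" "AE t in tm T. L2_torus (f t)"
    and w: "integrable (tm T) w" "AE t in tm T. (LINT x|torus. (norm (f t x))\<^sup>2) \<le> w t"
    and l: "bounded_linear l" "\<And>v. \<bar>l v\<bar> \<le> norm v"
  shows "\<exists>g. sqint2 g \<and> (AE t in tm T. AE x in torus. l (f t x) = g t x)"
proof (rule sqint2_version[OF _ _ w(1)])
  have "l \<in> borel_measurable borel"
    by (intro borel_measurable_continuous_onI linear_continuous_on l)
  from measurable_compose[OF f(1)[unfolded st_measurable_def] this]
  show "st_measurable T (\<lambda>t x. l (f t x))" by (simp add: st_measurable_def case_prod_unfold)
  show "AE t in tm T. sqint (\<lambda>x. l (f t x))"
    using f(2) by eventually_elim (rule L2_torus_functional(1)[OF _ l])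
  show "AE t in tm T. (LINT x|torus. (l (f t x))\<^sup>2) \<le> w t"
    using f(2) w(2) by eventually_elim (blast intro: order_trans L2_torus_functional(2)[OF _ l])
qed

lemma L2_torus_component:
  fixes f :: "real^3 \<Rightarrow> real^'k"
  assumes "L2_torus f"
  shows "sqint (\<lambda>x. f x $ k)" and "(LINT x|torus. (f x $ k)\<^sup>2) \<le> (LINT x|torus. (norm (f x))\<^sup>2)"
  using L2_torus_functional[OF assms bounded_linear_vec_nth component_le_norm_cart] by auto

lemma L2_torus_component2:
  fixes f :: "real^3 \<Rightarrow> real^'k^'j"
  assumes "L2_torus f"
  shows "sqint (\<lambda>x. f x $ i $ k)"
  using assms bounded_linear_compose[OF bounded_linear_vec_nth bounded_linear_vec_nth]
    order_trans[OF component_le_norm_cart Finite_Cartesian_Product.norm_nth_le]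
  by (rule L2_torus_functional(1))

section \<open>Testing with translates of the kernels\<close>

text \<open>The gradient of the translated kernel, written as a sum so that it is known to be smooth.\<close>

definition kgrad :: "nat \<Rightarrow> real^3 \<Rightarrow> real^3 \<Rightarrow> real^3" where
  "kgrad n x = kersum n (\<lambda>k. inc k O3) (\<lambda>k. axis k 1) x O3"

lemma sum_axis_component: "(\<Sum>i\<in>UNIV. A i * (axis i 1 :: real^3) $ k) = (A k :: real)"
proof -
  have "(\<Sum>i\<in>UNIV. A i * (axis i 1 :: real^3) $ k) = (\<Sum>i\<in>UNIV. if i = k then A k else 0)"
    by (rule sum.cong) (auto simp: axis_def)
  then show ?thesis by simp
qed

lemma kgrad_component: "kgrad n x y $ k = Ker n (inc k O3) (y - x)"
proof -
  have e: "(\<lambda>j. 0 + inc i O3 j) = inc i O3" for i by (auto simp: fun_eq_iff)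
  show ?thesis
    unfolding kgrad_def kersum_def sum_component vector_scaleR_component real_scaleR_def e
    by (rule sum_axis_component)
qed

lemma grad_scaled_kersum:
  "grad (\<lambda>y. c *\<^sub>R kersum n \<mu> v x m y) y = (\<chi> i. c *\<^sub>R kersum n \<mu> v x (inc i m) y)"
  unfolding grad_def frechet_derivative_at[OF has_derivative_scaleR_right[OF kersum_has_derivative], symmetric]
    sum_axis_scaleR ..

lemma grad_kgrad_component: "grad (\<lambda>y. c *\<^sub>R kgrad n x y) y $ i $ k = c * Ker n (inc i (inc k O3)) (y - x)"
proof -
  have e: "(\<lambda>j. inc i O3 j + inc l O3 j) = inc i (inc l O3)" for l
    by (auto simp: fun_eq_iff)
  have "kersum n (\<lambda>k. inc k O3) (\<lambda>k. axis k (1::real)) x (inc i O3) y $ k = Ker n (inc i (inc k O3)) (y - x)"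
    unfolding kersum_def sum_component vector_scaleR_component real_scaleR_def e
    by (rule sum_axis_component)
  then show ?thesis
    unfolding kgrad_def grad_scaled_kersum by simp
qed

lemma kersum_scalar: "kersum n (\<lambda>_::unit. O3) (\<lambda>_. 1::real) x m y = Ker n m (y - x)"
  by (simp add: kersum_def)

lemma ker_test: "smooth (\<lambda>y. Ker n m (y - x))" "periodic (\<lambda>y. Ker n m (y - x))"
  "grad (\<lambda>y. Ker n m (y - x)) y $ i = Ker n (inc i m) (y - x)"
proof -
  have e: "(\<lambda>y. Ker n m (y - x)) = kersum n (\<lambda>_::unit. O3) (\<lambda>_. 1) x m"
    unfolding kersum_scalar ..
  show "smooth (\<lambda>y. Ker n m (y - x))" unfolding e by (rule smooth_kersum)
  show "periodic (\<lambda>y. Ker n m (y - x))" unfolding e by (rule periodic_kersum)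
  show "grad (\<lambda>y. Ker n m (y - x)) y $ i = Ker n (inc i m) (y - x)"
    unfolding e grad_kersum vec_lambda_beta kersum_scalar ..
qed

lemma weak_grad_conv:
  assumes "has_weak_grad f g" shows "conv n (inc i m) f x = - conv n m (\<lambda>y. g y $ i) x"
proof -
  have "(LINT y|torus. (grad (\<lambda>y. Ker n m (y - x)) y $ i) *\<^sub>R f y) = - (LINT y|torus. Ker n m (y - x) *\<^sub>R (g y $ i))"
    using assms ker_test(1,2)[of n m x] unfolding has_weak_grad_def by blast
  then show ?thesis by (simp add: ker_test(3) conv_def)
qed

lemma weak_grad_conv_component:
  fixes f :: "real^3 \<Rightarrow> real^3"
  assumes w: "has_weak_grad f g"
  shows "conv n (inc i m) (\<lambda>y. f y $ k) x = - conv n m (\<lambda>y. g y $ i $ k) x"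
proof -
  have L: "L2_torus f" "L2_torus g" using w by (auto simp: has_weak_grad_def)
  have "(LINT y|torus. (grad (\<lambda>y. Ker n m (y - x)) y $ i) *\<^sub>R f y) = - (LINT y|torus. Ker n m (y - x) *\<^sub>R (g y $ i))"
    using w ker_test(1,2)[of n m x] unfolding has_weak_grad_def by blast
  then have e: "(LINT y|torus. Ker n (inc i m) (y - x) *\<^sub>R f y) $ k = - ((LINT y|torus. Ker n m (y - x) *\<^sub>R (g y $ i)) $ k)"
    unfolding ker_test(3) by simp
  have comp: "(LINT y|torus. Ker n m (y - x) *\<^sub>R h y) $ k = conv n m (\<lambda>y. h y $ k) x"
    if h: "\<And>k. integrable torus (\<lambda>y. h y $ k)" "h \<in> borel_measurable torus" for h :: "real^3 \<Rightarrow> real^3" and m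
  proof -
    have "integrable torus (\<lambda>y. Ker n m (y - x) *\<^sub>R h y)"
    proof (rule Bochner_Integration.integrable_bound)
      show "integrable torus (\<lambda>y. \<Sum>k\<in>UNIV. \<bar>Ker n m (y - x) * h y $ k\<bar>)"
        by (intro Bochner_Integration.integrable_sum integrable_abs integrable_Ker_mult h)
      show "(\<lambda>y. Ker n m (y - x) *\<^sub>R h y) \<in> borel_measurable torus"
        using h(2) by measurable
      show "AE y in torus. norm (Ker n m (y - x) *\<^sub>R h y) \<le> norm (\<Sum>k\<in>UNIV. \<bar>Ker n m (y - x) * h y $ k\<bar>)"
        using norm_le_l1_cart[of "Ker n m (_ - x) *\<^sub>R h _"] by (intro AE_I2) (simp add: order_trans[OF norm_le_l1_cart])
    qed
    from integral_bounded_linear[OF bounded_linear_vec_nth this, of k]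
    show ?thesis by (simp add: conv_def)
  qed
  have "f \<in> borel_measurable torus" "g \<in> borel_measurable torus" using L by (auto simp: L2_torus_def)
  moreover have "(\<lambda>y. g y $ i) \<in> borel_measurable torus"
    by (rule measurable_compose[OF \<open>g \<in> borel_measurable torus\<close>])
       (intro borel_measurable_continuous_onI continuous_intros)
  ultimately show ?thesis
    using e comp[of f "inc i m"] comp[of "\<lambda>y. g y $ i" m]
      sqint_integrable[OF L2_torus_component(1)[OF L(1)]] sqint_integrable[OF L2_torus_component2[OF L(2)]]
    by simp
qed

lemma weak_div_conv:
  assumes w: "has_weak_div f d" shows "(\<Sum>i\<in>UNIV. conv n (inc i m) (\<lambda>y. f y $ i) x) = - conv n m d x"
proof -
  have L: "L2_torus f" using w by (auto simp: has_weak_div_def)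
  have "(LINT y|torus. f y \<bullet> grad (\<lambda>y. Ker n m (y - x)) y) = - (LINT y|torus. d y * Ker n m (y - x))"
    using w ker_test(1,2)[of n m x] unfolding has_weak_div_def by blast
  then have "(LINT y|torus. (\<Sum>i\<in>UNIV. Ker n (inc i m) (y - x) * f y $ i)) = - conv n m d x"
    by (simp add: ker_test(3) conv_def inner_vec_def mult.commute)
  then show ?thesis
    unfolding conv_def
    by (subst (asm) Bochner_Integration.integral_sum)
       (intro integrable_Ker_mult sqint_integrable[OF L2_torus_component(1)[OF L]])
qed

lemma conv_cong_AE:
  assumes "AE y in torus. f y = g y" "f \<in> borel_measurable torus" "g \<in> borel_measurable torus"
  shows "conv n m f x = conv n m g x"
  unfolding conv_def
proof (rule integral_cong_AE)
  show "AE y in torus. Ker n m (y - x) * f y = Ker n m (y - x) * g y"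
    using assms(1) by eventually_elim simp
qed (use assms(2,3) in measurable)

text \<open>
  The induction equation tested with \<open>\<eta> \<nabla>K\<close>, at a fixed time: the two transport terms cancel
  because the second derivatives of the kernel commute, and integrations by parts turn the others into
  the terms of an advection-diffusion equation for \<open>div B\<close>.
\<close>

lemma induction_tested:
  fixes u B :: "real^3 \<Rightarrow> real^3" and DB :: "real^3 \<Rightarrow> real^3^3"
  assumes u: "L2_torus u" and DB: "has_weak_grad B DB" and d: "has_weak_div B d"
  shows "(LINT y|torus. B y \<bullet> (e' *\<^sub>R kgrad n x y) - \<nu> * (DB y \<bullet> grad (\<lambda>y. e *\<^sub>R kgrad n x y) y)
      + outer (u y) (B y) \<bullet> grad (\<lambda>y. e *\<^sub>R kgrad n x y) y
      - outer (B y) (u y) \<bullet> grad (\<lambda>y. e *\<^sub>R kgrad n x y) y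
      - d y * (u y \<bullet> (e *\<^sub>R kgrad n x y)))
    = - (e' * conv n O3 d x + e * advdiff \<nu> d (\<lambda>k y. u y $ k) n x)"
proof -
  let ?g = "\<lambda>y. grad (\<lambda>y. e *\<^sub>R kgrad n x y) y"
  let ?K1 = "\<lambda>k y. Ker n (inc k O3) (y - x)" and ?K2 = "\<lambda>i k y. Ker n (inc i (inc k O3)) (y - x)"
  have LB: "L2_torus B" "L2_torus DB" using DB by (auto simp: has_weak_grad_def)
  have Ld: "L2_torus d" using d by (auto simp: has_weak_div_def)
  have sd: "sqint d" using L2_torus_functional(1)[OF Ld bounded_linear_ident] by simp
  have iB: "integrable torus (\<lambda>y. B y $ k)" and iDB: "integrable torus (\<lambda>y. DB y $ i $ k)"
    and idu: "integrable torus (\<lambda>y. d y * u y $ k)" for i k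
    by (intro sqint_integrable L2_torus_component L2_torus_component2 LB sqint_mult_integrable sd u)+
  have sym: "outer (u y) (B y) \<bullet> ?g y = outer (B y) (u y) \<bullet> ?g y" for y
  proof -
    have "outer (u y) (B y) \<bullet> ?g y = (\<Sum>i\<in>UNIV. \<Sum>k\<in>UNIV. (u y $ i * B y $ k) * (e * ?K2 i k y))"
      by (simp add: inner_vec_def outer_def grad_kgrad_component)
    also have "\<dots> = (\<Sum>k\<in>UNIV. \<Sum>i\<in>UNIV. (u y $ i * B y $ k) * (e * ?K2 i k y))"
      by (rule sum.swap)
    also have "\<dots> = (\<Sum>k\<in>UNIV. \<Sum>i\<in>UNIV. (B y $ k * u y $ i) * (e * ?K2 k i y))"
    proof (intro sum.cong refl)
      fix i k
      have "inc i (inc k O3) = inc k (inc i O3)" by (auto simp: fun_eq_iff)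
      then show "(u y $ i * B y $ k) * (e * ?K2 i k y) = (B y $ k * u y $ i) * (e * ?K2 k i y)"
        by (simp only: mult.commute)
    qed
    also have "\<dots> = outer (B y) (u y) \<bullet> ?g y"
      by (simp add: inner_vec_def outer_def grad_kgrad_component)
    finally show ?thesis .
  qed
  have "(LINT y|torus. B y \<bullet> (e' *\<^sub>R kgrad n x y) - \<nu> * (DB y \<bullet> ?g y)
      + outer (u y) (B y) \<bullet> ?g y - outer (B y) (u y) \<bullet> ?g y - d y * (u y \<bullet> (e *\<^sub>R kgrad n x y)))
    = (LINT y|torus. e' * (\<Sum>k\<in>UNIV. ?K1 k y * B y $ k) - \<nu> * e * (\<Sum>i\<in>UNIV. \<Sum>k\<in>UNIV. ?K2 i k y * DB y $ i $ k)
      - e * (\<Sum>k\<in>UNIV. ?K1 k y * (d y * u y $ k)))"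
    by (intro Bochner_Integration.integral_cong refl)
       (simp add: sym, simp add: inner_vec_def grad_kgrad_component kgrad_component sum_distrib_left mult_ac)
  also have "\<dots> = e' * (\<Sum>k\<in>UNIV. conv n (inc k O3) (\<lambda>y. B y $ k) x)
      - \<nu> * e * (\<Sum>i\<in>UNIV. \<Sum>k\<in>UNIV. conv n (inc i (inc k O3)) (\<lambda>y. DB y $ i $ k) x)
      - e * (\<Sum>k\<in>UNIV. conv n (inc k O3) (\<lambda>y. d y * u y $ k) x)"
    unfolding conv_def
    using integrable_Ker_mult[OF iB] integrable_Ker_mult[OF iDB] integrable_Ker_mult[OF idu] by simp
  also have "(\<Sum>k\<in>UNIV. conv n (inc k O3) (\<lambda>y. B y $ k) x) = - conv n O3 d x"
    by (rule weak_div_conv[OF d])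
  also have "(\<Sum>i\<in>UNIV. \<Sum>k\<in>UNIV. conv n (inc i (inc k O3)) (\<lambda>y. DB y $ i $ k) x) = (\<Sum>i\<in>UNIV. conv n (inc i (inc i O3)) d x)"
  proof (rule sum.cong[OF refl])
    fix i
    have "conv n (inc i (inc k O3)) (\<lambda>y. DB y $ i $ k) x = - conv n (inc k (inc i (inc i O3))) (\<lambda>y. B y $ k) x" for k
    proof -
      have "conv n (inc i (inc i (inc k O3))) (\<lambda>y. B y $ k) x = - conv n (inc i (inc k O3)) (\<lambda>y. DB y $ i $ k) x"
        by (rule weak_grad_conv_component[OF DB])
      moreover have "inc i (inc i (inc k O3)) = inc k (inc i (inc i O3))" by (auto simp: fun_eq_iff)
      ultimately show ?thesis by simp
    qed
    then have "(\<Sum>k\<in>UNIV. conv n (inc i (inc k O3)) (\<lambda>y. DB y $ i $ k) x) =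
        - (\<Sum>k\<in>UNIV. conv n (inc k (inc i (inc i O3))) (\<lambda>y. B y $ k) x)"
      by (simp only: sum_negf)
    also have "(\<Sum>k\<in>UNIV. conv n (inc k (inc i (inc i O3))) (\<lambda>y. B y $ k) x) = - conv n (inc i (inc i O3)) d x"
      by (rule weak_div_conv[OF d])
    finally show "(\<Sum>k\<in>UNIV. conv n (inc i (inc k O3)) (\<lambda>y. DB y $ i $ k) x) = conv n (inc i (inc i O3)) d x"
      unfolding minus_minus .
  qed
  also have "e' * - D - \<nu> * e * S - e * W = - (e' * D + e * (\<nu> * S + W))" for D S W
    by (simp add: algebra_simps)
  finally show ?thesis unfolding advdiff_def .
qed

lemma incompressibility_tested:
  assumes u: "L2_torus u"
  shows "(LINT y|torus. u y \<bullet> grad (\<lambda>y. e *\<^sub>R kersum n (\<lambda>_::unit. O3) (\<lambda>_. 1::real) x O3 y) y)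
    = e * (\<Sum>k\<in>UNIV. conv n (inc k O3) (\<lambda>y. u y $ k) x)"
proof -
  let ?\<phi> = "kersum n (\<lambda>_::unit. O3) (\<lambda>_. 1::real) x"
  have "grad (\<lambda>y. e *\<^sub>R ?\<phi> O3 y) y $ k = e * Ker n (inc k O3) (y - x)" for y k
    unfolding grad_scaled_kersum vec_lambda_beta by (simp only: kersum_scalar real_scaleR_def)
  then have "(LINT y|torus. u y \<bullet> grad (\<lambda>y. e *\<^sub>R ?\<phi> O3 y) y) = (LINT y|torus. e * (\<Sum>k\<in>UNIV. Ker n (inc k O3) (y - x) * u y $ k))"
    by (simp add: inner_vec_def sum_distrib_left mult_ac)
  also have "\<dots> = e * (\<Sum>k\<in>UNIV. conv n (inc k O3) (\<lambda>y. u y $ k) x)"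
    unfolding conv_def
    using integrable_Ker_mult[OF sqint_integrable[OF L2_torus_component(1)[OF u]]] by simp
  finally show ?thesis .
qed

section \<open>The divergence of the magnetic field\<close>

lemma L2_torus_diff:
  fixes f g :: "real^3 \<Rightarrow> 'b::euclidean_space"
  assumes "L2_torus f" "L2_torus g" shows "L2_torus (\<lambda>x. f x - g x)"
  unfolding L2_torus_def
proof (intro conjI)
  have [measurable]: "f \<in> borel_measurable torus" "g \<in> borel_measurable torus"
    and i: "integrable torus (\<lambda>x. (norm (f x))\<^sup>2)" "integrable torus (\<lambda>x. (norm (g x))\<^sup>2)"
    using assms by (auto simp: L2_torus_def)
  show "periodic (\<lambda>x. f x - g x)" using assms by (auto simp: L2_torus_def periodic_def)
  show "(\<lambda>x. f x - g x) \<in> borel_measurable torus" by measurable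
  show "integrable torus (\<lambda>x. (norm (f x - g x))\<^sup>2)"
  proof (rule Bochner_Integration.integrable_bound)
    show "integrable torus (\<lambda>x. 2 * (norm (f x))\<^sup>2 + 2 * (norm (g x))\<^sup>2)" using i by simp
    show "AE x in torus. norm ((norm (f x - g x))\<^sup>2) \<le> norm (2 * (norm (f x))\<^sup>2 + 2 * (norm (g x))\<^sup>2)"
    proof (rule AE_I2)
      fix x
      have "(norm (f x - g x))\<^sup>2 \<le> (norm (f x) + norm (g x))\<^sup>2"
        by (intro power_mono norm_triangle_ineq4) simp
      also have "\<dots> \<le> 2 * (norm (f x))\<^sup>2 + 2 * (norm (g x))\<^sup>2"
        using zero_le_power2[of "norm (f x) - norm (g x)"] by (simp add: power2_sum power2_diff)
      finally show "norm ((norm (f x - g x))\<^sup>2) \<le> norm (2 * (norm (f x))\<^sup>2 + 2 * (norm (g x))\<^sup>2)" by simp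
    qed
  qed measurable
qed

text \<open>
  Strong convergence of \<open>B\<close> to solenoidal initial data gives convergence of the mollified divergence
  to \<open>0\<close>, since the mollified divergence involves no derivative of \<open>B\<close>.
\<close>

lemma mollified_div_bound:
  assumes B: "has_weak_div B d" and B0: "has_weak_div B0 (\<lambda>_. 0)"
    and K: "\<And>i z. \<bar>Ker n (inc i O3) z\<bar> \<le> K" and \<theta>: "\<theta> > 0"
  shows "\<bar>conv n O3 d x\<bar> \<le> 3 * (K * ((\<theta> + (LINT y|torus. (norm (B y - B0 y))\<^sup>2) / \<theta>) / 2))"
proof -
  have L: "L2_torus B" "L2_torus B0" using B B0 by (auto simp: has_weak_div_def)
  have LD: "L2_torus (\<lambda>y. B y - B0 y)" by (rule L2_torus_diff[OF L])
  have K0: "0 \<le> K" using K[of 0 0] by linarith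
  have i: "integrable torus (\<lambda>y. B y $ i)" "integrable torus (\<lambda>y. B0 y $ i)" for i
    by (intro sqint_integrable L2_torus_component L)+
  have sD: "sqint (\<lambda>y. (B y - B0 y) $ i)" for i by (rule L2_torus_component(1)[OF LD])
  have diff: "conv n (inc i O3) (\<lambda>y. (B y - B0 y) $ i) x = conv n (inc i O3) (\<lambda>y. B y $ i) x - conv n (inc i O3) (\<lambda>y. B0 y $ i) x" for i
    unfolding conv_def
    using integrable_Ker_mult[OF i(1)] integrable_Ker_mult[OF i(2)] by (simp add: right_diff_distrib)
  have each: "\<bar>conv n (inc i O3) (\<lambda>y. (B y - B0 y) $ i) x\<bar> \<le> K * ((\<theta> + (LINT y|torus. (norm (B y - B0 y))\<^sup>2) / \<theta>) / 2)" for i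
  proof -
    have iN: "integrable torus (\<lambda>y. ((B y - B0 y) $ i)\<^sup>2)" by (rule sqint_square[OF sD])
    have "(LINT y|torus. \<bar>(B y - B0 y) $ i\<bar>) \<le> (LINT y|torus. (\<theta> + ((B y - B0 y) $ i)\<^sup>2 / \<theta>) / 2)"
    proof (rule integral_mono)
      show "integrable torus (\<lambda>y. \<bar>(B y - B0 y) $ i\<bar>)" by (intro integrable_abs sqint_integrable sD)
      show "integrable torus (\<lambda>y. (\<theta> + ((B y - B0 y) $ i)\<^sup>2 / \<theta>) / 2)" using iN by simp
      show "\<bar>(B y - B0 y) $ i\<bar> \<le> (\<theta> + ((B y - B0 y) $ i)\<^sup>2 / \<theta>) / 2" for y
        using young_half[OF \<theta>, of 1 "(B y - B0 y) $ i"] by simp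
    qed
    also have "\<dots> = (\<theta> + (LINT y|torus. ((B y - B0 y) $ i)\<^sup>2) / \<theta>) / 2"
      using iN by simp
    also have "\<dots> \<le> (\<theta> + (LINT y|torus. (norm (B y - B0 y))\<^sup>2) / \<theta>) / 2"
      using L2_torus_component(2)[OF LD, of i] \<theta> by (intro divide_right_mono add_left_mono) auto
    finally show ?thesis
      using order_trans[OF conv_bound[OF K sqint_integrable[OF sD]] mult_left_mono[OF _ K0]] by blast
  qed
  have "conv n O3 d x = - (\<Sum>i\<in>UNIV. conv n (inc i O3) (\<lambda>y. B y $ i) x)"
    using weak_div_conv[OF B, of n O3 x] by (simp only: minus_minus)
  moreover have "conv n O3 (\<lambda>_. 0) x = 0" by (simp add: conv_def)
  then have "(\<Sum>i\<in>UNIV. conv n (inc i O3) (\<lambda>y. B0 y $ i) x) = 0"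
    using weak_div_conv[OF B0, of n O3 x] by (simp only: minus_zero)
  ultimately have "conv n O3 d x = - (\<Sum>i\<in>UNIV. conv n (inc i O3) (\<lambda>y. (B y - B0 y) $ i) x)"
    unfolding diff sum_subtractf by simp
  then have "\<bar>conv n O3 d x\<bar> \<le> (\<Sum>i\<in>UNIV. \<bar>conv n (inc i O3) (\<lambda>y. (B y - B0 y) $ i) x\<bar>)"
    by (simp only: abs_minus_cancel sum_abs)
  also have "\<dots> \<le> (\<Sum>i\<in>(UNIV::3 set). K * ((\<theta> + (LINT y|torus. (norm (B y - B0 y))\<^sup>2) / \<theta>) / 2))"
    by (intro sum_mono each)
  finally show ?thesis by simp
qed

lemma dt_separated:
  assumes "smooth1 \<eta>" shows "dt (\<lambda>t y. \<eta> t *\<^sub>R \<Phi> y) t y = deriv \<eta> t *\<^sub>R \<Phi> y"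
proof -
  have "(\<eta> has_real_derivative deriv \<eta> t) (at t)" using smooth1_deriv[OF assms, of 0] by simp
  then have "((\<lambda>s. \<eta> s *\<^sub>R \<Phi> y) has_vector_derivative deriv \<eta> t *\<^sub>R \<Phi> y) (at t)"
    by (auto intro!: derivative_eq_intros)
  then show ?thesis unfolding dt_def by (rule vector_derivative_at)
qed

lemma lint_norm_sq_nonneg: "0 \<le> (LINT x|torus. (norm (f x))\<^sup>2)"
  by (intro integral_nonneg_AE AE_I2) simp

theorem theorem7p7:
  fixes \<nu>\<^sub>1 \<nu>\<^sub>2 T :: real
    and u0 B0 :: "real^3 \<Rightarrow> real^3"
    and u B :: "real \<Rightarrow> real^3 \<Rightarrow> real^3"
  assumes "\<nu>\<^sub>1 > 0" and "\<nu>\<^sub>2 > 0" and "T > 0"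
    and "leray_hopf_mhd \<nu>\<^sub>1 \<nu>\<^sub>2 T u0 B0 u B"
    and "has_weak_div B0 (\<lambda>x. 0)"
  shows "spatial_div T B (\<lambda>t x. 0)"
proof -
  interpret time_strip T by unfold_locales (rule assms(3))
  obtain Du DB d where DB: "spatial_grad T B DB" and div: "spatial_div T B d"
    and d: "Linf_L2 T d" "L2_H1 T d" and ind: "induction_eq \<nu>\<^sub>2 T u B DB d"
    using assms(4) unfolding leray_hopf_mhd_def by blast
  have u: "Linf_L2 T u" "L2_H1 T u" and inc: "incompressibility T u" and ini: "attains_initial T B B0"
    using assms(4) unfolding leray_hopf_mhd_def by blast+
  obtain Gd where Gd: "spatial_grad T d Gd"
    and wd: "integrable (tm T) (\<lambda>t. (LINT x|torus. (norm (d t x))\<^sup>2) + (LINT x|torus. (norm (Gd t x))\<^sup>2))"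
    using d(2) unfolding L2_H1_def by blast
  obtain Gu where Gu: "spatial_grad T u Gu"
    and wu: "integrable (tm T) (\<lambda>t. (LINT x|torus. (norm (u t x))\<^sup>2) + (LINT x|torus. (norm (Gu t x))\<^sup>2))"
    using u(2) unfolding L2_H1_def by blast
  have ae: "AE t in tm T. has_weak_grad (d t) (Gd t)" "AE t in tm T. has_weak_grad (B t) (DB t)"
    "AE t in tm T. has_weak_div (B t) (d t)" "AE t in tm T. has_weak_grad (u t) (Gu t)"
    using Gd DB div Gu by (auto simp: spatial_grad_def spatial_div_def)
  have L2: "AE t in tm T. L2_torus (d t)" "AE t in tm T. L2_torus (u t)" "AE t in tm T. L2_torus (Gd t)"
    using ae(1,4) by (auto simp: has_weak_grad_def elim: AE_mp)
  have meas: "st_measurable T d" "st_measurable T u" "st_measurable T Gd"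
    using d(1) u(1) Gd by (auto simp: Linf_L2_def spatial_grad_def)
  have le: "AE t in tm T. (LINT x|torus. (norm (d t x))\<^sup>2) \<le> (LINT x|torus. (norm (d t x))\<^sup>2) + (LINT x|torus. (norm (Gd t x))\<^sup>2)"
    "AE t in tm T. (LINT x|torus. (norm (u t x))\<^sup>2) \<le> (LINT x|torus. (norm (u t x))\<^sup>2) + (LINT x|torus. (norm (Gu t x))\<^sup>2)"
    "AE t in tm T. (LINT x|torus. (norm (Gd t x))\<^sup>2) \<le> (LINT x|torus. (norm (d t x))\<^sup>2) + (LINT x|torus. (norm (Gd t x))\<^sup>2)"
    using lint_norm_sq_nonneg by (auto intro!: AE_I2)
  note comp = bounded_linear_vec_nth component_le_norm_cart
  obtain d' where d': "sqint2 d'" "AE t in tm T. AE x in torus. d t x = d' t x"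
    using sqint2_functional_version[OF meas(1) L2(1) wd le(1) bounded_linear_ident] by auto
  from choice[OF allI[OF sqint2_functional_version[OF meas(2) L2(2) wu le(2) comp]]]
  obtain u' where "\<forall>i. sqint2 (u' i) \<and> (AE t in tm T. AE x in torus. u t x $ i = u' i t x)" ..
  then have u': "\<And>i. sqint2 (u' i)" "\<And>i. AE t in tm T. AE x in torus. u t x $ i = u' i t x" by simp_all
  from choice[OF allI[OF sqint2_functional_version[OF meas(3) L2(3) wd le(3) comp]]]
  obtain G' where "\<forall>i. sqint2 (G' i) \<and> (AE t in tm T. AE x in torus. Gd t x $ i = G' i t x)" ..
  then have G': "\<And>i. sqint2 (G' i)" "\<And>i. AE t in tm T. AE x in torus. Gd t x $ i = G' i t x" by simp_all

  \<comment> \<open>The times at which all fields have their weak derivatives and agree with their representatives.\<close>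
  define good where "good t \<longleftrightarrow> has_weak_grad (d t) (Gd t) \<and> has_weak_grad (B t) (DB t) \<and> has_weak_div (B t) (d t)
    \<and> has_weak_grad (u t) (Gu t) \<and> (AE x in torus. d t x = d' t x) \<and> (\<forall>i. AE x in torus. u t x $ i = u' i t x)
    \<and> (\<forall>i. AE x in torus. Gd t x $ i = G' i t x) \<and> sqint (d' t) \<and> (\<forall>i. sqint (u' i t)) \<and> (\<forall>i. sqint (G' i t))" for t
  have good: "AE t in tm T. good t"
    unfolding good_def AE_conj_iff AE_all_countable
    using ae d'(2) u'(2) G'(2) sqint2_section[OF d'(1)] sqint2_section[OF u'(1)] sqint2_section[OF G'(1)] by blast
  have goodD: "conv n m (d t) x = conv n m (d' t) x" "conv n m (\<lambda>y. u t y $ i) x = conv n m (u' i t) x"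
    "conv n m (\<lambda>y. Gd t y $ i) x = conv n m (G' i t) x"
    "conv n m (\<lambda>y. d t y * u t y $ i) x = conv n m (\<lambda>y. d' t y * u' i t y) x"
    if g: "good t" for t n m i x
  proof -
    have L: "L2_torus (d t)" "L2_torus (u t)" "L2_torus (Gd t)"
      using g by (auto simp: good_def has_weak_grad_def)
    have [measurable]: "d t \<in> borel_measurable torus" using L by (simp add: L2_torus_def)
    note [measurable] = sqint_measurable[OF L2_torus_component(1)[OF L(2)], of i]
      sqint_measurable[OF L2_torus_component(1)[OF L(3)], of i]
    have [measurable]: "d' t \<in> borel_measurable torus" "u' i t \<in> borel_measurable torus" "G' i t \<in> borel_measurable torus"
      using g by (auto simp: good_def intro: sqint_measurable)
    have e: "AE x in torus. d t x = d' t x" "AE x in torus. u t x $ i = u' i t x" "AE x in torus. Gd t x $ i = G' i t x"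
      using g by (auto simp: good_def)
    show "conv n m (d t) x = conv n m (d' t) x" by (rule conv_cong_AE[OF e(1)]) measurable
    show "conv n m (\<lambda>y. u t y $ i) x = conv n m (u' i t) x" by (rule conv_cong_AE[OF e(2)]) measurable
    show "conv n m (\<lambda>y. Gd t y $ i) x = conv n m (G' i t) x" by (rule conv_cong_AE[OF e(3)]) measurable
    show "conv n m (\<lambda>y. d t y * u t y $ i) x = conv n m (\<lambda>y. d' t y * u' i t y) x"
    proof (rule conv_cong_AE)
      show "AE y in torus. d t y * u t y $ i = d' t y * u' i t y"
        using e(1,2) by eventually_elim simp
    qed measurable
  qed
  have tmeas: "\<eta> \<in> borel_measurable (tm T)" "deriv \<eta> \<in> borel_measurable (tm T)" if "smooth1 \<eta>" for \<eta>
    using smooth1_continuous[OF that, of UNIV 0] smooth1_continuous[OF that, of UNIV 1]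
    by (auto intro!: borel_measurable_tm borel_measurable_continuous_onI)
  have CVm: "(\<lambda>t. conv n m (d' t) x) \<in> borel_measurable (tm T)" "(\<lambda>t. conv n m (u' i t) x) \<in> borel_measurable (tm T)"
    "(\<lambda>t. conv n m (\<lambda>y. d' t y * u' i t y) x) \<in> borel_measurable (tm T)" for n m x i
    using integrable_conv_time[OF sqint2_integrable[OF d'(1)]] integrable_conv_time[OF sqint2_integrable[OF u'(1)]]
      integrable_conv_time[of "\<lambda>t y. d' t y * u' i t y", OF sqint2_mult[OF d'(1) u'(1)]]
    by (blast intro: borel_measurable_integrable)+

  interpret advection_diffusion T \<nu>\<^sub>2 d' u' G'
  proof unfold_locales
    show "0 \<le> \<nu>\<^sub>2" using assms(2) by simp
    show "sqint2 d'" "\<And>i. sqint2 (u' i)" "\<And>i. sqint2 (G' i)" by (fact d' u' G')+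
    show "AE t in tm T. \<forall>n i m x. conv n (inc i m) (d' t) x = - conv n m (G' i t) x"
      using good
    proof eventually_elim
      case (elim t)
      then have "has_weak_grad (d t) (Gd t)" by (simp add: good_def)
      from weak_grad_conv[OF this] show ?case unfolding goodD[OF elim] by blast
    qed
  next
    fix \<eta> :: "real \<Rightarrow> real" and a b n x
    assume \<eta>: "smooth1 \<eta>" and ab: "0 < a" "b < T" and supp: "\<And>t. t \<notin> {a..b} \<Longrightarrow> \<eta> t = 0"
    have zero: "(LINT t|tm T. LINT y|torus. u t y \<bullet> grad (\<lambda>y. \<eta> t *\<^sub>R kersum n (\<lambda>_::unit. O3) (\<lambda>_. 1::real) x O3 y) y) = 0"
      using inc test_fun_kersum[OF \<eta> ab supp] unfolding incompressibility_def by blast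
    have ae: "AE t in tm T. (LINT y|torus. u t y \<bullet> grad (\<lambda>y. \<eta> t *\<^sub>R kersum n (\<lambda>_::unit. O3) (\<lambda>_. 1::real) x O3 y) y)
        = \<eta> t * (\<Sum>i\<in>UNIV. conv n (inc i O3) (u' i t) x)"
      using good
    proof eventually_elim
      case (elim t)
      then have "L2_torus (u t)" by (simp add: good_def has_weak_grad_def)
      from incompressibility_tested[OF this] show ?case unfolding goodD(2)[OF elim] .
    qed
    have "(\<lambda>t. \<eta> t * (\<Sum>i\<in>UNIV. conv n (inc i O3) (u' i t) x)) \<in> borel_measurable (tm T)"
      by (intro borel_measurable_times borel_measurable_sum tmeas \<eta> CVm)
    from lint_tm_cong_AE[OF this ae] zero
    show "(LINT t|tm T. \<eta> t * (\<Sum>i\<in>UNIV. conv n (inc i O3) (u' i t) x)) = 0" by (rule trans[OF sym])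
  next
    fix \<eta> :: "real \<Rightarrow> real" and a b n x
    assume \<eta>: "smooth1 \<eta>" and ab: "0 < a" "b < T" and supp: "\<And>t. t \<notin> {a..b} \<Longrightarrow> \<eta> t = 0"
    let ?rhs = "\<lambda>t. - (deriv \<eta> t * conv n O3 (d' t) x + \<eta> t * advdiff \<nu>\<^sub>2 (d' t) (\<lambda>i. u' i t) n x)"
    let ?\<psi> = "\<lambda>t y. \<eta> t *\<^sub>R kgrad n x y"
    have "test_fun T ?\<psi>"
      unfolding kgrad_def by (rule test_fun_kersum[OF \<eta> ab supp])
    then have zero: "(LINT t|tm T. LINT y|torus. B t y \<bullet> dt ?\<psi> t y - \<nu>\<^sub>2 * (DB t y \<bullet> grad (?\<psi> t) y)
        + outer (u t y) (B t y) \<bullet> grad (?\<psi> t) y - outer (B t y) (u t y) \<bullet> grad (?\<psi> t) y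
        - d t y * (u t y \<bullet> ?\<psi> t y)) = 0"
      using ind unfolding induction_eq_def by blast
    have ae: "AE t in tm T. (LINT y|torus. B t y \<bullet> dt ?\<psi> t y - \<nu>\<^sub>2 * (DB t y \<bullet> grad (?\<psi> t) y)
        + outer (u t y) (B t y) \<bullet> grad (?\<psi> t) y - outer (B t y) (u t y) \<bullet> grad (?\<psi> t) y
        - d t y * (u t y \<bullet> ?\<psi> t y)) = ?rhs t"
      using good
    proof eventually_elim
      case (elim t)
      then have "L2_torus (u t)" "has_weak_grad (B t) (DB t)" "has_weak_div (B t) (d t)"
        by (auto simp: good_def has_weak_grad_def)
      from induction_tested[OF this, of "deriv \<eta> t" n x \<nu>\<^sub>2 "\<eta> t"]
      show ?case unfolding dt_separated[OF \<eta>] advdiff_def goodD[OF elim] .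
    qed
    have "?rhs \<in> borel_measurable (tm T)"
      unfolding advdiff_def
      by (intro borel_measurable_uminus borel_measurable_add borel_measurable_times borel_measurable_sum
        borel_measurable_const tmeas \<eta> CVm)
    from lint_tm_cong_AE[OF this ae] zero
    have "(LINT t|tm T. ?rhs t) = 0" by (rule trans[OF sym])
    then show "(LINT t|tm T. deriv \<eta> t * conv n O3 (d' t) x + \<eta> t * advdiff \<nu>\<^sub>2 (d' t) (\<lambda>i. u' i t) n x) = 0"
      by (simp only: integral_minus neg_equal_0_iff_equal)
  next
    fix n x and \<epsilon> :: real assume \<epsilon>: "\<epsilon> > 0"
    have "\<forall>i. \<exists>C. \<forall>z. \<bar>Ker n (inc i O3) z\<bar> \<le> C" using Ker_bounded by blast
    then obtain C where C: "\<And>i z. \<bar>Ker n (inc i O3) z\<bar> \<le> C i" by metis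
    define K where "K = (\<Sum>i\<in>UNIV. \<bar>C i\<bar>) + 1"
    have K: "\<bar>Ker n (inc i O3) z\<bar> \<le> K" for i z
    proof -
      have "\<bar>C i\<bar> \<le> (\<Sum>i\<in>UNIV. \<bar>C i\<bar>)" by (rule member_le_sum) auto
      then show ?thesis using C[of i z] unfolding K_def by linarith
    qed
    have "K > 0" unfolding K_def by (intro add_nonneg_pos sum_nonneg) auto
    define \<theta> where "\<theta> = \<epsilon> / (3 * K)"
    have \<theta>: "\<theta> > 0" "3 * (K * \<theta>) = \<epsilon>" using \<epsilon> \<open>K > 0\<close> by (simp_all add: \<theta>_def)
    obtain \<delta> where \<delta>: "\<delta> > 0" "AE t in tm T. t < \<delta> \<longrightarrow> sqrt (LINT x|torus. (norm (B t x - B0 x))\<^sup>2) < \<theta>"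
      using ini \<theta>(1) unfolding attains_initial_def by blast
    have "AE t in tm T. t < \<delta> \<longrightarrow> \<bar>conv n O3 (d' t) x\<bar> < \<epsilon>"
      using good \<delta>(2)
    proof eventually_elim
      case (elim t)
      show ?case
      proof
        assume "t < \<delta>"
        let ?I = "LINT x|torus. (norm (B t x - B0 x))\<^sup>2"
        have "sqrt ?I < \<theta>" using elim(2) \<open>t < \<delta>\<close> by blast
        also have "\<theta> = sqrt (\<theta>\<^sup>2)" using \<theta>(1) by simp
        finally have "?I < \<theta>\<^sup>2" by (simp only: real_sqrt_less_iff)
        then have "?I / \<theta> < \<theta>" using \<theta>(1) by (simp add: field_simps power2_eq_square)
        then have "(\<theta> + ?I / \<theta>) / 2 < \<theta>" by simp
        then have "K * ((\<theta> + ?I / \<theta>) / 2) < K * \<theta>" using \<open>K > 0\<close> by (rule mult_strict_left_mono)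
        moreover have "\<bar>conv n O3 (d t) x\<bar> \<le> 3 * (K * ((\<theta> + ?I / \<theta>) / 2))"
          by (rule mollified_div_bound[OF _ assms(5) K \<theta>(1)]) (use elim(1) in \<open>simp add: good_def\<close>)
        ultimately show "\<bar>conv n O3 (d' t) x\<bar> < \<epsilon>"
          using \<theta>(2) goodD(1)[OF elim(1), of n O3 x] by linarith
      qed
    qed
    then show "\<exists>\<delta>>0. AE t in tm T. t < \<delta> \<longrightarrow> \<bar>conv n O3 (d' t) x\<bar> < \<epsilon>" using \<delta>(1) by blast
  qed

  have "AE t in tm T. has_weak_div (B t) (\<lambda>x. 0)"
    using good solution_zero
  proof eventually_elim
    case (elim t)
    have w: "has_weak_div (B t) (d t)" using elim(1) by (simp add: good_def)
    have "AE x in torus. d t x = d' t x" using elim(1) by (simp add: good_def)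
    with elim(2) have z: "AE x in torus. d t x = 0" by eventually_elim simp
    have "(LINT x|torus. d t x * \<phi> x) = 0" for \<phi>
      by (rule integral_eq_zero_AE) (use z in \<open>eventually_elim, simp\<close>)
    then show ?case
      using w by (simp add: has_weak_div_def L2_torus_def periodic_def)
  qed
  then show ?thesis
    by (simp add: spatial_div_def st_measurable_def)
qed

end
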